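(* Let $H,G\ge 0$ be integers and let $L_1,\dots,L_{H+G}$ be elements of $\mathcal{S}_{\text{poly}}$ satisfying the Ramanujan Hypothesis and such that for all $g,h\le H+G$ \[ \frac{\log x}{x}\sum_{p\le x}a_{L_h}(p)\overline{a_{L_g}(p)}\longrightarrow \kappa(h,g)\quad (x\to+\infty), \] with $\kappa(h,h)>0$ and $\kappa(h,g)=0$ for $h\ne g$. Suppose there are $\sigma_0\in(1/2,1)$ and $\alpha\in(0,1)$ with $\sum_{h\le H+G}N_{L_h}(\sigma_0,T)=o(T^{1-\alpha})$ as $T\to\infty$. Then there is $D>0$ such that for any $\sigma\in(\sigma_0,1)$ and any sufficiently large $T$, \[ \max_{t\in[T,2T]}\min\left\{\min_{h\le H}|L_h(\sigma+it)|,\ \max_{H<h\le H+G}|L_h(\sigma+it)|^{-1}\right\}\ \ge\ \exp\left(D\frac{(\log T)^{1-\sigma}}{\log\log T}\right). \] For $\sigma=1$ the same holds with the right-hand side replaced by $(\log\log T)^{D}$.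
   Context: The class $\mathcal{S}$ consists of Dirichlet series $L(s)=\sum_{n\ge1}a_L(n)n^{-s}$ with $a_L(1)=1$, absolutely convergent for $\mathrm{Re}\,s>1$, such that: (I) for some integer $m\ge0$, $(s-1)^mL(s)$ is entire of finite order; (II) $L(s)\gamma(s)=\omega\overline{\gamma(1-\bar s)L(1-\bar s)}$ with $\gamma(s)=Q^s\prod_{k\le K}\Gamma(\lambda_ks+\mu_k)$, $Q,\lambda_k>0$, $\mu_k\in\mathbb{C}$, $|\omega|=1$; (III) $L(s)=\prod_p\exp(\sum_{\nu\ge1}b(p^\nu)p^{-\nu s})$ for $\mathrm{Re}\,s>1$ with $b(p^\nu)\ll p^{\nu\theta_L}$ for some $\theta_L<1/2$. The subclass $\mathcal{S}_{\text{poly}}$ consists of those $L\in\mathcal{S}$ with $L(s)=\prod_p\prod_{j\le\partial_L}(1-a_{L,j}(p)p^{-s})^{-1}$ for some integer $\partial_L\ge0$ and $a_{L,j}(p)\ll p^{\theta_L}$ with $\theta_L<1/4$. $L$ satisfies the Ramanujan Hypothesis if $a_L(n)\ll_\epsilon n^{\epsilon}$ for every $\epsilon>0$. For $\sigma>1/2$, $N_L(\sigma,T)=\#\{\rho: L(\rho)=0,\ T\le\mathrm{Im}\rho\le2T,\ \mathrm{Re}\rho\ge\sigma\}$. Here $p$ runs over primes. *)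

theory Defs
  imports "HOL-Analysis.Analysis" "HOL-Computational_Algebra.Primes"
begin

text \<open>An element L of the Selberg class is represented by the pair (a, f):
  a :: nat => complex is the coefficient sequence a_L(n) (a 0 is irrelevant),
  f :: complex => complex is the (meromorphically continued) function L(s).\<close>

definition gamma_factor :: "real \<Rightarrow> nat \<Rightarrow> (nat \<Rightarrow> real) \<Rightarrow> (nat \<Rightarrow> complex) \<Rightarrow> complex \<Rightarrow> complex" where
  "gamma_factor Q K lam mu s =
     complex_of_real Q powr s * (\<Prod>k<K. Gamma (complex_of_real (lam k) * s + mu k))"

definition selberg_class :: "(nat \<Rightarrow> complex) \<Rightarrow> (complex \<Rightarrow> complex) \<Rightarrow> bool" where
  "selberg_class a f \<longleftrightarrow>
     a 1 = 1 \<and>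
     \<comment> \<open>absolutely convergent Dirichlet series for Re s > 1\<close>
     (\<forall>s. Re s > 1 \<longrightarrow>
        summable (\<lambda>n. norm (a n / of_nat n powr s)) \<and>
        (\<lambda>n. a n / of_nat n powr s) sums f s) \<and>
     \<comment> \<open>(I) (s-1)^m L(s) is entire of finite order\<close>
     (\<exists>m::nat. \<exists>g. g holomorphic_on UNIV \<and>
        (\<forall>s. s \<noteq> 1 \<longrightarrow> f s = g s / (s - 1) ^ m) \<and>
        (\<exists>\<rho> C. \<forall>s. norm (g s) \<le> C * exp (norm s powr \<rho>))) \<and>
     \<comment> \<open>(II) functional equation (as an identity of meromorphic functions)\<close>
     (\<exists>Q K lam mu \<omega>. Q > 0 \<and> (\<forall>k<K. lam k > 0) \<and> norm \<omega> = 1 \<and>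
        (\<forall>\<^sub>\<approx>s. f s * gamma_factor Q K lam mu s =
            \<omega> * cnj (gamma_factor Q K lam mu (1 - cnj s) * f (1 - cnj s)))) \<and>
     \<comment> \<open>(III) Euler product\<close>
     (\<exists>b :: nat \<Rightarrow> complex. \<exists>\<theta> C. \<theta> < 1/2 \<and>
        (\<forall>p \<nu>. prime p \<longrightarrow> \<nu> \<ge> 1 \<longrightarrow> norm (b (p ^ \<nu>)) \<le> C * real p powr (real \<nu> * \<theta>)) \<and>
        (\<forall>s. Re s > 1 \<longrightarrow>
           (\<lambda>p. if prime p then
                   exp (\<Sum>\<nu>. b (p ^ Suc \<nu>) / of_nat p powr (of_nat (Suc \<nu>) * s))
                 else 1) has_prod f s))"

definition selberg_poly :: "(nat \<Rightarrow> complex) \<Rightarrow> (complex \<Rightarrow> complex) \<Rightarrow> bool" where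
  "selberg_poly a f \<longleftrightarrow> selberg_class a f \<and>
     (\<exists>d::nat. \<exists>aj :: nat \<Rightarrow> nat \<Rightarrow> complex. \<exists>\<theta> C. \<theta> < 1/4 \<and>
        (\<forall>j<d. \<forall>p. prime p \<longrightarrow> norm (aj j p) \<le> C * real p powr \<theta>) \<and>
        (\<forall>s. Re s > 1 \<longrightarrow>
           (\<lambda>p. if prime p then (\<Prod>j<d. inverse (1 - aj j p / of_nat p powr s)) else 1)
             has_prod f s))"

definition ramanujan :: "(nat \<Rightarrow> complex) \<Rightarrow> bool" where
  "ramanujan a \<longleftrightarrow> (\<forall>\<epsilon>>0. \<exists>C. \<forall>n\<ge>1. norm (a n) \<le> C * real n powr \<epsilon>)"

definition zero_count :: "(complex \<Rightarrow> complex) \<Rightarrow> real \<Rightarrow> real \<Rightarrow> nat" where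
  "zero_count f \<sigma> T = card {\<rho>. f \<rho> = 0 \<and> T \<le> Im \<rho> \<and> Im \<rho> \<le> 2 * T \<and> Re \<rho> \<ge> \<sigma>}"

text \<open>The value
  max over t in [T,2T] of min{ min_{h<=H} |L_h(sigma+it)|, max_{H<h<=H+G} |L_h(sigma+it)|^-1 }
  is at least X (X > 0).  A factor |L_h|^-1 with L_h = 0 is +infinity, hence
  |L_h|^-1 >= X is written |L_h| * X <= 1; an empty max (G = 0) is omitted.\<close>
definition big_values :: "(nat \<Rightarrow> complex \<Rightarrow> complex) \<Rightarrow> nat \<Rightarrow> nat \<Rightarrow> real \<Rightarrow> real \<Rightarrow> real \<Rightarrow> bool" where
  "big_values F H G \<sigma> T X \<longleftrightarrow>
     (\<exists>t\<in>{T..2*T}.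
        (\<forall>h\<in>{1..H}. norm (F h (Complex \<sigma> t)) \<ge> X) \<and>
        (G = 0 \<or> (\<exists>h\<in>{H+1..H+G}. norm (F h (Complex \<sigma> t)) * X \<le> 1)))"

end

theory Submission
  imports Defs "HOL-Complex_Analysis.Complex_Analysis" "HOL-Real_Asymp.Real_Asymp"
begin

text \<open>
  Weight \<open>[T, 2T]\<close> by the Riesz product \<open>R(t)\<close> with factors \<open>1 + Re (cnj c\<^sub>p p\<^bsup>-it\<^esup>)\<close> over the
  primes \<open>p \<le> X\<close>, where \<open>X\<close> is a small multiple of \<open>log T\<close> and \<open>|c\<^sub>p| \<le> 1\<close>. The frequencies
  occurring are logarithms of rationals of height \<open>T\<^bsup>o(1) + small\<^esup>\<close>, so under this measure the
  numbers \<open>p\<^bsup>-it\<^esup>\<close> behave like independent random variables with mean \<open>c\<^sub>p / 2\<close>. Hence every sum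
  \<open>Re \<Sum> a(p) p\<^bsup>-\<sigma>-it\<^esup>\<close> has mean \<open>Re \<Sum> a(p) c\<^sub>p p\<^bsup>-\<sigma>\<^esup> / 2\<close> and, as \<open>\<sigma> > 1/2\<close>, bounded variance.
  Taking for \<open>c\<^sub>p\<close> a signed combination of the conjugates of the \<open>a\<^sub>g(p)\<close>, orthogonality makes the
  means large with prescribed signs, simultaneously for all functions.

  Since \<open>R \<le> 2\<^sup>X\<close> is a small power of \<open>T\<close>, the zero-density hypothesis makes the points near a zero
  negligible for this measure. Away from zeros, \<open>log L\<close> is \<open>O(log T)\<close> on a disc around \<open>4 + it\<close>
  (polynomial growth from the functional equation and Phragmen-Lindeloef, then Borel-Caratheodory),
  so its Taylor polynomial of degree about \<open>(log T)\<^bsup>1/2\<^esup>\<close> at \<open>4 + it\<close> approximates it at \<open>\<sigma> + it\<close>; this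
  polynomial is a smoothly weighted sum over primes. The Ramanujan hypothesis enters through
  \<open>|a\<^sub>j(p)| \<le> 1\<close>, which makes the prime powers contribute \<open>O(1)\<close>.
\<close>

text \<open>The bound has the size of the sum of p^(-\<sigma>) over p \<le> X, and X cannot exceed a
  multiple of log T, because the frequencies have denominators that are powers of a primorial, of
  size exp (O(X)), and these must stay below T. Two conditions fix the multiple \<alpha>/10: the
  error terms carry 128^X, where 128 = 4^3 * 2 combines the cube of the primorial bound 4^X with the
  total coefficient size 2^X of the Riesz product; and 2^X times o(T^(1-\<alpha>)) zeros must be
  o(T).

  The obstacle is that log L is approximated by a sum over primes up to some Z far beyond X, on
  which the weight has no influence. These primes enter only through the variance, with an error Z^8
  * 128^X, so Z must be T^o(1). A Taylor polynomial of degree N amplifies the tail of the Euler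
  product by about 8^N and so forces Z to be exponential in N, while its remainder O(q^N * log T)
  forces N to exceed a multiple of log log T. An N of order (log T)^(1/2) satisfies both.\<close>

section \<open>Growth in vertical strips\<close>

text \<open>Takes the place of Stirling's formula. By Gauss's product the quotient is a limit of
  finite products of u / |u + iy| with u = x + k, and no such factor decreases as u grows.\<close>

lemma norm_Gamma_quotient_mono:
  fixes x x' y :: real
  assumes "0 < x" "x \<le> x'"
  shows "norm (Gamma (Complex x y)) / Gamma x \<le> norm (Gamma (Complex x' y)) / Gamma x'"
proof -
  define q where "q n u = norm (Gamma_series (Complex u y) n) / Gamma_series u n" for n :: nat and u :: real
  have lim: "(\<lambda>n. q n u) \<longlonglongrightarrow> norm (Gamma (Complex u y)) / Gamma u" if "u > 0" for u
    unfolding q_def using Gamma_real_pos[OF that]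
    by (intro tendsto_divide tendsto_norm Gamma_series_LIMSEQ) auto
  have q: "q n u = (\<Prod>k\<le>n. (u + k) / norm (Complex u y + k))" if "u > 0" for n :: nat and u :: real
  proof -
    have "q n u = norm (pochhammer u (Suc n)) / norm (pochhammer (Complex u y) (Suc n))"
      using that pochhammer_pos[OF that, of "Suc n"]
      by (auto simp: q_def Gamma_series_def norm_divide norm_mult abs_mult)
    also have "\<dots> = (\<Prod>k\<le>n. (u + k) / norm (Complex u y + k))"
      using that unfolding pochhammer_prod
      by (simp add: prod_dividef atLeast0LessThan lessThan_Suc_atMost abs_prod prod_norm
                    add_pos_nonneg abs_of_pos)
    finally show ?thesis .
  qed
  have le: "q n x \<le> q n x'" for n
  proof -
    have "(x + k) / norm (Complex x y + k) \<le> (x' + k) / norm (Complex x' y + k)" for k :: nat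
    proof -
      define u v where "u = x + k" and "v = x' + k"
      have uv: "0 < u" "u \<le> v" using assms by (auto simp: u_def v_def)
      have n: "norm (Complex x y + k) = sqrt (u^2 + y^2)" "norm (Complex x' y + k) = sqrt (v^2 + y^2)"
        by (simp_all add: cmod_def u_def v_def)
      have "u * sqrt (v^2 + y^2) = sqrt (u^2 * v^2 + u^2 * y^2)"
        using uv by (simp add: real_sqrt_mult flip: distrib_left)
      also have "\<dots> \<le> sqrt (v^2 * u^2 + v^2 * y^2)"
        using uv by (intro real_sqrt_le_mono add_mono mult_right_mono power_mono) (auto simp: mult.commute)
      also have "\<dots> = v * sqrt (u^2 + y^2)"
        using uv by (simp add: real_sqrt_mult flip: distrib_left)
      finally have "u / sqrt (u^2 + y^2) \<le> v / sqrt (v^2 + y^2)"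
        using uv by (subst frac_le_eq) (auto intro!: divide_nonpos_pos mult_pos_pos simp: add_pos_nonneg)
      then show ?thesis by (simp add: n flip: u_def v_def)
    qed
    then show ?thesis
      using assms unfolding q[OF assms(1)] q[OF order.strict_trans2[OF assms]]
      by (intro prod_mono) auto
  qed
  show ?thesis
    by (rule LIMSEQ_le[OF lim lim]) (use assms le in auto)
qed

lemma Gamma_add_of_nat:
  fixes z :: complex
  assumes "Im z \<noteq> 0"
  shows "Gamma (z + of_nat n) = pochhammer z n * Gamma z"
proof -
  have "z \<notin> \<int>\<^sub>\<le>\<^sub>0" using assms by (auto elim!: nonpos_Ints_cases)
  then show ?thesis by (simp add: pochhammer_Gamma Gamma_eq_zero_iff)
qed

text \<open>Shifting the left-hand argument to the right only increases the modulus, since every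
  factor of the Pochhammer symbol is at least y \<ge> 1 in modulus; shifting the right-hand one
  costs a factor at most \<open>M * y\<close> per step. Once both real parts are positive and
  suitably ordered, \<open>norm_Gamma_quotient_mono\<close> compares them. The power of y pays for
  the \<open>n2\<close> steps on the right.\<close>

lemma norm_Gamma_le_power:
  fixes x x' :: real
  obtains C :: real and n :: nat where "C > 0"
    "\<And>y. y \<ge> 1 \<Longrightarrow> norm (Gamma (Complex x y)) \<le> C * y ^ n * norm (Gamma (Complex x' y))"
proof -
  obtain n1 :: nat where "- x < n1" using reals_Archimedean2 by blast
  then have n1: "x + n1 > 0" by simp
  obtain n2 :: nat where "x + n1 - x' < n2" using reals_Archimedean2 by blast
  then have n2: "x' + n2 > x + n1" by simp
  define B where "B = Gamma (x + n1) / Gamma (x' + n2)"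
  define M where "M = \<bar>x'\<bar> + n2 + 1"
  have B: "B > 0" using n1 n2 by (auto simp: B_def intro!: divide_pos_pos Gamma_real_pos)
  have M: "M > 0" by (simp add: M_def add_nonneg_pos)
  show ?thesis
  proof (rule that[of "B * M ^ n2" n2])
    show "B * M ^ n2 > 0" using B M by simp
    fix y :: real assume y: "y \<ge> 1"
    have a: "norm (Gamma (Complex x y)) \<le> norm (Gamma (Complex (x + n1) y))"
    proof -
      have e: "Complex (x + n1) y = Complex x y + of_nat n1" by (simp add: complex_eq_iff)
      have "1 \<le> (\<Prod>k<n1. norm (Complex x y + k))"
      proof (rule prod_ge_1)
        fix k
        have "y \<le> norm (Complex x y + of_nat k)"
          using abs_Im_le_cmod[of "Complex x y + of_nat k"] by simp
        then show "1 \<le> norm (Complex x y + of_nat k)" using y by simp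
      qed
      then have "1 \<le> norm (pochhammer (Complex x y) n1)"
        by (simp add: pochhammer_prod prod_norm atLeast0LessThan)
      then show ?thesis using y unfolding e
        by (subst Gamma_add_of_nat) (auto simp: norm_mult mult_le_cancel_right1)
    qed
    have "norm (Gamma (Complex (x + n1) y)) / Gamma (x + n1) \<le>
          norm (Gamma (Complex (x' + n2) y)) / Gamma (x' + n2)"
      using n1 n2 by (intro norm_Gamma_quotient_mono) auto
    then have b: "norm (Gamma (Complex (x + n1) y)) \<le> B * norm (Gamma (Complex (x' + n2) y))"
      using Gamma_real_pos[OF n1] by (simp add: B_def field_simps)
    have c: "norm (Gamma (Complex (x' + n2) y)) \<le> (M * y) ^ n2 * norm (Gamma (Complex x' y))"
    proof -
      have e: "Complex (x' + n2) y = Complex x' y + of_nat n2" by (simp add: complex_eq_iff)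
      have "(\<Prod>k<n2. norm (Complex x' y + k)) \<le> (\<Prod>k<n2. M * y)"
      proof (intro prod_mono conjI)
        fix k assume k: "k \<in> {..<n2}"
        have "norm (Complex x' y + of_nat k) \<le> \<bar>x' + k\<bar> + \<bar>y\<bar>"
          using cmod_le[of "Complex x' y + of_nat k"] by simp
        also have "\<dots> \<le> (\<bar>x'\<bar> + n2) * 1 + 1 * y" using k y by auto
        also have "\<dots> \<le> (\<bar>x'\<bar> + n2) * y + 1 * y" using y by (intro add_mono mult_left_mono) auto
        also have "\<dots> = M * y" by (simp add: M_def algebra_simps)
        finally show "norm (Complex x' y + of_nat k) \<le> M * y" .
      qed auto
      then have "norm (pochhammer (Complex x' y) n2) \<le> (M * y) ^ n2"
        by (simp add: pochhammer_prod prod_norm atLeast0LessThan)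
      then show ?thesis using y unfolding e
        by (subst Gamma_add_of_nat) (auto simp: norm_mult intro: mult_right_mono)
    qed
    have "norm (Gamma (Complex x y)) \<le> B * norm (Gamma (Complex (x' + n2) y))"
      using a b by linarith
    also have "\<dots> \<le> B * ((M * y) ^ n2 * norm (Gamma (Complex x' y)))"
      using B c by (intro mult_left_mono) auto
    finally show "norm (Gamma (Complex x y)) \<le> B * M ^ n2 * y ^ n2 * norm (Gamma (Complex x' y))"
      by (simp add: power_mult_distrib mult_ac)
  qed
qed

text \<open>The last conclusion is recorded because it keeps the arguments of Gamma off the poles
  throughout Im s \<ge> t0.\<close>

lemma gamma_factor_quotient_le:
  fixes x x' :: real
  assumes Q: "Q > 0" and lam: "\<And>k. k < K \<Longrightarrow> lam k > 0"
  obtains C t0 :: real and n :: nat where "C > 0" "t0 \<ge> 1"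
    "\<And>t. t \<ge> t0 \<Longrightarrow> norm (gamma_factor Q K lam mu (Complex x t)) \<le>
        C * t ^ n * norm (gamma_factor Q K lam mu (Complex x' t))"
    "\<And>k s. k < K \<Longrightarrow> Im s \<ge> t0 \<Longrightarrow> Im (complex_of_real (lam k) * s + mu k) > 0"
proof -
  \<comment> \<open>Each summand is the height from which one Gamma argument has imaginary part at
    least 1; the sum dominates all of them at once.\<close>
  define t0 where "t0 = 1 + (\<Sum>k<K. (1 + \<bar>Im (mu k)\<bar>) / lam k)"
  have t0: "t0 \<ge> 1" using lam by (auto simp: t0_def intro!: sum_nonneg divide_nonneg_pos)
  have im: "lam k * t + Im (mu k) \<ge> 1" if "k < K" "t \<ge> t0" for k t
  proof -
    have "(1 + \<bar>Im (mu k)\<bar>) / lam k \<le> (\<Sum>k<K. (1 + \<bar>Im (mu k)\<bar>) / lam k)"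
      using that lam by (intro member_le_sum) (auto intro!: divide_nonneg_pos)
    then have "(1 + \<bar>Im (mu k)\<bar>) / lam k \<le> t" using that by (simp add: t0_def)
    then show ?thesis using lam[OF that(1)] by (simp add: field_simps)
  qed
  have "\<exists>C n. C > 0 \<and> (\<forall>t\<ge>t0. norm (Gamma (complex_of_real (lam k) * Complex x t + mu k)) \<le>
      C * t ^ n * norm (Gamma (complex_of_real (lam k) * Complex x' t + mu k)))"
    if k: "k < K" for k
  proof -
    obtain C n where C: "C > 0" "\<And>y. y \<ge> 1 \<Longrightarrow> norm (Gamma (Complex (lam k * x + Re (mu k)) y)) \<le>
       C * y ^ n * norm (Gamma (Complex (lam k * x' + Re (mu k)) y))"
      using norm_Gamma_le_power[where x = "lam k * x + Re (mu k)" and x' = "lam k * x' + Re (mu k)"]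
      by metis
    define M where "M = lam k + \<bar>Im (mu k)\<bar>"
    have M: "M > 0" using lam[OF k] by (simp add: M_def)
    have "norm (Gamma (complex_of_real (lam k) * Complex x t + mu k)) \<le>
      C * M ^ n * t ^ n * norm (Gamma (complex_of_real (lam k) * Complex x' t + mu k))"
      if t: "t \<ge> t0" for t
    proof -
      define y where "y = lam k * t + Im (mu k)"
      have y: "1 \<le> y" using im[OF k t] by (simp add: y_def)
      have e: "complex_of_real (lam k) * Complex u t + mu k = Complex (lam k * u + Re (mu k)) y" for u
        by (simp add: complex_eq_iff y_def)
      have "Im (mu k) \<le> \<bar>Im (mu k)\<bar> * t"
        using t0 t mult_left_mono[of 1 t "\<bar>Im (mu k)\<bar>"] by linarith
      then have "y \<le> M * t" by (simp add: y_def M_def algebra_simps)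
      then have "y ^ n \<le> (M * t) ^ n" using y by (intro power_mono) auto
      then have "C * y ^ n * norm (Gamma (Complex (lam k * x' + Re (mu k)) y)) \<le>
         C * (M * t) ^ n * norm (Gamma (Complex (lam k * x' + Re (mu k)) y))"
        using C by (intro mult_right_mono mult_left_mono) auto
      then show ?thesis unfolding e using C(2)[OF y] by (simp add: power_mult_distrib)
    qed
    then show ?thesis using C M by (intro exI[of _ "C * M ^ n"] exI[of _ n]) auto
  qed
  then obtain C n where C: "\<And>k. k < K \<Longrightarrow> C k > (0::real)"
    "\<And>k t. k < K \<Longrightarrow> t \<ge> t0 \<Longrightarrow> norm (Gamma (complex_of_real (lam k) * Complex x t + mu k)) \<le>
      C k * t ^ n k * norm (Gamma (complex_of_real (lam k) * Complex x' t + mu k))"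
    by metis
  show ?thesis
  proof (rule that[of "Q powr (x - x') * (\<Prod>k<K. C k)" t0 "\<Sum>k<K. n k"])
    show "Q powr (x - x') * (\<Prod>k<K. C k) > 0" using Q C by (auto intro!: mult_pos_pos prod_pos)
    show "t0 \<ge> 1" by fact
    fix t assume t: "t \<ge> t0"
    have n: "norm (complex_of_real Q powr Complex u t) = Q powr u" for u
      using Q by (simp add: norm_powr_real_powr)
    have "(\<Prod>k<K. norm (Gamma (complex_of_real (lam k) * Complex x t + mu k))) \<le>
       (\<Prod>k<K. C k * t ^ n k * norm (Gamma (complex_of_real (lam k) * Complex x' t + mu k)))"
      using C t by (intro prod_mono) auto
    also have "\<dots> = (\<Prod>k<K. C k) * t ^ (\<Sum>k<K. n k) *
        (\<Prod>k<K. norm (Gamma (complex_of_real (lam k) * Complex x' t + mu k)))"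
      by (simp add: prod.distrib power_sum)
    finally have "Q powr x * (\<Prod>k<K. norm (Gamma (complex_of_real (lam k) * Complex x t + mu k))) \<le>
       Q powr x * ((\<Prod>k<K. C k) * t ^ (\<Sum>k<K. n k) *
        (\<Prod>k<K. norm (Gamma (complex_of_real (lam k) * Complex x' t + mu k))))"
      by (rule mult_left_mono) simp
    moreover have "Q powr x = Q powr (x - x') * Q powr x'" using Q by (simp flip: powr_add)
    ultimately show "norm (gamma_factor Q K lam mu (Complex x t)) \<le>
        Q powr (x - x') * (\<Prod>k<K. C k) * t ^ (\<Sum>k<K. n k) *
          norm (gamma_factor Q K lam mu (Complex x' t))"
      by (simp add: gamma_factor_def norm_mult n prod_norm mult_ac)
  next
    fix k s assume "k < K" "Im s \<ge> t0"
    then show "Im (complex_of_real (lam k) * s + mu k) > 0" using im[of k "Im s"] by simp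
  qed
qed

lemma norm_of_nat_powr: "norm (of_nat n powr s :: complex) = real n powr Re s"
  by (cases "n = 0") (auto simp: norm_powr_real_powr)

text \<open>The damping factor \<open>k\<close> has modulus exp (-\<epsilon> * e^(\<beta> Im s) *
  cos (\<beta> (Re s - m))), a doubly exponential decay that beats growth of every finite order. On
  a tall enough box the maximum principle gives a bound free of \<epsilon>, which may then tend to
  0.\<close>

lemma phragmen_lindelof_half_strip:
  fixes f :: "complex \<Rightarrow> complex" and a b t0 B C \<rho> :: real
  assumes hol: "f holomorphic_on {s. 0 < Im s}" and "a < b" "0 < t0" "0 < B" "0 < \<rho>"
    and growth: "\<And>s. a \<le> Re s \<Longrightarrow> Re s \<le> b \<Longrightarrow> t0 \<le> Im s \<Longrightarrow> norm (f s) \<le> C * exp (norm s powr \<rho>)"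
    and sides: "\<And>s. t0 \<le> Im s \<Longrightarrow> Re s = a \<or> Re s = b \<Longrightarrow> norm (f s) \<le> B"
    and bottom: "\<And>s. Im s = t0 \<Longrightarrow> a \<le> Re s \<Longrightarrow> Re s \<le> b \<Longrightarrow> norm (f s) \<le> B"
    and s0: "a \<le> Re s0" "Re s0 \<le> b" "t0 \<le> Im s0"
  shows "norm (f s0) \<le> B"
proof -
  \<comment> \<open>At this scale \<beta> (Re s - m) stays within [-1/2, 1/2] on the strip, so the
    cosine is at least cos (1/2) > 0.\<close>
  define \<beta> where "\<beta> = 1 / (b - a)"
  define m where "m = (a + b) / 2"
  define c where "c = cos (1/2 :: real)"
  define k where "k \<epsilon> s = exp (- of_real \<epsilon> * exp (- \<i> * of_real \<beta> * (s - of_real m)))" for \<epsilon> s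
  have \<beta>: "\<beta> > 0" using assms by (simp add: \<beta>_def)
  have c: "c > 0" unfolding c_def by (rule cos_gt_zero_pi) (use pi_gt3 in auto)
  have cosge: "cos (\<beta> * (Re s - m)) \<ge> c" if "a \<le> Re s" "Re s \<le> b" for s
  proof -
    have "\<bar>Re s - m\<bar> \<le> (b - a) / 2" using that by (auto simp: m_def abs_le_iff field_simps)
    then have "\<bar>\<beta> * (Re s - m)\<bar> \<le> 1/2"
      using assms \<open>a < b\<close> by (simp add: \<beta>_def abs_mult field_simps)
    then have "cos (1/2) \<le> cos \<bar>\<beta> * (Re s - m)\<bar>"
      using pi_gt3 by (intro cos_monotone_0_pi_le) auto
    then show ?thesis by (simp add: c_def)
  qed
  have normk: "norm (k \<epsilon> s) = exp (- \<epsilon> * exp (\<beta> * Im s) * cos (\<beta> * (Re s - m)))" for \<epsilon> s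
    by (simp add: k_def Re_exp mult_ac)
  have k1: "norm (k \<epsilon> s) \<le> exp (- (\<epsilon> * c) * exp (\<beta> * Im s))"
    if "\<epsilon> > 0" "a \<le> Re s" "Re s \<le> b" for \<epsilon> s
  proof -
    have "\<epsilon> * exp (\<beta> * Im s) * c \<le> \<epsilon> * exp (\<beta> * Im s) * cos (\<beta> * (Re s - m))"
      using that cosge by (intro mult_left_mono) auto
    then show ?thesis by (simp add: normk mult_ac)
  qed
  have kle1: "norm (k \<epsilon> s) \<le> 1" if "\<epsilon> > 0" "a \<le> Re s" "Re s \<le> b" for \<epsilon> s
    using k1[OF that] that c by (smt (verit) exp_le_one_iff mult_minus_left mult_pos_pos exp_gt_zero)
  have key: "norm (f s0) * norm (k \<epsilon> s0) \<le> B" if \<epsilon>: "\<epsilon> > 0" for \<epsilon>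
  proof -
    define M where "M = \<bar>a\<bar> + \<bar>b\<bar>"
    have M: "M \<ge> 0" by (simp add: M_def)
    have "\<epsilon> * c > 0" using \<epsilon> c by simp
    then have "filterlim (\<lambda>t. (M + t) powr \<rho> - \<epsilon> * c * exp (\<beta> * t)) at_bot at_top"
      using \<open>0 < \<rho>\<close> \<beta> M by real_asymp
    then have "((\<lambda>t. \<bar>C\<bar> * exp ((M + t) powr \<rho> - \<epsilon> * c * exp (\<beta> * t))) \<longlongrightarrow> \<bar>C\<bar> * 0) at_top"
      by (intro tendsto_mult tendsto_const filterlim_compose[OF exp_at_bot])
    then have "eventually (\<lambda>t. \<bar>C\<bar> * exp ((M + t) powr \<rho> - \<epsilon> * c * exp (\<beta> * t)) < B) at_top"
      using \<open>0 < B\<close> by (intro order_tendstoD(2)) auto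
    then have "eventually (\<lambda>t. \<bar>C\<bar> * exp ((M + t) powr \<rho> - \<epsilon> * c * exp (\<beta> * t)) < B \<and> t > Im s0) at_top"
      using eventually_gt_at_top[of "Im s0"] by eventually_elim auto
    then obtain t1 where t1: "\<bar>C\<bar> * exp ((M + t1) powr \<rho> - \<epsilon> * c * exp (\<beta> * t1)) < B" "t1 > Im s0"
      by (force dest: eventually_happens)
    define S where "S = cbox (Complex a t0) (Complex b t1)"
    have "norm (f s0 * k \<epsilon> s0) \<le> B"
    proof (rule maximum_modulus_frontier[where S = S and f = "\<lambda>s. f s * k \<epsilon> s"])
      have h: "(\<lambda>s. f s * k \<epsilon> s) holomorphic_on {s. 0 < Im s}"
        unfolding k_def by (intro holomorphic_intros hol)
      have sub: "S \<subseteq> {s. 0 < Im s}" using \<open>0 < t0\<close> by (auto simp: S_def in_cbox_complex_iff)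
      show "(\<lambda>s. f s * k \<epsilon> s) holomorphic_on interior S"
        using h sub interior_subset by (blast intro: holomorphic_on_subset)
      show "continuous_on (closure S) (\<lambda>s. f s * k \<epsilon> s)"
        using holomorphic_on_imp_continuous_on[OF h] sub
        by (auto simp: S_def intro: continuous_on_subset)
      show "bounded S" by (simp add: S_def)
      show "s0 \<in> S" using s0 t1 by (auto simp: S_def in_cbox_complex_iff)
    next
      fix z assume "z \<in> frontier S"
      then have z: "a \<le> Re z" "Re z \<le> b" "t0 \<le> Im z" "Im z \<le> t1"
        and z': "Re z = a \<or> Re z = b \<or> Im z = t0 \<or> Im z = t1"
        by (auto simp: S_def frontier_cbox in_cbox_complex_iff in_box_complex_iff)
      show "norm (f z * k \<epsilon> z) \<le> B"
      proof (cases "Im z = t1")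
        case False
        then have "norm (f z) \<le> B" using z z' sides bottom by auto
        then have "norm (f z) * norm (k \<epsilon> z) \<le> B * 1"
          using kle1[OF \<epsilon> z(1,2)] \<open>0 < B\<close> by (intro mult_mono) auto
        then show ?thesis by (simp add: norm_mult)
      next
        case True
        have "norm z \<le> \<bar>Re z\<bar> + \<bar>Im z\<bar>" by (rule cmod_le)
        also have "\<dots> \<le> M + t1" using z \<open>0 < t0\<close> by (auto simp: M_def)
        finally have "norm z powr \<rho> \<le> (M + t1) powr \<rho>" using \<open>0 < \<rho>\<close> by (intro powr_mono2) auto
        have "norm (f z) \<le> C * exp (norm z powr \<rho>)" using growth z by auto
        also have "\<dots> \<le> \<bar>C\<bar> * exp (norm z powr \<rho>)" by (intro mult_right_mono) auto
        also have "\<dots> \<le> \<bar>C\<bar> * exp ((M + t1) powr \<rho>)"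
          using \<open>norm z powr \<rho> \<le> _\<close> by (intro mult_left_mono) auto
        finally have "norm (f z) * norm (k \<epsilon> z) \<le>
            \<bar>C\<bar> * exp ((M + t1) powr \<rho>) * exp (- (\<epsilon> * c) * exp (\<beta> * t1))"
          using k1[OF \<epsilon> z(1,2)] True by (intro mult_mono) auto
        also have "\<dots> = \<bar>C\<bar> * exp ((M + t1) powr \<rho> - \<epsilon> * c * exp (\<beta> * t1))"
          by (simp add: exp_diff exp_minus field_simps)
        finally show ?thesis using t1 by (simp add: norm_mult)
      qed
    qed
    then show ?thesis by (simp add: norm_mult)
  qed
  have "((\<lambda>\<epsilon>. norm (f s0) * norm (k \<epsilon> s0)) \<longlongrightarrow> norm (f s0) * norm (k 0 s0)) (at_right 0)"
    unfolding normk by (intro tendsto_intros)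
  moreover have "eventually (\<lambda>\<epsilon>. norm (f s0) * norm (k \<epsilon> s0) \<le> B) (at_right 0)"
    using key by (auto simp: eventually_at_filter)
  ultimately have "norm (f s0) * norm (k 0 s0) \<le> B"
    by (rule tendsto_upperbound) simp
  then show ?thesis by (simp add: normk)
qed

lemma selberg_class_holomorphic:
  assumes "selberg_class a f"
  shows "f holomorphic_on - {1}"
proof -
  from assms obtain m g where g: "g holomorphic_on UNIV" "\<And>s. s \<noteq> 1 \<Longrightarrow> f s = g s / (s - 1) ^ (m::nat)"
    unfolding selberg_class_def by blast
  have "(\<lambda>s. g s / (s - 1) ^ m) holomorphic_on - {1}"
    by (intro holomorphic_intros holomorphic_on_subset[OF g(1)]) auto
  then show ?thesis by (rule holomorphic_transform) (auto simp: g(2))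
qed

lemma selberg_class_bounded:
  assumes "selberg_class a f"
  obtains B where "B > 0" "\<And>s. Re s \<ge> 2 \<Longrightarrow> norm (f s) \<le> B"
proof -
  have s: "summable (\<lambda>n. norm (a n / of_nat n powr s))" "(\<lambda>n. a n / of_nat n powr s) sums f s"
    if "Re s > 1" for s
    using assms that unfolding selberg_class_def by auto
  have s2: "summable (\<lambda>n. norm (a n) / real n powr 2)"
    using s(1)[of 2] by (simp add: norm_divide norm_power)
  show ?thesis
  proof (rule that[of "1 + (\<Sum>n. norm (a n) / real n powr 2)"])
    show "0 < 1 + (\<Sum>n. norm (a n) / real n powr 2)"
      using suminf_nonneg[OF s2] by (simp add: add_pos_nonneg)
    fix s :: complex assume re: "Re s \<ge> 2"
    have "norm (f s) = norm (\<Sum>n. a n / of_nat n powr s)"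
      using s(2)[of s] re by (simp add: sums_iff)
    also have "\<dots> \<le> (\<Sum>n. norm (a n / of_nat n powr s))"
      using re by (intro summable_norm s) auto
    also have "\<dots> \<le> (\<Sum>n. norm (a n) / real n powr 2)"
    proof (rule suminf_le[OF _ s(1) s2])
      fix n
      show "norm (a n / of_nat n powr s) \<le> norm (a n) / real n powr 2"
      proof (cases "n = 0")
        case False
        then have "real n powr 2 \<le> real n powr Re s" using re by (intro powr_mono) auto
        then show ?thesis using False
          by (simp add: norm_divide norm_of_nat_powr frac_le)
      qed simp
    qed (use re in auto)
    finally show "norm (f s) \<le> 1 + (\<Sum>n. norm (a n) / real n powr 2)" by simp
  qed
qed

text \<open>The functional equation bounds \<^term>\<open>f\<close> on the line \<open>Re s = -1\<close>, because the gamma factors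
  on its two sides are taken at points with the same imaginary part.\<close>

lemma selberg_class_left_bound:
  assumes S: "selberg_class a f"
  obtains C t0 :: real and n :: nat where "C > 0" "t0 \<ge> 1"
    "\<And>t. t \<ge> t0 \<Longrightarrow> norm (f (Complex (-1) t)) \<le> C * t ^ n"
proof -
  from S obtain Q K lam mu \<omega> where Q: "Q > 0" and lam: "\<And>k. k < K \<Longrightarrow> lam k > 0" and \<omega>: "norm \<omega> = 1"
    and fe: "\<forall>\<^sub>\<approx>s. f s * gamma_factor Q K lam mu s =
            \<omega> * cnj (gamma_factor Q K lam mu (1 - cnj s) * f (1 - cnj s))"
    unfolding selberg_class_def by blast
  obtain C t0 n where C: "C > 0" "t0 \<ge> 1"
    "\<And>t. t \<ge> t0 \<Longrightarrow> norm (gamma_factor Q K lam mu (Complex 2 t)) \<le>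
        C * t ^ n * norm (gamma_factor Q K lam mu (Complex (-1) t))"
    and im: "\<And>k s. k < K \<Longrightarrow> Im s \<ge> t0 \<Longrightarrow> Im (complex_of_real (lam k) * s + mu k) > 0"
    using gamma_factor_quotient_le[where lam = lam and x = 2 and x' = "-1", OF Q] lam by metis
  obtain B where B: "B > 0" "\<And>s. Re s \<ge> 2 \<Longrightarrow> norm (f s) \<le> B"
    using selberg_class_bounded[OF S] by blast
  have ni: "complex_of_real (lam k) * s + mu k \<notin> \<int>\<^sub>\<le>\<^sub>0" if "k < K" "Im s \<ge> t0" for k s
    using im[OF that] by (metis complex_Im_of_int less_irrefl nonpos_Ints_cases)
  have gnz: "gamma_factor Q K lam mu s \<noteq> 0" if "Im s \<ge> t0" for s
    using Q ni[OF _ that] by (auto simp: gamma_factor_def Gamma_eq_zero_iff)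
  have gc: "isCont (gamma_factor Q K lam mu) s" if "Im s \<ge> t0" for s
    unfolding gamma_factor_def using Q ni[OF _ that]
    by (intro continuous_intros) auto
  have fc: "isCont f s" if "Im s \<ge> t0" for s
  proof -
    have "s \<noteq> 1" using that C(2) by auto
    moreover have "open (- {1 :: complex})" by (intro open_Compl closed_singleton)
    ultimately have "f field_differentiable at s"
      by (intro holomorphic_on_imp_differentiable_at[OF selberg_class_holomorphic[OF S]]) auto
    then show ?thesis by (rule field_differentiable_imp_continuous_at)
  qed
  \<comment> \<open>The functional equation is assumed only outside a sparse exceptional set. Both
    sides are continuous at points with Im s \<ge> t0, so it holds at each of them.\<close>
  have eq: "f s * gamma_factor Q K lam mu s =
      \<omega> * cnj (gamma_factor Q K lam mu (1 - cnj s) * f (1 - cnj s))" (is "?l s = ?r s")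
    if s: "Im s \<ge> t0" for s
  proof -
    have 1: "?l \<midarrow>s\<rightarrow> ?l s" using fc gc s by (intro isContD continuous_intros) auto
    have 2: "?r \<midarrow>s\<rightarrow> ?r s"
      using s by (intro isContD continuous_intros isCont_o2[OF _ fc] isCont_o2[OF _ gc]) auto
    have 3: "eventually (\<lambda>s. ?r s = ?l s) (at s)"
      using eventually_cosparse_imp_eventually_at[OF fe UNIV_I, of s UNIV]
      by eventually_elim (rule sym)
    show ?thesis
      by (rule LIM_unique[OF 1 Lim_transform_eventually[OF 2 3]])
  qed
  show ?thesis
  proof (rule that[of "C * B" t0 n])
    fix t assume t: "t \<ge> t0"
    let ?s = "Complex (-1) t"
    have e: "1 - cnj ?s = Complex 2 t" by (simp add: complex_eq_iff)
    have "norm (f ?s) * norm (gamma_factor Q K lam mu ?s) =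
       norm (gamma_factor Q K lam mu (Complex 2 t)) * norm (f (Complex 2 t))"
      using arg_cong[OF eq[of ?s], of norm] t \<omega> unfolding e by (simp add: norm_mult)
    also have "\<dots> \<le> (C * t ^ n * norm (gamma_factor Q K lam mu ?s)) * B"
      using C t B by (intro mult_mono) auto
    finally show "norm (f ?s) \<le> C * B * t ^ n"
      using gnz[of ?s] t by (simp add: mult_ac)
  qed (use C B in auto)
qed

text \<open>Division by s^n makes \<open>f\<close> bounded on the lines Re s = -1 and Re s = 2, and
  finite order supplies the a priori growth for Phragmen-Lindeloef in between. The possible pole at
  1 lies below the height \<open>t0\<close>.\<close>

lemma selberg_class_growth:
  assumes S: "selberg_class a f"
  obtains C t0 :: real and n :: nat where "C \<ge> 1" "t0 \<ge> 1"
    "\<And>s. Re s \<ge> 0 \<Longrightarrow> Im s \<ge> t0 \<Longrightarrow> norm (f s) \<le> C * Im s ^ n"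
proof -
  obtain C t0 n where C: "C > 0" "t0 \<ge> 1" "\<And>t. t \<ge> t0 \<Longrightarrow> norm (f (Complex (-1) t)) \<le> C * t ^ n"
    using selberg_class_left_bound[OF S] by blast
  obtain B where B: "B > 0" "\<And>s. Re s \<ge> 2 \<Longrightarrow> norm (f s) \<le> B"
    using selberg_class_bounded[OF S] by blast
  from S obtain m g \<rho> G where g: "\<And>s. s \<noteq> 1 \<Longrightarrow> f s = g s / (s - 1) ^ (m::nat)"
    "\<And>s. norm (g s) \<le> G * exp (norm s powr \<rho>)"
    unfolding selberg_class_def by blast
  \<comment> \<open>The order in the definition of the class may be nonpositive, whereas the strip
    lemma needs a positive one. Raising it is harmless where |s| \<ge> 1.\<close>
  define \<rho>' where "\<rho>' = max 1 \<rho>"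
  define F where "F s = f s / s ^ n" for s
  have hf: "f holomorphic_on {s. 0 < Im s}"
    using selberg_class_holomorphic[OF S] by (rule holomorphic_on_subset) auto
  have hF: "F holomorphic_on {s. 0 < Im s}"
    unfolding F_def by (intro holomorphic_intros hf) auto
  have "compact (cbox (Complex (-1) t0) (Complex 2 t0))" by simp
  then have "compact (F ` cbox (Complex (-1) t0) (Complex 2 t0))"
    using C by (intro compact_continuous_image continuous_on_subset[OF holomorphic_on_imp_continuous_on[OF hF]])
      (auto simp: in_cbox_complex_iff)
  then obtain B' where B': "\<And>z. z \<in> cbox (Complex (-1) t0) (Complex 2 t0) \<Longrightarrow> norm (F z) \<le> B'"
    using compact_imp_bounded bounded_iff by (metis imageI)
  define M where "M = C + B + \<bar>B'\<bar>"
  have M: "M > 0" using C B by (simp add: M_def)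
  have Fle: "norm (F s) \<le> M" if "-1 \<le> Re s" "Re s \<le> 2" "t0 \<le> Im s" for s
  proof (rule phragmen_lindelof_half_strip[where a = "-1" and b = 2 and ?t0.0 = t0 and \<rho> = \<rho>' and C = "\<bar>G\<bar>", OF hF])
    fix s assume s: "-1 \<le> Re s" "Re s \<le> 2" "t0 \<le> Im s"
    have 1: "1 \<le> norm s" using abs_Im_le_cmod[of s] s C by linarith
    have 2: "1 \<le> norm (s - 1)" using abs_Im_le_cmod[of "s - 1"] s C by simp
    have "s \<noteq> 1" using s C by auto
    have "norm (F s) = norm (g s) / (norm (s - 1) ^ m * norm s ^ n)"
      using g(1)[OF \<open>s \<noteq> 1\<close>] by (simp add: F_def norm_divide norm_mult norm_power)
    also have "\<dots> \<le> norm (g s) / 1"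
    proof (rule divide_left_mono)
      show "1 \<le> norm (s - 1) ^ m * norm s ^ n"
        using mult_mono[OF one_le_power[OF 2, of m] one_le_power[OF 1, of n]] by auto
      then show "0 < (norm (s - 1) ^ m * norm s ^ n) * 1" by linarith
    qed auto
    also have "\<dots> \<le> G * exp (norm s powr \<rho>)" using g(2) by simp
    also have "\<dots> \<le> \<bar>G\<bar> * exp (norm s powr \<rho>')"
      using 1 by (intro mult_mono) (auto simp: \<rho>'_def intro: powr_mono)
    finally show "norm (F s) \<le> \<bar>G\<bar> * exp (norm s powr \<rho>')" .
  next
    fix s assume s: "t0 \<le> Im s" "Re s = -1 \<or> Re s = 2"
    have im: "Im s \<le> norm s" using abs_Im_le_cmod[of s] by linarith
    have "norm (f s) \<le> (C + B) * Im s ^ n"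
    proof (cases "Re s = -1")
      case True
      then have "s = Complex (-1) (Im s)" by (simp add: complex_eq_iff)
      then have "norm (f s) \<le> C * Im s ^ n" using C(3)[OF s(1)] by metis
      also have "\<dots> \<le> (C + B) * Im s ^ n" using B C s by (intro mult_right_mono) auto
      finally show ?thesis .
    next
      case False
      then have "norm (f s) \<le> B * 1" using s B by simp
      also have "\<dots> \<le> (C + B) * Im s ^ n" using B C s by (intro mult_mono one_le_power) auto
      finally show ?thesis .
    qed
    also have "\<dots> \<le> (C + B) * norm s ^ n"
      using C B s im by (intro mult_left_mono power_mono) auto
    finally have "norm (F s) \<le> C + B"
      using s C B by (auto simp: F_def norm_divide norm_power divide_le_eq)
    then show "norm (F s) \<le> M" by (simp add: M_def)
  next
    fix s assume "Im s = t0" "-1 \<le> Re s" "Re s \<le> 2"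
    then have "norm (F s) \<le> B'" by (intro B') (auto simp: in_cbox_complex_iff)
    then show "norm (F s) \<le> M" using C B by (simp add: M_def)
  qed (use C M that in \<open>auto simp: \<rho>'_def\<close>)
  show ?thesis
  proof (rule that[of "1 + B + M * 3 ^ n" t0 n])
    show "1 \<le> 1 + B + M * 3 ^ n" using M B by simp
    show "t0 \<ge> 1" by fact
    fix s assume s: "Re s \<ge> 0" "Im s \<ge> t0"
    have p1: "1 \<le> Im s ^ n" using s C by (intro one_le_power) auto
    show "norm (f s) \<le> (1 + B + M * 3 ^ n) * Im s ^ n"
    proof (cases "Re s \<le> 2")
      case True
      have "norm s \<le> \<bar>Re s\<bar> + \<bar>Im s\<bar>" by (rule cmod_le)
      also have "\<dots> \<le> 3 * Im s" using s C True by auto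
      finally have "norm s ^ n \<le> (3 * Im s) ^ n" by (intro power_mono) auto
      moreover have "s \<noteq> 0" using s C by auto
      moreover have "norm (F s) \<le> M" using Fle s True by auto
      ultimately have "norm (f s) \<le> M * norm s ^ n"
        by (simp add: F_def norm_divide norm_power divide_le_eq)
      also have "\<dots> \<le> M * (3 * Im s) ^ n" using \<open>norm s ^ n \<le> _\<close> M by (intro mult_left_mono) auto
      also have "\<dots> = (M * 3 ^ n) * Im s ^ n" by (simp add: power_mult_distrib)
      also have "\<dots> \<le> (1 + B + M * 3 ^ n) * Im s ^ n"
        using B p1 by (intro mult_right_mono) auto
      finally show ?thesis .
    next
      case False
      then have "norm (f s) \<le> B * 1" using B by simp
      also have "\<dots> \<le> (1 + B + M * 3 ^ n) * Im s ^ n" using B M p1 by (intro mult_mono) auto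
      finally show ?thesis .
    qed
  qed
qed

section \<open>Local factors of the Euler product\<close>

text \<open>The reciprocal of the Euler product truncated at \<open>Z\<close>. Multiplying the
  function by it removes the primes up to \<open>Z\<close> and leaves something close to 1.\<close>

definition euler_poly :: "nat \<Rightarrow> (nat \<Rightarrow> nat \<Rightarrow> complex) \<Rightarrow> nat \<Rightarrow> complex \<Rightarrow> complex" where
  "euler_poly d aj Z s = (\<Prod>p | prime p \<and> p \<le> Z. \<Prod>j<d. 1 - aj j p / of_nat p powr s)"

lemma finite_primes_le [simp]: "finite {p::nat. prime p \<and> p \<le> n}"
  by (rule finite_subset[of _ "{..n}"]) auto

text \<open>Bounds of the form exp (g) - 1 are stable under products: the exponents add.\<close>

lemma norm_prod_exp_bound:
  fixes f :: "nat \<Rightarrow> complex"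
  assumes "\<And>n. n \<in> A \<Longrightarrow> norm (f n - 1) \<le> exp (g n) - 1"
  shows "norm (prod f A - 1) \<le> exp (sum g A) - 1"
proof -
  have "norm (prod (\<lambda>n. 1 + (f n - 1)) A - 1) \<le> prod (\<lambda>n. 1 + norm (f n - 1)) A - 1"
    by (rule norm_prod_minus1_le_prod_minus1)
  also have "prod (\<lambda>n. 1 + norm (f n - 1)) A \<le> prod (\<lambda>n. exp (g n)) A"
    using assms by (intro prod_mono) (auto simp: add_nonneg_nonneg algebra_simps)
  also have "\<dots> \<le> exp (sum g A)"
    by (cases "finite A") (auto simp: exp_sum)
  finally show ?thesis by simp
qed

lemma norm_inverse_one_minus_diff:
  fixes u :: complex
  assumes "norm u \<le> 1/2"
  shows "norm (inverse (1 - u) - 1) \<le> 2 * norm u"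
proof -
  have "1/2 \<le> norm (1 - u)" using norm_triangle_ineq2[of 1 u] assms by simp
  moreover from this have "1 - u \<noteq> 0" by auto
  then have "inverse (1 - u) - 1 = u / (1 - u)" by (simp add: field_simps)
  ultimately show ?thesis
    using mult_left_mono[of "1/2" "norm (1 - u)" "norm u"]
    by (simp add: norm_divide divide_le_eq)
qed

text \<open>The partial products over Z < p \<le> n are bounded uniformly in n. In p^(1/4 - Re s)
  the factor p^(-2) is split off to make the sum over p converge; the remaining power decreases in p
  and is largest at Z + 1. Of the conditions on \<open>C\<close>, the one with base 2 makes all
  local factors invertible, so that those up to \<open>Z\<close> cancel, and the last one puts the
  terms beyond \<open>Z\<close> within 1/2.\<close>

lemma euler_tail_bound:
  fixes aj :: "nat \<Rightarrow> nat \<Rightarrow> complex" and C :: real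
  assumes aj: "\<And>j p. j < d \<Longrightarrow> prime p \<Longrightarrow> norm (aj j p) \<le> C * real p powr (1/4)"
    and hp: "(\<lambda>p. if prime p then (\<Prod>j<d. inverse (1 - aj j p / of_nat p powr s)) else 1) has_prod F"
    and x: "Re s \<ge> 3" and C: "C > 0" "C * 2 powr (1/4 - Re s) < 1" "2 * C \<le> real (Z + 1)"
  shows "norm (F * euler_poly d aj Z s - 1) \<le>
    exp (2 * d * C * (\<Sum>n. 1 / real n ^ 2) * real (Z + 1) powr (9/4 - Re s)) - 1"
proof -
  define u where "u j p = aj j p / of_nat p powr s" for j p
  define e where "e p = (if prime p then \<Prod>j<d. 1 - u j p else 1)" for p
  define l where "l p = (if prime p then \<Prod>j<d. inverse (1 - u j p) else 1)" for p
  define S where "S = (\<Sum>n. 1 / real n ^ 2)"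
  have sS: "summable (\<lambda>n. 1 / real n ^ 2)"
    using inverse_power_summable[of 2, where ?'a = real] by (simp add: field_simps)
  have u: "norm (u j p) \<le> C * real p powr (1/4 - Re s)" if "j < d" "prime p" for j p
  proof -
    have "p > 0" using that prime_gt_0_nat by auto
    then have "norm (u j p) = norm (aj j p) / real p powr Re s"
      by (simp add: u_def norm_divide norm_of_nat_powr)
    also have "\<dots> \<le> C * real p powr (1/4) / real p powr Re s"
      using aj[OF that] by (intro divide_right_mono) auto
    finally show ?thesis by (simp add: powr_diff)
  qed
  have u1: "norm (u j p) < 1" if "j < d" "prime p" for j p
  proof -
    have "real p powr (1/4 - Re s) \<le> 2 powr (1/4 - Re s)"
      using x prime_ge_2_nat[OF that(2)] by (intro powr_mono2') auto
    then have "C * real p powr (1/4 - Re s) \<le> C * 2 powr (1/4 - Re s)" using C by simp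
    then show ?thesis using u[OF that] C by linarith
  qed
  have el: "e p * l p = 1" for p
  proof -
    have "(\<Prod>j<d. 1 - u j p) * (\<Prod>j<d. inverse (1 - u j p)) = 1" if "prime p"
    proof -
      have "(1 - u j p) * inverse (1 - u j p) = 1" if "j < d" for j
        using u1[OF that \<open>prime p\<close>] by (intro right_inverse) auto
      then show ?thesis by (simp add: prod.distrib[symmetric])
    qed
    then show ?thesis by (simp add: e_def l_def)
  qed
  have E: "euler_poly d aj Z s = (\<Prod>p\<le>Z. e p)"
    using prod.inter_filter[of "{..Z}" "\<lambda>p. \<Prod>j<d. 1 - u j p" prime]
    by (simp add: euler_poly_def e_def u_def Collect_conj_eq Int_commute conj_commute)
  have bd: "norm ((\<Prod>p\<le>n. l p) * (\<Prod>p\<le>Z. e p) - 1) \<le> exp (2 * d * C * S * real (Z + 1) powr (9/4 - Re s)) - 1"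
    if "n \<ge> Z" for n
  proof -
    have "(\<Prod>p\<le>n. l p) = (\<Prod>p\<le>Z. l p) * (\<Prod>p\<in>{Z<..n}. l p)"
      using that by (subst prod.union_disjoint[symmetric]) (auto intro!: prod.cong)
    moreover have "(\<Prod>p\<le>Z. l p) * (\<Prod>p\<le>Z. e p) = 1"
      by (simp add: prod.distrib[symmetric] mult.commute el)
    ultimately have eq: "(\<Prod>p\<le>n. l p) * (\<Prod>p\<le>Z. e p) = (\<Prod>p\<in>{Z<..n}. l p)"
      by (simp add: mult_ac)
    define g where "g p = 2 * d * C * real (Z + 1) powr (9/4 - Re s) * (1 / real p ^ 2)" for p :: nat
    have g0: "g p \<ge> 0" for p using C by (auto simp: g_def)
    have "norm ((\<Prod>p\<in>{Z<..n}. l p) - 1) \<le> exp (\<Sum>p\<in>{Z<..n}. g p) - 1"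
    proof (rule norm_prod_exp_bound)
      fix p assume p: "p \<in> {Z<..n}"
      show "norm (l p - 1) \<le> exp (g p) - 1"
      proof (cases "prime p")
        case True
        have p0: "p > 0" using True prime_gt_0_nat by auto
        define h where "h = 2 * C * real p powr (1/4 - Re s)"
        have "norm ((\<Prod>j<d. inverse (1 - u j p)) - 1) \<le> exp (\<Sum>j<d. h) - 1"
        proof (rule norm_prod_exp_bound)
          fix j assume j: "j \<in> {..<d}"
          have "real p powr (1/4 - Re s) \<le> real p powr (-1)"
            using x p0 by (intro powr_mono) auto
          then have "C * real p powr (1/4 - Re s) \<le> C / p"
            using C p0 by (simp add: powr_minus field_simps)
          also have "\<dots> \<le> 1/2" using C p p0 by (simp add: field_simps)
          finally have "C * real p powr (1/4 - Re s) \<le> 1/2" .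
          then have "norm (inverse (1 - u j p) - 1) \<le> 2 * norm (u j p)"
            using u[of j p] j True by (intro norm_inverse_one_minus_diff) auto
          also have "\<dots> \<le> h" using u[of j p] j True by (simp add: h_def)
          also have "\<dots> \<le> exp h - 1" using exp_ge_add_one_self[of h] by linarith
          finally show "norm (inverse (1 - u j p) - 1) \<le> exp h - 1" .
        qed
        also have "(\<Sum>j<d. h) \<le> g p"
        proof -
          have "real p powr (1/4 - Re s) = real p powr (9/4 - Re s) * (1 / real p ^ 2)"
          proof -
            have "9/4 - Re s = 2 + (1/4 - Re s)" by simp
            then show ?thesis using p0 by (simp only: powr_add) simp
          qed
          also have "\<dots> \<le> real (Z + 1) powr (9/4 - Re s) * (1 / real p ^ 2)"
            using x p by (intro mult_right_mono powr_mono2') auto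
          finally have "(2 * d * C) * real p powr (1/4 - Re s) \<le>
              (2 * d * C) * (real (Z + 1) powr (9/4 - Re s) * (1 / real p ^ 2))"
            using C by (intro mult_left_mono) auto
          then show ?thesis by (simp add: h_def g_def mult_ac)
        qed
        finally show ?thesis using True by (simp add: l_def)
      qed (use g0 in \<open>auto simp: l_def\<close>)
    qed
    also have "(\<Sum>p\<in>{Z<..n}. g p) \<le> 2 * d * C * real (Z + 1) powr (9/4 - Re s) * S"
      unfolding g_def sum_distrib_left[symmetric] S_def
      using C sS by (intro mult_left_mono sum_le_suminf) auto
    finally show ?thesis unfolding eq by (simp add: mult_ac)
  qed
  have "(\<lambda>n. \<Prod>p\<le>n. l p) \<longlonglongrightarrow> F"
    using has_prod_imp_tendsto[OF hp] unfolding l_def u_def .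
  then have "(\<lambda>n. norm ((\<Prod>p\<le>n. l p) * (\<Prod>p\<le>Z. e p) - 1)) \<longlonglongrightarrow> norm (F * (\<Prod>p\<le>Z. e p) - 1)"
    by (intro tendsto_intros)
  then show ?thesis unfolding E S_def[symmetric]
    by (rule tendsto_upperbound) (use bd in \<open>auto simp: eventually_sequentially\<close>)
qed

lemma dirichlet_series_mult_factor:
  fixes c :: "nat \<Rightarrow> complex" and \<alpha> :: complex
  assumes p: "p > 0" and sm: "summable (\<lambda>n. norm (c n / of_nat n powr s))"
    and F: "(\<lambda>n. c n / of_nat n powr s) sums F"
  defines "c' \<equiv> \<lambda>n. c n - (if p dvd n then \<alpha> * c (n div p) else 0)"
  shows "summable (\<lambda>n. norm (c' n / of_nat n powr s))"
    and "(\<lambda>n. c' n / of_nat n powr s) sums (F * (1 - \<alpha> / of_nat p powr s))"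
proof -
  define h where "h n = (if p dvd n then \<alpha> * c (n div p) else 0) / of_nat n powr s" for n
  have mono: "strict_mono (\<lambda>n. p * n)" using p by (auto simp: strict_mono_def)
  have out: "h n = 0" if "n \<notin> range (\<lambda>n. p * n)" for n
    using that by (auto simp: h_def dvd_def)
  have hp: "h (p * n) = \<alpha> / of_nat p powr s * (c n / of_nat n powr s)" for n
    using p by (simp add: h_def powr_times_real)
  have "(\<lambda>n. h (p * n)) sums (\<alpha> / of_nat p powr s * F)"
    unfolding hp by (intro sums_mult F)
  then have h: "h sums (\<alpha> / of_nat p powr s * F)"
    using sums_mono_reindex[of "\<lambda>n. p * n" h, OF mono out] by auto
  have "summable (\<lambda>n. norm (h (p * n)))"
    unfolding hp norm_mult[of "\<alpha> / of_nat p powr s"] by (intro summable_mult sm)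
  then have hs: "summable (\<lambda>n. norm (h n))"
    using summable_mono_reindex[of "\<lambda>n. p * n" "\<lambda>n. norm (h n)", OF mono] out by auto
  have e: "c' n / of_nat n powr s = c n / of_nat n powr s - h n" for n
    by (simp add: c'_def h_def diff_divide_distrib)
  show "(\<lambda>n. c' n / of_nat n powr s) sums (F * (1 - \<alpha> / of_nat p powr s))"
    unfolding e using sums_diff[OF F h] by (simp add: algebra_simps)
  show "summable (\<lambda>n. norm (c' n / of_nat n powr s))" unfolding e
    by (rule summable_comparison_test'[OF summable_add[OF sm hs], of 0])
      (auto simp: norm_triangle_ineq4)
qed

text \<open>Multiplying by finitely many factors \<open>1 - a\<^sub>j(p) p\<^bsup>-s\<^esup>\<close> acts on the coefficients at powers of
  a prime \<open>q\<close> only through the factors with \<open>p = q\<close>; so the local series can be read off from finite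
  Euler products without expanding the infinite one.\<close>

lemma dirichlet_series_mult_factors:
  fixes a :: "nat \<Rightarrow> complex" and aj :: "nat \<Rightarrow> nat \<Rightarrow> complex"
  assumes f: "\<forall>s. Re s > 1 \<longrightarrow> summable (\<lambda>n. norm (a n / of_nat n powr s)) \<and>
      (\<lambda>n. a n / of_nat n powr s) sums f s"
    and "finite S" and "\<forall>x\<in>S. prime (fst x)"
  shows "\<exists>c. (\<forall>s. Re s > 1 \<longrightarrow> summable (\<lambda>n. norm (c n / of_nat n powr s)) \<and>
          (\<lambda>n. c n / of_nat n powr s) sums (f s * (\<Prod>(p, j)\<in>S. 1 - aj j p / of_nat p powr s))) \<and>
       (\<forall>q. prime q \<longrightarrow> Abs_fps (\<lambda>k. c (q ^ k)) =
          Abs_fps (\<lambda>k. a (q ^ k)) * (\<Prod>(p, j)\<in>{x\<in>S. fst x = q}. 1 - fps_const (aj j p) * fps_X))"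
  using assms(2,3)
proof (induction S rule: finite_induct)
  case empty
  then show ?case using f by (intro exI[of _ a]) auto
next
  case (insert x S)
  obtain p0 j0 where x: "x = (p0, j0)" by (cases x)
  have p0: "prime p0" using insert.prems x by auto
  have "\<forall>x\<in>S. prime (fst x)" using insert.prems by blast
  from insert.IH[OF this] obtain c where c0:
      "\<forall>s. Re s > 1 \<longrightarrow> summable (\<lambda>n. norm (c n / of_nat n powr s)) \<and>
        (\<lambda>n. c n / of_nat n powr s) sums (f s * (\<Prod>(p, j)\<in>S. 1 - aj j p / of_nat p powr s))"
      and c1: "\<forall>q. prime q \<longrightarrow> Abs_fps (\<lambda>k. c (q ^ k)) =
          Abs_fps (\<lambda>k. a (q ^ k)) * (\<Prod>(p, j)\<in>{x\<in>S. fst x = q}. 1 - fps_const (aj j p) * fps_X)"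
    by (elim exE conjE)
  note c = c0[rule_format, THEN conjunct1] c0[rule_format, THEN conjunct2] c1[rule_format]
  define c' where "c' n = c n - (if p0 dvd n then aj j0 p0 * c (n div p0) else 0)" for n
  have pos: "p0 > 0" using p0 prime_gt_0_nat by auto
  have 1: "summable (\<lambda>n. norm (c' n / of_nat n powr s))"
     "(\<lambda>n. c' n / of_nat n powr s) sums (f s * (\<Prod>(p, j)\<in>insert x S. 1 - aj j p / of_nat p powr s))"
    if "Re s > 1" for s
    using dirichlet_series_mult_factor[OF pos c(1)[OF that] c(2)[OF that], of "aj j0 p0"] insert.hyps
    unfolding c'_def[symmetric] by (auto simp: x mult_ac)
  have 2: "Abs_fps (\<lambda>k. c' (q ^ k)) =
          Abs_fps (\<lambda>k. a (q ^ k)) * (\<Prod>(p, j)\<in>{y\<in>insert x S. fst y = q}. 1 - fps_const (aj j p) * fps_X)"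
    if q: "prime q" for q
  proof (cases "q = p0")
    case False
    have "c' (q ^ k) = c (q ^ k)" for k
      using False p0 q by (auto simp: c'_def dest: prime_dvd_power primes_dvd_imp_eq)
    moreover have "{y\<in>insert x S. fst y = q} = {y\<in>S. fst y = q}" using False x by auto
    ultimately show ?thesis using c(3)[OF q] by simp
  next
    case True
    have "Abs_fps (\<lambda>k. c' (q ^ k)) = Abs_fps (\<lambda>k. c (q ^ k)) * (1 - fps_const (aj j0 p0) * fps_X)"
    proof (rule fps_ext)
      fix k
      have "p0 dvd q ^ k \<longleftrightarrow> k \<noteq> 0"
        using True p0 by (cases k) auto
      moreover have "q ^ k div p0 = q ^ (k - 1)" if "k \<noteq> 0"
        using that True pos by (cases k) auto
      moreover have "(Abs_fps (\<lambda>k. c (q ^ k)) * (1 - fps_const (aj j0 p0) * fps_X)) $ k =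
          c (q ^ k) - (if k = 0 then 0 else c (q ^ (k - 1)) * aj j0 p0)"
        by (simp add: right_diff_distrib mult.assoc[symmetric] fps_mult_right_const_nth)
      ultimately show "Abs_fps (\<lambda>k. c' (q ^ k)) $ k =
          (Abs_fps (\<lambda>k. c (q ^ k)) * (1 - fps_const (aj j0 p0) * fps_X)) $ k"
        by (auto simp: c'_def)
    qed
    moreover have "{y\<in>insert x S. fst y = q} = insert x {y\<in>S. fst y = q}" using True x by auto
    ultimately show ?thesis using c(3)[OF q] insert.hyps by (simp add: x mult_ac)
  qed
  show ?case using 1 2 by blast
qed

text \<open>Induction on the index m: after multiplication by m^x the earlier terms are already
  known to vanish, the later ones decay geometrically in x, and F x - 1 contributes O((m / (P +
  1))^x). Letting x tend to infinity isolates the m-th coefficient.\<close>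

lemma dirichlet_coefficients_unique:
  fixes c :: "nat \<Rightarrow> complex" and K :: real
  assumes sm: "summable (\<lambda>n. norm (c n) / real n ^ 2)"
    and F: "\<And>x. x \<ge> 2 \<Longrightarrow> (\<lambda>n. c n / of_real (real n powr x)) sums F x"
    and small: "eventually (\<lambda>x. norm (F x - 1) \<le> K * real (P + 1) powr (-x)) at_top"
    and n: "1 \<le> n" "n \<le> P"
  shows "c n = (if n = 1 then 1 else 0)"
proof -
  define b where "b n = c n - (if n = 1 then 1 else 0)" for n
  have sb: "summable (\<lambda>n. norm (b n) / real n ^ 2)"
  proof (rule summable_comparison_test'[of "\<lambda>n. norm (c n) / real n ^ 2 + (if n = 1 then 1 else 0)" 0])
    show "summable (\<lambda>n. norm (c n) / (real n)\<^sup>2 + (if n = 1 then 1 else 0))"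
      by (intro summable_add sm) simp
    fix n show "norm (norm (b n) / (real n)\<^sup>2) \<le> norm (c n) / (real n)\<^sup>2 + (if n = 1 then 1 else 0)"
      using norm_triangle_ineq4[of "c n" 1] by (auto simp: b_def)
  qed
  have Fb: "(\<lambda>n. b n / of_real (real n powr x)) sums (F x - 1)" if "x \<ge> 2" for x
  proof -
    have e: "b n / of_real (real n powr x) = c n / of_real (real n powr x) - (if n = 1 then 1 else 0)" for n
      by (simp add: b_def diff_divide_distrib)
    show ?thesis unfolding e
      using sums_diff[OF F[OF that] sums_single[of 1 "\<lambda>_. 1"]] by simp
  qed
  have "b n = 0" if "1 \<le> n" "n \<le> P" for n
    using that
  proof (induction n rule: less_induct)
    case (less m)
    \<comment> \<open>The largest ratio m / n with n > m; it governs the decay of all later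
      terms.\<close>
    define q where "q = real m / (m + 1)"
    have q: "0 < q" "q < 1" using less.prems by (auto simp: q_def)
    define S where "S = (\<Sum>n. norm (b n) / real n ^ 2)"
    have bound: "norm (b m) \<le> real m powr x * norm (F x - 1) + real m ^ 2 * q powr (x - 2) * S"
      if x: "x \<ge> 2" for x
    proof -
      define t where "t n = of_real (real m powr x) * (b n / of_real (real n powr x)) -
          (if n = m then b n else 0)" for n
      have "t sums (of_real (real m powr x) * (F x - 1) - b m)"
        unfolding t_def by (intro sums_diff sums_mult Fb x sums_single)
      then have "norm (of_real (real m powr x) * (F x - 1) - b m) = norm (suminf t)"
        by (simp add: sums_iff)
      also have "\<dots> \<le> (\<Sum>n. real m ^ 2 * q powr (x - 2) * (norm (b n) / real n ^ 2))"
      proof (rule norm_suminf_le)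
        show "summable (\<lambda>n. real m ^ 2 * q powr (x - 2) * (norm (b n) / real n ^ 2))"
          by (intro summable_mult sb)
        fix n
        consider "n < m" | "n = m" | "n > m" by linarith
        then show "norm (t n) \<le> real m ^ 2 * q powr (x - 2) * (norm (b n) / real n ^ 2)"
        proof cases
          case 1
          \<comment> \<open>The term n = 0 is harmless: \<open>0 powr x = 0\<close> and division by
            zero gives zero, so the coefficient at 0 never enters.\<close>
          then have "b n = 0 \<or> n = 0" using less by auto
          then show ?thesis using 1 by (auto simp: t_def)
        next
          case 2
          then show ?thesis using less.prems by (simp add: t_def)
        next
          case 3
          have mn: "0 < real m" "0 < real n" using less.prems 3 by auto
          have "norm (t n) = norm (b n) * (real m / real n) powr x"
            using 3 by (simp add: t_def norm_mult norm_divide powr_divide)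
          also have "(real m / real n) powr x = (real m / real n) powr 2 * (real m / real n) powr (x - 2)"
            using powr_add[of "real m / real n" 2 "x - 2"] by simp
          also have "(real m / real n) powr (x - 2) \<le> q powr (x - 2)"
            using mn 3 x by (intro powr_mono2) (auto simp: q_def frac_le)
          finally have "norm (t n) \<le> norm (b n) * ((real m / real n) powr 2 * q powr (x - 2))"
            by (simp add: mult_left_mono)
          also have "(real m / real n) powr 2 = real m ^ 2 / real n ^ 2"
            using mn by (simp add: power_divide)
          finally show ?thesis by (simp add: field_simps)
        qed
      qed
      also have "\<dots> = real m ^ 2 * q powr (x - 2) * S" unfolding S_def by (rule suminf_mult[OF sb])
      finally have "norm (of_real (real m powr x) * (F x - 1) - b m) \<le> real m ^ 2 * q powr (x - 2) * S" .
      moreover have "norm (b m) \<le> norm (of_real (real m powr x) * (F x - 1)) +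
          norm (of_real (real m powr x) * (F x - 1) - b m)"
        by (metis norm_minus_commute norm_triangle_sub)
      ultimately show ?thesis by (simp add: norm_mult)
    qed
    define r where "r = real m / real (P + 1)"
    have r: "0 < r" "r < 1" using less.prems by (auto simp: r_def)
    have "eventually (\<lambda>x. norm (b m) \<le> K * r powr x + real m ^ 2 * q powr (x - 2) * S) at_top"
      using small eventually_ge_at_top[of 2]
    proof eventually_elim
      case (elim x)
      have "real m powr x * norm (F x - 1) \<le> real m powr x * (K * real (P + 1) powr (-x))"
        using elim by (intro mult_left_mono) auto
      also have "\<dots> = K * r powr x" by (simp add: r_def powr_divide powr_minus field_simps)
      finally show ?case using bound[OF elim(2)] by linarith
    qed
    moreover have "((\<lambda>x. K * r powr x + real m ^ 2 * q powr (x - 2) * S) \<longlongrightarrow> K * 0 + real m ^ 2 * 0 * S) at_top"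
    proof (intro tendsto_intros)
      show "((\<lambda>x. r powr x) \<longlongrightarrow> 0) at_top" using r by real_asymp
      show "((\<lambda>x. q powr (x - 2)) \<longlongrightarrow> 0) at_top" using q by real_asymp
    qed
    ultimately have "norm (b m) \<le> K * 0 + real m ^ 2 * 0 * S"
      by (intro tendsto_lowerbound[where F = at_top]) auto
    then show ?case by simp
  qed
  from this[OF n] show ?thesis by (simp add: b_def)
qed


text \<open>Multiplying \<open>f\<close> by finitely many reciprocal local factors leaves 1 + O((P +
  1)^(-x)), so the new coefficients vanish from 2 up to P. At p^k with p^k \<le> P this vanishing is
  exactly the claimed identity of power series in degree k.\<close>

lemma selberg_poly_local_series:
  fixes d :: nat and aj :: "nat \<Rightarrow> nat \<Rightarrow> complex" and C :: real
  assumes S: "selberg_class a f"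
    and aj: "\<And>j p. j < d \<Longrightarrow> prime p \<Longrightarrow> norm (aj j p) \<le> C * real p powr (1/4)" and C: "C \<ge> 1"
    and hp: "\<And>s. Re s > 1 \<Longrightarrow>
      (\<lambda>p. if prime p then (\<Prod>j<d. inverse (1 - aj j p / of_nat p powr s)) else 1) has_prod f s"
    and p: "prime p"
  shows "Abs_fps (\<lambda>k. a (p ^ k)) * (\<Prod>j<d. 1 - fps_const (aj j p) * fps_X) = 1"
proof (rule fps_ext)
  fix k
  have f: "\<forall>s. Re s > 1 \<longrightarrow> summable (\<lambda>n. norm (a n / of_nat n powr s)) \<and>
      (\<lambda>n. a n / of_nat n powr s) sums f s"
    using S unfolding selberg_class_def by (elim conjE)
  obtain P0 :: nat where P0: "2 * C < P0" using reals_Archimedean2 by blast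
  \<comment> \<open>\<open>p ^ k\<close> brings the coefficient under inspection into range,
    \<open>P0\<close> meets the requirement 2 * C \<le> P + 1 of the tail bound.\<close>
  define P where "P = P0 + p ^ k"
  have "real P0 \<le> real (P + 1)" unfolding of_nat_le_iff P_def by simp
  then have P: "2 * C \<le> real (P + 1)" "p ^ k \<le> P" using P0 by (linarith, simp add: P_def)
  define S where "S = {q. prime q \<and> q \<le> P} \<times> {..<d}"
  have finS: "finite S" unfolding S_def by (intro finite_cartesian_product finite_primes_le) simp
  have prS: "\<forall>x\<in>S. prime (fst x)" by (auto simp: S_def)
  from dirichlet_series_mult_factors[OF f finS prS, of aj] obtain c where c0:
      "\<forall>s. Re s > 1 \<longrightarrow> summable (\<lambda>n. norm (c n / of_nat n powr s)) \<and>
        (\<lambda>n. c n / of_nat n powr s) sums (f s * (\<Prod>(p, j)\<in>S. 1 - aj j p / of_nat p powr s))"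
      and c1: "\<forall>q. prime q \<longrightarrow> Abs_fps (\<lambda>k. c (q ^ k)) =
          Abs_fps (\<lambda>k. a (q ^ k)) * (\<Prod>(p, j)\<in>{x\<in>S. fst x = q}. 1 - fps_const (aj j p) * fps_X)"
    by (elim exE conjE)
  have prodS: "(\<Prod>(p, j)\<in>S. 1 - aj j p / of_nat p powr s) = euler_poly d aj P s" for s
    unfolding S_def euler_poly_def by (rule prod.cartesian_product[symmetric])
  define F where "F x = f (complex_of_real x) * euler_poly d aj P (of_real x)" for x :: real
  define M where "M = 2 * d * C * (\<Sum>n. 1 / real n ^ 2)"
  have M: "M \<ge> 0"
    unfolding M_def using C inverse_power_summable[of 2, where ?'a = real]
    by (intro mult_nonneg_nonneg suminf_nonneg) (auto simp: field_simps)
  have coeff: "c (p ^ k) = (if p ^ k = 1 then 1 else 0)"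
  proof (rule dirichlet_coefficients_unique[where P = P and F = F and K = "2 * M * real (P + 1) powr (9/4)"])
    show "summable (\<lambda>n. norm (c n) / (real n)\<^sup>2)"
      using c0[rule_format, of 2] by (simp add: norm_divide norm_power)
    show "(\<lambda>n. c n / of_real (real n powr x)) sums F x" if "x \<ge> 2" for x
      using c0[rule_format, of "of_real x", THEN conjunct2] that
      by (simp add: prodS F_def powr_of_real[symmetric])
    have ev: "eventually (\<lambda>x. C * 2 powr (1/4 - x) < 1) at_top"
      "eventually (\<lambda>x. M * real (P + 1) powr (9/4 - x) < 1) at_top"
    proof -
      have "((\<lambda>x. C * 2 powr (1/4 - x)) \<longlongrightarrow> C * 0) at_top"
        by (intro tendsto_intros) real_asymp
      then show "eventually (\<lambda>x. C * 2 powr (1/4 - x) < 1) at_top"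
        by (intro order_tendstoD) auto
      have "real (P + 1) > 1" using P C by simp
      then have "((\<lambda>x. real (P + 1) powr (9/4 - x)) \<longlongrightarrow> 0) at_top"
        by real_asymp
      then have "((\<lambda>x. M * real (P + 1) powr (9/4 - x)) \<longlongrightarrow> M * 0) at_top"
        by (intro tendsto_intros)
      then show "eventually (\<lambda>x. M * real (P + 1) powr (9/4 - x) < 1) at_top"
        by (intro order_tendstoD) auto
    qed
    show "eventually (\<lambda>x. norm (F x - 1) \<le> 2 * M * real (P + 1) powr (9/4) * real (P + 1) powr (-x)) at_top"
      using ev eventually_ge_at_top[of 3]
    proof eventually_elim
      case (elim x)
      define y where "y = M * real (P + 1) powr (9/4 - x)"
      have y: "0 \<le> y" "y \<le> 1" using M elim by (auto simp: y_def)
      have "norm (F x - 1) \<le> exp y - 1"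
        unfolding F_def y_def M_def
        using euler_tail_bound[where s = "of_real x" and C = C and d = d and aj = aj and Z = P, OF aj hp]
          elim C P by simp
      also have "\<dots> \<le> y + y\<^sup>2" using exp_bound[OF y] by simp
      also have "\<dots> \<le> 2 * y" using mult_left_mono[OF y(2) y(1)] by (simp add: power2_eq_square)
      also have "y = M * (real (P + 1) powr (9/4) * real (P + 1) powr (-x))"
        by (simp add: y_def flip: powr_add)
      finally show ?case by (simp add: mult_ac)
    qed
    show "1 \<le> p ^ k" using prime_gt_0_nat[OF p] by (simp add: Suc_le_eq)
    show "p ^ k \<le> P" by (rule P)
  qed
  \<comment> \<open>For k = 0 the prime p itself may exceed P, so that degree is checked separately
    through the constant terms.\<close>
  have pP: "p \<le> P" if "k \<noteq> 0"
  proof -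
    have "p ^ 1 \<le> p ^ k" using that prime_ge_1_nat[OF p] by (intro power_increasing) auto
    then show ?thesis using P by simp
  qed
  show "(Abs_fps (\<lambda>k. a (p ^ k)) * (\<Prod>j<d. 1 - fps_const (aj j p) * fps_X)) $ k = (1 :: complex fps) $ k"
  proof (cases "k = 0")
    case True
    have "a 1 = 1" using \<open>selberg_class a f\<close> unfolding selberg_class_def by auto
    moreover have "(\<Prod>j<d. 1 - fps_const (aj j p) * fps_X) $ 0 = 1"
      by (induction d) auto
    ultimately show ?thesis using True by simp
  next
    case False
    have "{x\<in>S. fst x = p} = {p} \<times> {..<d}" using pP[OF False] p by (auto simp: S_def)
    then have "(\<Prod>(p, j)\<in>{x\<in>S. fst x = p}. 1 - fps_const (aj j p) * fps_X) =
        (\<Prod>j<d. 1 - fps_const (aj j p) * fps_X)"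
      by (simp add: prod.cartesian_product[symmetric])
    moreover have "p ^ k \<noteq> 1" using False p by auto
    ultimately show ?thesis
      using c1[rule_format, OF p] coeff False by (metis (no_types, lifting) fps_nth_Abs_fps fps_one_nth)
  qed
qed

text \<open>By the Ramanujan hypothesis the local series at p converges up to radius p^(-\<epsilon>)
  for every \<epsilon> > 0. If some |a_j(p)| exceeded 1, the point 1 / a_j(p) would lie inside the
  unit disc, and for small \<epsilon> inside that disc of convergence. There the polynomial of local
  factors vanishes, although its product with the series is identically 1. The formula for a(p) is
  the coefficient of degree 1 in the same identity.\<close>

lemma selberg_poly_ramanujan_euler:
  assumes S: "selberg_poly a f" and R: "ramanujan a"
  obtains d :: nat and aj :: "nat \<Rightarrow> nat \<Rightarrow> complex" where "\<And>j p. j < d \<Longrightarrow> prime p \<Longrightarrow> norm (aj j p) \<le> 1"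
    "\<And>p. prime p \<Longrightarrow> a p = (\<Sum>j<d. aj j p)"
    "\<And>s. Re s > 1 \<Longrightarrow>
      (\<lambda>p. if prime p then (\<Prod>j<d. inverse (1 - aj j p / of_nat p powr s)) else 1) has_prod f s"
proof -
  from S obtain d :: nat and aj :: "nat \<Rightarrow> nat \<Rightarrow> complex" and \<theta> C where C: "\<theta> < 1/4"
    and aj0: "\<forall>j<d. \<forall>p. prime p \<longrightarrow> norm (aj j p) \<le> C * real p powr \<theta>"
    and hp0: "\<forall>s. Re s > 1 \<longrightarrow>
      (\<lambda>p. if prime p then (\<Prod>j<d. inverse (1 - aj j p / of_nat p powr s)) else 1) has_prod f s"
    unfolding selberg_poly_def by (elim conjE exE) (rule that; assumption)
  note aj = aj0[rule_format] and hp = hp0[rule_format]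
  have S': "selberg_class a f" using S by (simp add: selberg_poly_def)
  have aj': "norm (aj j p) \<le> max 1 C * real p powr (1/4)" if "j < d" "prime p" for j p
  proof -
    have "real p powr \<theta> \<le> real p powr (1/4)"
      using C prime_ge_1_nat[OF that(2)] by (intro powr_mono) auto
    then have "C * real p powr \<theta> \<le> max 1 C * real p powr (1/4)"
      by (intro mult_mono) auto
    then show ?thesis using aj[OF that] by linarith
  qed
  note loc = selberg_poly_local_series[OF S' aj' _ hp]
  have a1: "a 1 = 1" using S' unfolding selberg_class_def by auto
  show ?thesis
  proof (rule that[OF _ _ hp])
    fix p :: nat assume p: "prime p"
    have n0: "(\<Prod>j<m. 1 - fps_const (aj j p) * fps_X) $ 0 = 1" for m
      by (induction m) auto
    have n1: "(\<Prod>j<m. 1 - fps_const (aj j p) * fps_X) $ Suc 0 = - (\<Sum>j<m. aj j p)" for m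
      by (induction m) (auto simp: fps_mult_nth_1[unfolded One_nat_def] n0)
    have "(Abs_fps (\<lambda>k. a (p ^ k)) * (\<Prod>j<d. 1 - fps_const (aj j p) * fps_X)) $ Suc 0 = 0"
      using loc[OF _ _ _ _ p] by simp
    then show "a p = (\<Sum>j<d. aj j p)"
      using a1 by (simp add: fps_mult_nth_1[unfolded One_nat_def] n0 n1)
  next
    fix j p assume j: "j < d" and p: "prime (p :: nat)"
    show "norm (aj j p) \<le> 1"
    proof (rule ccontr)
      assume "\<not> norm (aj j p) \<le> 1"
      define A where "A = norm (aj j p)"
      have A: "A > 1" using \<open>\<not> _\<close> by (simp add: A_def)
      have p1: "real p > 1" using prime_gt_1_nat[OF p] by simp
      \<comment> \<open>Chosen so that p^\<epsilon> = A^(1/3). The radius r = A^(-2/3) then lies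
        strictly between |z| = A^(-1) and A^(-1/3), and at r the series is dominated by a geometric
        one of ratio A^(-1/3).\<close>
      define \<epsilon> where "\<epsilon> = ln A / (3 * ln p)"
      have \<epsilon>: "\<epsilon> > 0" using A p1 by (auto simp: \<epsilon>_def)
      have pe: "real p powr \<epsilon> = A powr (1/3)" using A p1 by (simp add: powr_def \<epsilon>_def)
      obtain K where K: "\<And>n. n \<ge> 1 \<Longrightarrow> norm (a n) \<le> K * real n powr \<epsilon>"
        using R \<epsilon> unfolding ramanujan_def by blast
      define r where "r = A powr (-2/3)"
      have r: "r > 0" using A by (simp add: r_def)
      define q where "q = A powr (-1/3)"
      have q: "0 < q" "q < 1" using A by (auto simp: q_def intro: powr_less_one)
      have "summable (\<lambda>k. a (p ^ k) * complex_of_real r ^ k)"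
      proof (rule summable_comparison_test'[of "\<lambda>k. K * q ^ k" 0])
        show "summable (\<lambda>k. K * q ^ k)" using q by (intro summable_mult summable_geometric) auto
        fix k
        have "real (p ^ k) powr \<epsilon> = (real p powr \<epsilon>) powr real k"
          using p1 by (simp add: powr_powr mult.commute flip: powr_realpow)
        also have "\<dots> = (A powr (1/3)) ^ k" using A by (simp add: pe powr_realpow)
        finally have "real (p ^ k) powr \<epsilon> = (A powr (1/3)) ^ k" .
        moreover have "norm (a (p ^ k)) \<le> K * real (p ^ k) powr \<epsilon>"
          using p1 by (intro K) auto
        ultimately have "norm (a (p ^ k)) * r ^ k \<le> K * (A powr (1/3)) ^ k * r ^ k"
          using r by (intro mult_right_mono) auto
        also have "\<dots> = K * (A powr (1/3) * r) ^ k" by (simp add: power_mult_distrib)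
        also have "A powr (1/3) * r = q" by (simp add: r_def q_def flip: powr_add)
        finally show "norm (a (p ^ k) * complex_of_real r ^ k) \<le> K * q ^ k"
          using r by (simp add: norm_mult norm_power)
      qed
      from conv_radius_geI[OF this] have rad: "ereal r \<le> fps_conv_radius (Abs_fps (\<lambda>k. a (p ^ k)))"
        using r by (simp add: fps_conv_radius_def)
      define z where "z = inverse (aj j p)"
      have "norm z < r"
      proof -
        have "norm z = A powr (-1)" using A by (simp add: z_def A_def norm_inverse powr_minus)
        also have "\<dots> < r" unfolding r_def using A by (intro powr_less_mono) auto
        finally show ?thesis .
      qed
      then have zr: "ereal (norm z) < fps_conv_radius (Abs_fps (\<lambda>k. a (p ^ k)))"
        using rad less_le_trans by (metis ereal_less(2) less_ereal.simps(1))
      define W where "W = (\<Prod>j<d. [:1, - aj j p:])"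
      have W: "(\<Prod>j<d. 1 - fps_const (aj j p) * fps_X) = fps_of_poly W"
        unfolding W_def fps_of_poly_prod fps_of_poly_linear' by (simp flip: fps_const_neg)
      have "1 = eval_fps (Abs_fps (\<lambda>k. a (p ^ k)) * fps_of_poly W) z"
        using loc[OF _ _ _ _ p] by (simp add: W)
      also have "\<dots> = eval_fps (Abs_fps (\<lambda>k. a (p ^ k))) z * poly W z"
        using zr by (subst eval_fps_mult) auto
      also have "poly W z = 0"
      proof -
        have "aj j p \<noteq> 0" using A by (auto simp: A_def)
        then have "1 + z * - aj j p = 0" by (simp add: z_def)
        then show ?thesis using j unfolding W_def poly_prod by (intro prod_zero) auto
      qed
      finally show False by simp
    qed
  qed
qed

section \<open>Approximation of the logarithm away from zeros\<close>

text \<open>After normalisation to the unit disc, h maps it into the half-plane Re < A and 0 to 0.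
  The map h / (2A - h) carries this half-plane into the unit disc, so the Schwarz lemma applies to
  \<phi>; solving for h gives the bound.\<close>

lemma borel_caratheodory:
  fixes g :: "complex \<Rightarrow> complex"
  assumes hol: "g holomorphic_on ball z0 R" and M: "\<And>z. z \<in> ball z0 R \<Longrightarrow> Re (g z) < M"
    and z: "z \<in> ball z0 R"
  shows "norm (g z - g z0) \<le> 2 * (M - Re (g z0)) * norm (z - z0) / (R - norm (z - z0))"
proof -
  have R: "R > 0" using z by (metis ball_eq_empty empty_iff not_le)
  define A where "A = M - Re (g z0)"
  have A: "A > 0" using M[of z0] R by (simp add: A_def)
  define h where "h w = g (z0 + of_real R * w) - g z0" for w
  define \<phi> where "\<phi> w = h w / (of_real (2 * A) - h w)" for w
  have mem: "z0 + of_real R * w \<in> ball z0 R" if "norm w < 1" for w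
    using that R by (simp add: dist_norm norm_mult)
  have Reh: "Re (h w) < A" if "norm w < 1" for w
    using M[OF mem[OF that]] by (simp add: h_def A_def)
  have nz: "of_real (2 * A) - h w \<noteq> 0" if "norm w < 1" for w
  proof
    assume "of_real (2 * A) - h w = 0"
    then have "Re (h w) = 2 * A" by (auto simp: complex_eq_iff)
    then show False using Reh[OF that] A by simp
  qed
  have h: "h holomorphic_on ball 0 1"
    unfolding h_def using mem
    by (intro holomorphic_intros holomorphic_on_compose_gen[OF _ hol, unfolded o_def]) auto
  have "norm (\<phi> w) \<le> norm w" if w: "norm w < 1" for w
  proof (rule Schwarz_Lemma(1))
    show "\<phi> holomorphic_on ball 0 1"
      unfolding \<phi>_def using nz by (intro holomorphic_intros h) auto
    show "\<phi> 0 = 0" by (simp add: \<phi>_def h_def)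
    show "norm w < 1" by fact
    fix w :: complex assume w: "norm w < 1"
    have "(norm (h w))\<^sup>2 < (norm (of_real (2 * A) - h w))\<^sup>2"
    proof -
      have "(norm (of_real (2 * A) - h w))\<^sup>2 - (norm (h w))\<^sup>2 = 4 * A * (A - Re (h w))"
        unfolding cmod_power2 by (simp add: power2_eq_square algebra_simps)
      then show ?thesis using A Reh[OF w] by (smt (verit) mult_pos_pos)
    qed
    then have "norm (h w) < norm (of_real (2 * A) - h w)" by (rule power2_less_imp_less) simp
    then show "norm (\<phi> w) < 1" using nz[OF w] by (simp add: \<phi>_def norm_divide)
  qed
  note \<phi> = this
  define w where "w = (z - z0) / of_real R"
  have nw: "norm w = norm (z - z0) / R" using R by (simp add: w_def norm_divide)
  have w: "norm w < 1" using z R by (simp add: nw dist_norm norm_minus_commute)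
  have hw: "h w = g z - g z0" using R by (simp add: h_def w_def)
  have "norm (h w) \<le> norm w * norm (of_real (2 * A) - h w)"
    using \<phi>[OF w] nz[OF w] by (simp add: \<phi>_def norm_divide divide_le_eq)
  also have "\<dots> \<le> norm w * (2 * A + norm (h w))"
    using norm_triangle_ineq4[of "of_real (2 * A)" "h w"] A by (intro mult_left_mono) auto
  finally have "norm (h w) * (1 - norm w) \<le> 2 * A * norm w" by (simp add: algebra_simps)
  then have "norm (h w) * (1 - norm w) * R \<le> 2 * A * norm w * R"
    using R by (intro mult_right_mono) auto
  moreover have "(1 - norm w) * R = R - norm (z - z0)" "norm w * R = norm (z - z0)"
    using R by (simp_all add: nw field_simps)
  ultimately have "norm (h w) * (R - norm (z - z0)) \<le> 2 * A * norm (z - z0)"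
    by (simp add: mult.assoc)
  moreover have "R - norm (z - z0) > 0" using z by (simp add: dist_norm norm_minus_commute)
  ultimately show ?thesis by (simp add: hw A_def le_divide_eq)
qed

text \<open>The Cauchy estimate is centred at the value \<open>g z0\<close>, so only a one-sided
  bound on the real part is used. This is what the logarithm of a function of polynomial growth
  provides.\<close>

lemma taylor_coeff_bound_Re:
  fixes g :: "complex \<Rightarrow> complex"
  assumes hol: "g holomorphic_on ball z0 R" and M: "\<And>z. z \<in> ball z0 R \<Longrightarrow> Re (g z) < M"
    and r: "0 < r" "r < R" and n: "n > 0"
  shows "norm ((deriv ^^ n) g z0 / fact n) \<le> 2 * (M - Re (g z0)) * r / (R - r) / r ^ n"
proof -
  have "norm ((deriv ^^ n) g z0) \<le> fact n * (2 * (M - Re (g z0)) * r / (R - r)) / r ^ n"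
  proof (rule Cauchy_higher_deriv_bound[where y = "g z0"])
    show "g holomorphic_on ball z0 r" using r by (intro holomorphic_on_subset[OF hol]) auto
    show "continuous_on (cball z0 r) g"
      using r by (intro continuous_on_subset[OF holomorphic_on_imp_continuous_on[OF hol]]) auto
    fix w assume w: "w \<in> ball z0 r"
    have A: "M - Re (g z0) > 0" using M[of z0] r by simp
    have "norm (g w - g z0) \<le> 2 * (M - Re (g z0)) * norm (w - z0) / (R - norm (w - z0))"
      using w r by (intro borel_caratheodory[OF hol M]) auto
    also have "\<dots> < 2 * (M - Re (g z0)) * r / (R - r)"
      using w r A by (intro frac_less mult_strict_left_mono)
        (auto simp: dist_norm norm_minus_commute intro!: mult_nonneg_nonneg)
    finally show "g w \<in> ball (g z0) (2 * (M - Re (g z0)) * r / (R - r))"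
      by (simp add: dist_norm norm_minus_commute)
  qed (use r n in auto)
  then show ?thesis by (simp add: norm_divide field_simps)
qed

text \<open>Linear in \<open>f\<close> and determined by the germ at \<open>z0\<close>. A function
  can thus be split into pieces, some of which are known only near \<open>z0\<close>, and the
  polynomial still evaluated at a far displacement \<open>z\<close>.\<close>

definition taylor_sum :: "nat \<Rightarrow> (complex \<Rightarrow> complex) \<Rightarrow> complex \<Rightarrow> complex \<Rightarrow> complex" where
  "taylor_sum N g z0 z = (\<Sum>n<N. (deriv ^^ n) g z0 / fact n * z ^ n)"

lemma taylor_sum_add:
  assumes "f holomorphic_on S" "g holomorphic_on S" "open S" "z0 \<in> S"
  shows "taylor_sum N (\<lambda>w. f w + g w) z0 z = taylor_sum N f z0 z + taylor_sum N g z0 z"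
  unfolding taylor_sum_def
  by (simp add: higher_deriv_add[OF assms] add_divide_distrib distrib_right sum.distrib)

lemma taylor_sum_sum:
  assumes "finite I" "\<And>i. i \<in> I \<Longrightarrow> f i holomorphic_on S" "open S" "z0 \<in> S"
  shows "taylor_sum N (\<lambda>w. \<Sum>i\<in>I. f i w) z0 z = (\<Sum>i\<in>I. taylor_sum N (f i) z0 z)"
  using assms(1,2)
proof (induction I rule: finite_induct)
  case empty
  show ?case by (simp add: taylor_sum_def)
next
  case (insert i I)
  have "taylor_sum N (\<lambda>w. f i w + (\<Sum>i\<in>I. f i w)) z0 z =
      taylor_sum N (f i) z0 z + taylor_sum N (\<lambda>w. \<Sum>i\<in>I. f i w) z0 z"
    using insert assms by (intro taylor_sum_add[of _ S] holomorphic_intros) auto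
  then show ?case using insert by simp
qed

lemma sum_geometric_le:
  fixes q :: real
  assumes "0 \<le> q" "q < 1"
  shows "(\<Sum>n<N. q ^ n) \<le> 1 / (1 - q)"
proof -
  have "(\<Sum>n<N. q ^ n) \<le> (\<Sum>n. q ^ n)"
    using assms by (intro sum_le_suminf summable_geometric) auto
  then show ?thesis using assms by (simp add: suminf_geometric)
qed

lemma norm_taylor_sum_le:
  assumes hol: "g holomorphic_on ball z0 R" and r: "0 < r" "r < R"
    and B: "\<And>z. z \<in> ball z0 R \<Longrightarrow> norm (g z) \<le> B" and z: "norm z < r"
  shows "norm (taylor_sum N g z0 z) \<le> B / (1 - norm z / r)"
proof -
  have B0: "B \<ge> 0" using order_trans[OF norm_ge_zero B[of z0]] r by auto
  have "norm ((deriv ^^ n) g z0) \<le> fact n * B / r ^ n" for n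
  proof (rule Cauchy_inequality)
    show "g holomorphic_on ball z0 r" using r by (intro holomorphic_on_subset[OF hol]) auto
    show "continuous_on (cball z0 r) g"
      using r by (intro continuous_on_subset[OF holomorphic_on_imp_continuous_on[OF hol]]) auto
    show "norm (g x) \<le> B" if "norm (z0 - x) = r" for x
      using that r by (intro B) (auto simp: dist_norm)
  qed (use r in auto)
  then have 1: "norm ((deriv ^^ n) g z0 / fact n * z ^ n) \<le> B * (norm z / r) ^ n" for n
  proof -
    assume a: "\<And>n. norm ((deriv ^^ n) g z0) \<le> fact n * B / r ^ n"
    have "norm ((deriv ^^ n) g z0 / fact n * z ^ n) = norm ((deriv ^^ n) g z0) / fact n * norm z ^ n"
      by (simp add: norm_mult norm_divide norm_power)
    also have "\<dots> \<le> (fact n * B / r ^ n) / fact n * norm z ^ n"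
      using a by (intro mult_right_mono divide_right_mono) auto
    finally show ?thesis by (simp add: power_divide)
  qed
  have "norm (taylor_sum N g z0 z) \<le> (\<Sum>n<N. B * (norm z / r) ^ n)"
    unfolding taylor_sum_def by (intro sum_norm_le 1)
  also have "\<dots> = B * (\<Sum>n<N. (norm z / r) ^ n)" by (simp add: sum_distrib_left)
  also have "\<dots> \<le> B * (1 / (1 - norm z / r))"
    using r z B0 by (intro mult_left_mono sum_geometric_le) auto
  finally show ?thesis by simp
qed

lemma taylor_remainder_Re:
  assumes hol: "g holomorphic_on ball z0 R" and M: "\<And>z. z \<in> ball z0 R \<Longrightarrow> Re (g z) < M"
    and r: "0 < r" "r < R" and N: "N > 0" and z: "norm z < r"
  shows "norm (g (z0 + z) - taylor_sum N g z0 z) \<le>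
    2 * (M - Re (g z0)) * r / (R - r) * (norm z / r) ^ N / (1 - norm z / r)"
proof -
  define c where "c n = (deriv ^^ n) g z0 / fact n * z ^ n" for n
  define B where "B = 2 * (M - Re (g z0)) * r / (R - r)"
  define q where "q = norm z / r"
  have q: "0 \<le> q" "q < 1" using r z by (auto simp: q_def)
  have "c sums g (z0 + z)"
    using holomorphic_power_series[OF hol, of "z0 + z"] r z by (simp add: c_def[abs_def] dist_norm)
  then have s: "(\<lambda>n. c (n + N)) sums (g (z0 + z) - taylor_sum N g z0 z)"
    unfolding taylor_sum_def c_def[symmetric] by (rule sums_split_initial_segment)
  have "norm (c (n + N)) \<le> B * q ^ N * q ^ n" for n
  proof -
    have "norm (c (n + N)) = norm ((deriv ^^ (n + N)) g z0 / fact (n + N)) * norm z ^ (n + N)"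
      by (simp only: c_def norm_mult norm_power)
    also have "\<dots> \<le> B / r ^ (n + N) * norm z ^ (n + N)"
      unfolding B_def using N by (intro mult_right_mono taylor_coeff_bound_Re[OF hol M r]) auto
    also have "\<dots> = B * q ^ (n + N)" by (simp add: q_def power_divide)
    finally show ?thesis by (simp add: power_add mult_ac)
  qed
  then have "norm (\<Sum>n. c (n + N)) \<le> (\<Sum>n. B * q ^ N * q ^ n)"
    using q by (intro norm_suminf_le summable_mult summable_geometric) auto
  also have "\<dots> = B * q ^ N * (1 / (1 - q))"
    using q by (subst suminf_mult) (auto simp: suminf_geometric)
  finally show ?thesis using s by (simp add: sums_iff B_def q_def)
qed

text \<open>The displacement may lie far outside the unit disc on which \<open>g\<close> is
  controlled. Coefficients of size 2^n from Cauchy's estimate on radius 1/2, times 4^n, give the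
  loss 8^N; it is affordable because \<eta> will be a negative power of Z and Z exponential in N.
  Only the real part of \<open>g\<close> is assumed small, hence only real parts are
  bounded.\<close>

lemma Re_taylor_sum_le:
  assumes hol: "g holomorphic_on ball z0 1" and M: "\<And>z. z \<in> ball z0 1 \<Longrightarrow> \<bar>Re (g z)\<bar> \<le> \<eta>"
    and \<eta>: "\<eta> > 0" and z: "norm z \<le> 4"
  shows "\<bar>Re (taylor_sum N g z0 z)\<bar> \<le> 6 * \<eta> * N * 8 ^ N"
proof -
  have c: "\<bar>Re ((deriv ^^ n) g z0 / fact n * z ^ n)\<bar> \<le> 6 * \<eta> * 8 ^ n" for n
  proof (cases "n = 0")
    case True
    then show ?thesis using M[of z0] \<eta> by auto
  next
    case False
    have "Re (g w) < 2 * \<eta>" if "w \<in> ball z0 1" for w using M[OF that] \<eta> by auto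
    then have "norm ((deriv ^^ n) g z0 / fact n) \<le> 2 * (2 * \<eta> - Re (g z0)) * (1/2) / (1 - 1/2) / (1/2) ^ n"
      using False by (intro taylor_coeff_bound_Re[OF hol]) auto
    also have "\<dots> = 2 * (2 * \<eta> - Re (g z0)) * 2 ^ n" by (simp add: power_divide field_simps)
    also have "\<dots> \<le> 2 * (3 * \<eta>) * 2 ^ n"
      using M[of z0] by (intro mult_right_mono mult_left_mono) auto
    finally have "norm ((deriv ^^ n) g z0 / fact n) * norm z ^ n \<le> (6 * \<eta> * 2 ^ n) * 4 ^ n"
      using z \<eta> by (intro mult_mono power_mono) auto
    also have "\<dots> = 6 * \<eta> * 8 ^ n" by (simp flip: power_mult_distrib)
    finally show ?thesis
      using abs_Re_le_cmod[of "(deriv ^^ n) g z0 / fact n * z ^ n"]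
      unfolding norm_mult norm_power by linarith
  qed
  have "\<bar>Re (taylor_sum N g z0 z)\<bar> \<le> (\<Sum>n<N. \<bar>Re ((deriv ^^ n) g z0 / fact n * z ^ n)\<bar>)"
    unfolding taylor_sum_def Re_sum by (rule sum_abs)
  also have "\<dots> \<le> (\<Sum>n<N. 6 * \<eta> * 8 ^ N)"
  proof (rule sum_mono)
    fix n assume "n \<in> {..<N}"
    then have "(8::real) ^ n \<le> 8 ^ N" by (intro power_increasing) auto
    then have "6 * \<eta> * 8 ^ n \<le> 6 * \<eta> * 8 ^ N" using \<eta> by simp
    then show "\<bar>Re ((deriv ^^ n) g z0 / fact n * z ^ n)\<bar> \<le> 6 * \<eta> * 8 ^ N"
      using c[of n] by linarith
  qed
  finally show ?thesis by (simp add: mult_ac)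
qed

section \<open>Taylor polynomials of the terms of a Dirichlet series\<close>

lemma higher_deriv_nat_powr:
  fixes A :: complex
  assumes "p > (0::nat)"
  shows "(deriv ^^ n) (\<lambda>s. A / of_nat p powr s) = (\<lambda>s. A * (- of_real (ln p)) ^ n / of_nat p powr s)"
proof (induction n)
  case (Suc n)
  have "deriv (\<lambda>s. A * (- of_real (ln p)) ^ n / of_nat p powr s) s =
      A * (- of_real (ln p)) ^ Suc n / of_nat p powr s" for s
    using assms by (intro DERIV_imp_deriv)
      (auto intro!: derivative_eq_intros simp: Ln_of_nat field_simps power2_eq_square)
  then show ?case by (simp add: Suc.IH)
qed simp

text \<open>For r \<ge> 0 this is the probability that a Poisson variable of mean r * log p is less
  than N: a smooth cutoff, close to 1 while r * log p is well below N and close to 0 well above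
  it.\<close>

definition exp_weight :: "nat \<Rightarrow> real \<Rightarrow> nat \<Rightarrow> real" where
  "exp_weight N r p = real p powr (- r) * (\<Sum>n<N. (r * ln p) ^ n / fact n)"

lemma taylor_sum_nat_powr:
  assumes "p > (0::nat)"
  shows "taylor_sum N (\<lambda>s. A / of_nat p powr s) (Complex 4 t) (of_real (\<sigma> - 4)) =
    A * of_real (exp_weight N (4 - \<sigma>) p) / of_nat p powr (Complex \<sigma> t)"
proof -
  define r where "r = 4 - \<sigma>"
  have e: "of_nat p powr Complex 4 t = of_nat p powr (Complex \<sigma> t) * of_real (real p powr r)"
  proof -
    have "Complex 4 t = Complex \<sigma> t + of_real r" by (simp add: complex_eq_iff r_def)
    then show ?thesis using powr_of_real[of "real p" r] by (simp add: powr_add)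
  qed
  have "taylor_sum N (\<lambda>s. A / of_nat p powr s) (Complex 4 t) (of_real (\<sigma> - 4)) =
     (\<Sum>n<N. A / of_nat p powr Complex 4 t * of_real ((r * ln p) ^ n / fact n))"
    unfolding taylor_sum_def higher_deriv_nat_powr[OF assms]
  proof (intro sum.cong refl)
    fix n
    have "(- of_real (ln p)) ^ n * of_real (\<sigma> - 4) ^ n = (of_real (r * ln p) :: complex) ^ n"
      unfolding power_mult_distrib[symmetric] by (simp add: r_def algebra_simps)
    then show "A * (- of_real (ln p)) ^ n / of_nat p powr Complex 4 t / fact n * of_real (\<sigma> - 4) ^ n =
       A / of_nat p powr Complex 4 t * of_real ((r * ln p) ^ n / fact n)"
      by (simp add: field_simps)
  qed
  also have "\<dots> = A / of_nat p powr Complex 4 t * of_real (\<Sum>n<N. (r * ln p) ^ n / fact n)"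
    by (simp add: sum_distrib_left)
  also have "\<dots> = A * of_real (exp_weight N r p) / of_nat p powr (Complex \<sigma> t)"
    unfolding e exp_weight_def using assms by (simp add: powr_minus field_simps)
  finally show ?thesis by (simp add: r_def)
qed

section \<open>The Euler product in the half-plane Re s \<ge> 3\<close>

lemma abs_ln_norm_le:
  fixes w :: complex
  assumes "norm (w - 1) \<le> 1/2"
  shows "w \<noteq> 0" "\<bar>ln (norm w)\<bar> \<le> 2 * norm (w - 1)"
proof -
  show w: "w \<noteq> 0" using assms by auto
  have h: "1/2 \<le> norm w" "\<bar>norm w - 1\<bar> \<le> norm (w - 1)"
    using norm_triangle_ineq2[of 1 "1 - w"] norm_triangle_ineq3[of w 1] assms
    by (auto simp: norm_minus_commute)
  show "\<bar>ln (norm w)\<bar> \<le> 2 * norm (w - 1)"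
  proof (cases "norm w \<ge> 1")
    case True
    then show ?thesis using ln_add_one_self_le_self2[of "norm w - 1"] h w by auto
  next
    case False
    have "- ln (norm w) = ln (1 / norm w)" using w by (simp add: ln_div)
    also have "\<dots> \<le> 1 / norm w - 1" using w by (intro ln_le_minus_one) auto
    also have "\<dots> = (1 - norm w) / norm w" using w by (simp add: field_simps)
    also have "\<dots> \<le> (1 - norm w) / (1/2)" using h False by (intro divide_left_mono) auto
    finally have "- ln (norm w) \<le> 2 * (1 - norm w)" by simp
    moreover have "ln (norm w) \<le> norm w - 1" using w by (intro ln_le_minus_one) auto
    ultimately show ?thesis using h False by (auto simp: abs_le_iff)
  qed
qed

text \<open>The exponent -3/4 is the 9/4 - Re s of \<open>euler_tail_bound\<close> at Re s = 3.
  \<open>Z\<close> must be large so that the product is within 1/2 of 1, where |log |w|| \<le> 2 |w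
  - 1|.\<close>

lemma euler_tail_ln:
  fixes d :: nat and aj :: "nat \<Rightarrow> nat \<Rightarrow> complex"
  assumes aj: "\<And>j p. j < d \<Longrightarrow> prime p \<Longrightarrow> norm (aj j p) \<le> 1"
    and hp: "\<And>s. Re s > 1 \<Longrightarrow>
      (\<lambda>p. if prime p then (\<Prod>j<d. inverse (1 - aj j p / of_nat p powr s)) else 1) has_prod f s"
  obtains K :: real and Z0 :: nat where "K > 0"
    "\<And>Z s. Z \<ge> Z0 \<Longrightarrow> Re s \<ge> 3 \<Longrightarrow> f s * euler_poly d aj Z s \<noteq> 0 \<and>
        \<bar>ln (norm (f s * euler_poly d aj Z s))\<bar> \<le> K * real (Z + 1) powr (-3/4)"
proof -
  define M where "M = 1 + 2 * real d * (\<Sum>n. 1 / real n ^ 2)"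
  have S0: "(\<Sum>n. 1 / real n ^ 2) \<ge> 0"
    using inverse_power_summable[of 2, where ?'a = real]
    by (intro suminf_nonneg) (auto simp: field_simps)
  then have M: "M \<ge> 1" by (simp add: M_def)
  have "((\<lambda>Z. M * real (Z + 1) powr (-3/4)) \<longlongrightarrow> M * 0) sequentially"
    by (intro tendsto_intros) real_asymp
  then have "eventually (\<lambda>Z. M * real (Z + 1) powr (-3/4) < 1/4) sequentially"
    by (intro order_tendstoD) auto
  then obtain Z1 where Z1: "\<And>Z. Z \<ge> Z1 \<Longrightarrow> M * real (Z + 1) powr (-3/4) < 1/4"
    by (auto simp: eventually_sequentially)
  show ?thesis
  proof (rule that[of "4 * M" "Z1 + 1"])
    fix Z s assume Z: "Z \<ge> Z1 + 1" and s: "Re s \<ge> 3"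
    define y where "y = M * real (Z + 1) powr (-3/4)"
    have y: "0 \<le> y" "y \<le> 1/4" using Z1[of Z] Z M by (auto simp: y_def)
    have "norm (f s * euler_poly d aj Z s - 1) \<le>
        exp (2 * real d * 1 * (\<Sum>n. 1 / real n ^ 2) * real (Z + 1) powr (9/4 - Re s)) - 1"
    proof (rule euler_tail_bound)
      fix j p assume jp: "j < d" "prime (p::nat)"
      have "1 \<le> real p powr (1/4)" using prime_ge_1_nat[OF jp(2)] by (intro ge_one_powr_ge_zero) auto
      then show "norm (aj j p) \<le> 1 * real p powr (1/4)" using aj[OF jp] by simp
    next
      have "2 powr (1/4 - Re s) \<le> 2 powr (-1 :: real)" using s by (intro powr_mono) auto
      then show "1 * 2 powr (1/4 - Re s) < 1" by (simp add: powr_minus)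
    qed (use s Z hp in auto)
    also have "2 * real d * 1 * (\<Sum>n. 1 / real n ^ 2) * real (Z + 1) powr (9/4 - Re s) \<le> y"
      unfolding y_def M_def using s S0 by (intro mult_mono powr_mono) auto
    also have "exp y - 1 \<le> y + y\<^sup>2" using exp_bound[OF y(1)] y by simp
    also have "\<dots> \<le> 2 * y" using y mult_left_mono[of y 1 y] by (simp add: power2_eq_square)
    finally have *: "norm (f s * euler_poly d aj Z s - 1) \<le> 2 * y" by simp
    with y have "norm (f s * euler_poly d aj Z s - 1) \<le> 1/2" by simp
    from abs_ln_norm_le[OF this] show "f s * euler_poly d aj Z s \<noteq> 0 \<and>
        \<bar>ln (norm (f s * euler_poly d aj Z s))\<bar> \<le> 4 * M * real (Z + 1) powr (-3/4)"
      using * by (auto simp: y_def)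
  qed (use M in auto)
qed

text \<open>Supplies the lower bound for |f| at the centre 4 + it, without which an upper bound for
  log |f| on the disc would not control the Taylor remainder. Beyond a fixed prime the tail estimate
  applies; each of the finitely many remaining factors contributes at most 1.\<close>

lemma abs_ln_far_right:
  fixes d :: nat and aj :: "nat \<Rightarrow> nat \<Rightarrow> complex"
  assumes aj: "\<And>j p. j < d \<Longrightarrow> prime p \<Longrightarrow> norm (aj j p) \<le> 1"
    and hp: "\<And>s. Re s > 1 \<Longrightarrow>
      (\<lambda>p. if prime p then (\<Prod>j<d. inverse (1 - aj j p / of_nat p powr s)) else 1) has_prod f s"
  obtains B :: real where "B > 0" "\<And>s. Re s \<ge> 3 \<Longrightarrow> \<bar>ln (norm (f s))\<bar> \<le> B"
proof -
  obtain K :: real and Z :: nat where K: "K > 0" and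
    E: "\<And>Z' s. Z' \<ge> Z \<Longrightarrow> Re s \<ge> 3 \<Longrightarrow> f s * euler_poly d aj Z' s \<noteq> 0 \<and>
        \<bar>ln (norm (f s * euler_poly d aj Z' s))\<bar> \<le> K * real (Z' + 1) powr (-3/4)"
    using euler_tail_ln[OF aj hp] by metis
  show ?thesis
  proof (rule that[of "K + (\<Sum>p | prime p \<and> p \<le> Z. \<Sum>j<d. 1)"])
    show "0 < K + (\<Sum>p | prime p \<and> p \<le> Z. \<Sum>j<d. 1)" using K by (auto intro: add_pos_nonneg)
    fix s :: complex assume s: "Re s \<ge> 3"
    define v where "v j p = aj j p / of_nat p powr s" for j p
    have v: "1 - v j p \<noteq> 0" "\<bar>ln (norm (1 - v j p))\<bar> \<le> 1" if "j < d" "prime p" for j p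
    proof -
      have p2: "real p \<ge> 2" using prime_ge_2_nat[OF that(2)] by simp
      have "2 powr 3 \<le> 2 powr Re s" using s by (intro powr_mono) auto
      also have "\<dots> \<le> real p powr Re s" using p2 s by (intro powr_mono2) auto
      finally have "8 \<le> real p powr Re s" by simp
      then have "norm (v j p) \<le> 1/2"
        using aj[OF that] by (simp add: v_def norm_divide norm_of_nat_powr divide_le_eq)
      then have "norm ((1 - v j p) - 1) \<le> 1/2" by simp
      from abs_ln_norm_le[OF this] show "1 - v j p \<noteq> 0" "\<bar>ln (norm (1 - v j p))\<bar> \<le> 1"
        using \<open>norm (v j p) \<le> 1/2\<close> by auto
    qed
    have "ln (norm (euler_poly d aj Z s)) = (\<Sum>p | prime p \<and> p \<le> Z. \<Sum>j<d. ln (norm (1 - v j p)))"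
    proof -
      have "norm (euler_poly d aj Z s) = (\<Prod>p | prime p \<and> p \<le> Z. \<Prod>j<d. norm (1 - v j p))"
        unfolding euler_poly_def v_def by (simp add: prod_norm)
      also have "ln \<dots> = (\<Sum>p | prime p \<and> p \<le> Z. ln (\<Prod>j<d. norm (1 - v j p)))"
        using v(1) by (intro ln_prod) (auto intro!: prod_pos)
      also have "\<dots> = (\<Sum>p | prime p \<and> p \<le> Z. \<Sum>j<d. ln (norm (1 - v j p)))"
        using v(1) by (intro sum.cong ln_prod) auto
      finally show ?thesis .
    qed
    also have "\<bar>\<dots>\<bar> \<le> (\<Sum>p | prime p \<and> p \<le> Z. \<Sum>j<d. 1)"
      using v(2) by (intro order_trans[OF sum_abs] sum_mono) auto
    finally have a: "\<bar>ln (norm (euler_poly d aj Z s))\<bar> \<le> (\<Sum>p | prime p \<and> p \<le> Z. \<Sum>j<d. 1)" by simp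
    have e: "f s * euler_poly d aj Z s \<noteq> 0"
      "\<bar>ln (norm (f s * euler_poly d aj Z s))\<bar> \<le> K * real (Z + 1) powr (-3/4)"
      using E[of Z s] s by auto
    have "real (Z + 1) powr (-3/4) \<le> real (Z + 1) powr 0" by (intro powr_mono) auto
    then have "K * real (Z + 1) powr (-3/4) \<le> K" using K by (simp add: mult_le_cancel_left2)
    moreover have "ln (norm (f s * euler_poly d aj Z s)) = ln (norm (f s)) + ln (norm (euler_poly d aj Z s))"
      using e(1) by (simp add: norm_mult ln_mult)
    ultimately show "\<bar>ln (norm (f s))\<bar> \<le> K + (\<Sum>p | prime p \<and> p \<le> Z. \<Sum>j<d. 1)"
      using a e(2) by linarith
  qed
qed

text \<open>On a disc free of zeros the logarithm of \<^term>\<open>f\<close> is, up to a bounded error, the real part of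
  the Taylor polynomial at \<open>4 + it\<close>; applied termwise to the Dirichlet series this polynomial
  becomes the smoothing weight \<^const>\<open>exp_weight\<close>.  Prime powers contribute \<open>O(1)\<close>.\<close>

lemma ln_norm_approx:
  fixes d :: nat and aj :: "nat \<Rightarrow> nat \<Rightarrow> complex" and \<sigma>0 \<sigma> :: real
  assumes S: "selberg_class a f"
    and aj: "\<And>j p. j < d \<Longrightarrow> prime p \<Longrightarrow> norm (aj j p) \<le> 1"
    and ap: "\<And>p. prime p \<Longrightarrow> a p = (\<Sum>j<d. aj j p)"
    and hp: "\<And>s. Re s > 1 \<Longrightarrow>
      (\<lambda>p. if prime p then (\<Prod>j<d. inverse (1 - aj j p / of_nat p powr s)) else 1) has_prod f s"
    and \<sigma>: "1/2 < \<sigma>0" "\<sigma>0 < \<sigma>" "\<sigma> \<le> 1"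
  obtains K q t1 :: real and Z0 :: nat where "K > 0" "0 < q" "q < 1" "t1 \<ge> 1"
    "\<And>(t::real) (N::nat) (Z::nat). t \<ge> t1 \<Longrightarrow> N > 0 \<Longrightarrow> Z \<ge> Z0 \<Longrightarrow> (\<And>s. s \<in> ball (Complex 4 t) (4 - \<sigma>0) \<Longrightarrow> f s \<noteq> 0) \<Longrightarrow>
      f (Complex \<sigma> t) \<noteq> 0 \<and>
      \<bar>ln (norm (f (Complex \<sigma> t))) - (\<Sum>p | prime p \<and> p \<le> Z.
          Re (a p * of_real (exp_weight N (4 - \<sigma>) p) / of_nat p powr (Complex \<sigma> t)))\<bar>
        \<le> K * (1 + ln t * q ^ N + real N * 8 ^ N * real (Z + 1) powr (-3/4))"
proof -
  define R where "R = 4 - \<sigma>0"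
  define r where "r = 4 - \<sigma>"
  \<comment> \<open>Midway between the distance r from the centre to the target point and the radius
    R of the zero-free disc: the Cauchy estimates need room inside R, the geometric series needs
    room outside r.\<close>
  define r' where "r' = (r + R) / 2"
  define q where "q = r / r'"
  have r: "3 \<le> r" "r < r'" "r' < R" "R < 4" using \<sigma> by (auto simp: r_def R_def r'_def)
  have q: "0 < q" "q < 1" using r by (auto simp: q_def)
  obtain C t0 :: real and n :: nat where C: "C \<ge> 1" "t0 \<ge> 1"
    and growth: "\<And>s. Re s \<ge> 0 \<Longrightarrow> Im s \<ge> t0 \<Longrightarrow> norm (f s) \<le> C * Im s ^ n"
    using selberg_class_growth[OF S] by metis
  obtain B :: real where B: "B > 0" "\<And>s. Re s \<ge> 3 \<Longrightarrow> \<bar>ln (norm (f s))\<bar> \<le> B"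
    using abs_ln_far_right[OF aj hp] by metis
  obtain K1 :: real and Z0 :: nat where K1: "K1 > 0" and
    E: "\<And>Z s. Z \<ge> Z0 \<Longrightarrow> Re s \<ge> 3 \<Longrightarrow> f s * euler_poly d aj Z s \<noteq> 0 \<and>
        \<bar>ln (norm (f s * euler_poly d aj Z s))\<bar> \<le> K1 * real (Z + 1) powr (-3/4)"
    using euler_tail_ln[OF aj hp] by metis
  define S2 where "S2 = (\<Sum>m. real m powr (- 2 * \<sigma>0))"
  have sS2: "summable (\<lambda>m. real m powr (- 2 * \<sigma>0))" using \<sigma> by (simp add: summable_real_powr_iff)
  have S2: "S2 \<ge> 0" unfolding S2_def by (intro suminf_nonneg sS2) auto
  define M where "M t = ln C + n * (2 * ln t) + 1" for t
  define A where "A = 2 * r' / (R - r') / (1 - q)"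
  have A: "A > 0" using r q by (auto simp: A_def)
  define K where "K = A * (ln C + 2 * n + 1 + B) + 6 * K1 + d * (4 / (1 - q)) * S2"
  define t1 where "t1 = max 3 (t0 + 4)"
  have lnC: "ln C \<ge> 0" using C by simp
  have K: "K > 0" "A * (ln C + 2 * n + 1 + B) \<le> K" "6 * K1 \<le> K" "d * (4 / (1 - q)) * S2 \<le> K"
  proof -
    have "A * (ln C + 2 * n + 1 + B) > 0" using A lnC B by (intro mult_pos_pos) auto
    moreover have "d * (4 / (1 - q)) * S2 \<ge> 0" using q S2 by auto
    ultimately show "K > 0" "A * (ln C + 2 * n + 1 + B) \<le> K" "6 * K1 \<le> K" "d * (4 / (1 - q)) * S2 \<le> K"
      using K1 by (auto simp: K_def)
  qed
  show ?thesis
  proof (rule that[of "K" q t1 Z0])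
    show "K > 0" "0 < q" "q < 1" "t1 \<ge> 1" using K q by (auto simp: t1_def)
    fix t :: real and N Z :: nat
    assume t: "t \<ge> t1" and N: "N > 0" and Z: "Z \<ge> Z0"
      and nz: "\<And>s. s \<in> ball (Complex 4 t) (4 - \<sigma>0) \<Longrightarrow> f s \<noteq> 0"
    define z0 where "z0 = Complex 4 t"
    define z where "z = complex_of_real (\<sigma> - 4)"
    define P where "P = {p. prime p \<and> p \<le> Z}"
    have P: "finite P" "\<And>p. p \<in> P \<Longrightarrow> prime p" by (auto simp: P_def)
    have nzm: "norm z = r" unfolding z_def r_def norm_of_real using \<sigma> by simp
    have z0z: "z0 + z = Complex \<sigma> t" by (simp add: z0_def z_def complex_eq_iff)
    have t3: "t \<ge> 3" "t \<ge> t0 + 4" using t by (auto simp: t1_def)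
    have lnt: "ln t \<ge> 1"
      using t3 ln_mono[of "exp 1" t] exp_le by (simp add: order_trans)
    have ballD: "Re s > \<sigma>0" "\<bar>Im s - t\<bar> < 4" if "s \<in> ball z0 R" for s
    proof -
      have "\<bar>Re (z0 - s)\<bar> < R" "\<bar>Im (z0 - s)\<bar> < R"
        using that abs_Re_le_cmod[of "z0 - s"] abs_Im_le_cmod[of "z0 - s"] by (auto simp: dist_norm)
      then show "Re s > \<sigma>0" "\<bar>Im s - t\<bar> < 4" using r by (auto simp: z0_def R_def abs_if split: if_splits)
    qed
    have holf: "f holomorphic_on ball z0 R"
      using t3 C ballD by (intro holomorphic_on_subset[OF selberg_class_holomorphic[OF S]]) fastforce
    have "contractible (ball z0 R)" by (intro convex_imp_contractible convex_ball)
    then obtain g where g: "g holomorphic_on ball z0 R" "\<And>s. s \<in> ball z0 R \<Longrightarrow> f s = exp (g s)"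
      using contractible_imp_holomorphic_log[OF holf] nz by (auto simp: z0_def R_def)
    have Reg: "Re (g s) = ln (norm (f s))" if "s \<in> ball z0 R" for s
      using g(2)[OF that] by simp
    have gM: "Re (g s) < M t" if "s \<in> ball z0 R" for s
    proof -
      have im: "Im s \<ge> t0" "Im s > 0" "Im s \<le> t\<^sup>2"
      proof -
        show "Im s \<ge> t0" "Im s > 0" using ballD(2)[OF that] t3 C by auto
        have "Im s \<le> t + 4" using ballD(2)[OF that] by auto
        also have "\<dots> \<le> t * 3" using t3 by simp
        also have "\<dots> \<le> t\<^sup>2" using t3 by (simp add: power2_eq_square)
        finally show "Im s \<le> t\<^sup>2" .
      qed
      have "norm (f s) \<le> C * Im s ^ n" using ballD[OF that] \<sigma> im by (intro growth) auto
      also have "\<dots> \<le> C * (t\<^sup>2) ^ n" using im C by (intro mult_left_mono power_mono) auto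
      finally have "ln (norm (f s)) \<le> ln (C * (t\<^sup>2) ^ n)"
        using nz that t3 C by (subst ln_le_cancel_iff) (auto simp: z0_def R_def)
      also have "\<dots> = ln C + n * (2 * ln t)" using C t3 by (simp add: ln_mult ln_realpow)
      finally show ?thesis using Reg[OF that] by (simp add: M_def)
    qed
    have z0in: "z0 \<in> ball z0 R" using r by simp
    \<comment> \<open>\<open>v\<close> is the prime term of a local logarithm \<open>l\<close>, and
      \<open>e\<close> the contribution of the higher powers of p. Since \<open>e\<close> is O(p^(-2
      \<sigma>0)) and \<sigma>0 > 1/2, it is summable over p uniformly on the disc.\<close>
    define v where "v j p s = aj j p / of_nat p powr s" for j p s
    define l where "l j p s = - Ln (1 - v j p s)" for j p s
    define e where "e j p s = l j p s - v j p s" for j p s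
    have pos: "p > 0" if "p \<in> P" for p using prime_gt_0_nat[OF P(2)[OF that]] .
    have vle: "norm (v j p s) \<le> real p powr (- Re s)" if "j < d" "p \<in> P" for j p s
      using aj[OF that(1) P(2)[OF that(2)]] pos[OF that(2)]
      by (simp add: v_def norm_divide norm_of_nat_powr powr_minus divide_le_eq)
    \<comment> \<open>The worst case is p = 2, where the bound is below 2^(-1/2) < 3/4. Staying
      below 1 keeps 1 - v off the cut of \<open>Ln\<close>, and 1 / (1 - |v|) is at most 4.\<close>
    have v34: "norm (v j p s) \<le> 3/4" "norm (v j p s) \<le> real p powr (- \<sigma>0)"
      if "j < d" "p \<in> P" "s \<in> ball z0 R" for j p s
    proof -
      have p2: "real p \<ge> 2" using prime_ge_2_nat[OF P(2)[OF that(2)]] by simp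
      have "real p powr (- Re s) \<le> real p powr (- \<sigma>0)"
        using ballD[OF that(3)] p2 by (intro powr_mono) auto
      then show 1: "norm (v j p s) \<le> real p powr (- \<sigma>0)" using vle[OF that(1,2), of s] by linarith
      also have "\<dots> \<le> 2 powr (- \<sigma>0)" using p2 \<sigma> by (intro powr_mono2') auto
      also have "\<dots> \<le> 2 powr (- (1/2))" using \<sigma> by (intro powr_mono) auto
      also have "\<dots> = 1 / sqrt 2" by (simp add: powr_minus_divide powr_half_sqrt)
      also have "\<dots> \<le> 3/4"
      proof -
        have "4/3 \<le> sqrt 2" by (rule real_le_rsqrt) (simp add: power2_eq_square)
        then show ?thesis by (simp add: field_simps)
      qed
      finally show "norm (v j p s) \<le> 3/4" .
    qed
    have vnz: "1 - v j p s \<notin> \<real>\<^sub>\<le>\<^sub>0" "1 - v j p s \<noteq> 0" if "j < d" "p \<in> P" "s \<in> ball z0 R" for j p s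
    proof -
      have "Re (v j p s) \<le> 3/4" using v34(1)[OF that] complex_Re_le_cmod[of "v j p s"] by linarith
      then show "1 - v j p s \<notin> \<real>\<^sub>\<le>\<^sub>0" "1 - v j p s \<noteq> 0"
        by (auto simp: complex_nonpos_Reals_iff complex_eq_iff)
    qed
    have hv: "v j p holomorphic_on A" if "p \<in> P" for j p A
      unfolding v_def using pos[OF that] by (intro holomorphic_intros) auto
    have hl: "l j p holomorphic_on ball z0 R" if "j < d" "p \<in> P" for j p
      unfolding l_def using vnz(1)[OF that]
      by (intro holomorphic_intros hv[OF that(2), unfolded v_def] hv[OF that(2)]) auto
    have he: "e j p holomorphic_on ball z0 R" if "j < d" "p \<in> P" for j p
      unfolding e_def by (intro holomorphic_intros hl[OF that] hv[OF that(2)])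
    have ele: "norm (e j p s) \<le> 4 * real p powr (- 2 * \<sigma>0)" if "j < d" "p \<in> P" "s \<in> ball z0 R" for j p s
    proof -
      have "norm (e j p s) = norm (ln (1 + (- v j p s)) - (- v j p s))"
        by (simp add: e_def l_def norm_minus_commute) (metis add.commute norm_minus_cancel minus_add_distrib
            add.inverse_inverse diff_conv_add_uminus)
      also have "\<dots> \<le> norm (v j p s) ^ 2 / (1 - norm (v j p s))"
        using Ln_approx_linear[of "- v j p s"] v34(1)[OF that] by simp
      also have "\<dots> \<le> (real p powr (- \<sigma>0)) ^ 2 / (1/4)"
        using v34[OF that] by (intro frac_le power_mono) auto
      also have "(real p powr (- \<sigma>0)) ^ 2 = real p powr (- 2 * \<sigma>0)"
        using pos[OF that(2)] by (simp add: power2_eq_square flip: powr_add)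
      finally show ?thesis by simp
    qed
    define L where "L s = (\<Sum>p\<in>P. \<Sum>j<d. l j p s)" for s
    have hL: "L holomorphic_on ball z0 R"
      unfolding L_def by (intro holomorphic_intros hl) auto
    have ReL: "Re (L s) = - ln (norm (euler_poly d aj Z s))" if "s \<in> ball z0 R" for s
    proof -
      have "ln (norm (euler_poly d aj Z s)) = ln (\<Prod>p\<in>P. \<Prod>j<d. norm (1 - v j p s))"
        by (simp add: euler_poly_def P_def v_def prod_norm)
      also have "\<dots> = (\<Sum>p\<in>P. ln (\<Prod>j<d. norm (1 - v j p s)))"
        using vnz(2)[OF _ _ that] by (intro ln_prod P) (auto intro!: prod_pos)
      also have "\<dots> = (\<Sum>p\<in>P. \<Sum>j<d. ln (norm (1 - v j p s)))"
        using vnz(2)[OF _ _ that] by (intro sum.cong ln_prod) auto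
      also have "\<dots> = (\<Sum>p\<in>P. \<Sum>j<d. - Re (l j p s))"
        using vnz(2)[OF _ _ that] by (intro sum.cong) (auto simp: l_def)
      finally show ?thesis by (simp add: L_def sum_negf)
    qed
    \<comment> \<open>A logarithm of \<open>f\<close> times the truncated reciprocal Euler product.
      Its smallness is known only on the unit disc about z0, where Re s \<ge> 3, and only for its
      real part, since \<open>g\<close> is a logarithm without a normalised branch.\<close>
    define u where "u s = g s - L s" for s
    have hu: "u holomorphic_on ball z0 R" unfolding u_def by (intro holomorphic_intros g hL)
    define \<eta> where "\<eta> = K1 * real (Z + 1) powr (-3/4)"
    have \<eta>: "\<eta> > 0" using K1 by (simp add: \<eta>_def)
    have b1: "ball z0 1 \<subseteq> ball z0 R" using r by auto
    have Reu: "\<bar>Re (u s)\<bar> \<le> \<eta>" if "s \<in> ball z0 1" for s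
    proof -
      have "\<bar>Re (z0 - s)\<bar> < 1" using that abs_Re_le_cmod[of "z0 - s"] by (auto simp: dist_norm)
      then have s: "Re s \<ge> 3" by (auto simp: z0_def)
      have sR: "s \<in> ball z0 R" using that b1 by auto
      have "Re (u s) = ln (norm (f s)) + ln (norm (euler_poly d aj Z s))"
        using Reg[OF sR] ReL[OF sR] by (simp add: u_def)
      also have "\<dots> = ln (norm (f s * euler_poly d aj Z s))"
        using E[OF Z s] by (simp add: norm_mult ln_mult)
      finally show ?thesis using E[OF Z s] by (simp add: \<eta>_def)
    qed
    have Tu: "\<bar>Re (taylor_sum N u z0 z)\<bar> \<le> 6 * \<eta> * N * 8 ^ N"
      using r by (intro Re_taylor_sum_le holomorphic_on_subset[OF hu b1] Reu \<eta>) (auto simp: nzm)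
    have Tg: "taylor_sum N g z0 z = taylor_sum N u z0 z + taylor_sum N L z0 z"
    proof -
      have "g = (\<lambda>s. u s + L s)" by (simp add: u_def)
      then show ?thesis using taylor_sum_add[OF hu hL open_ball z0in] by simp
    qed
    have TL: "taylor_sum N L z0 z = (\<Sum>p\<in>P. \<Sum>j<d. taylor_sum N (v j p) z0 z + taylor_sum N (e j p) z0 z)"
    proof -
      have "taylor_sum N L z0 z = (\<Sum>p\<in>P. taylor_sum N (\<lambda>s. \<Sum>j<d. l j p s) z0 z)"
        unfolding L_def using hl z0in by (intro taylor_sum_sum[of _ _ "ball z0 R"] holomorphic_intros P) auto
      also have "\<dots> = (\<Sum>p\<in>P. \<Sum>j<d. taylor_sum N (l j p) z0 z)"
        using hl z0in by (intro sum.cong taylor_sum_sum[of _ _ "ball z0 R"]) auto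
      also have "\<dots> = (\<Sum>p\<in>P. \<Sum>j<d. taylor_sum N (v j p) z0 z + taylor_sum N (e j p) z0 z)"
      proof (intro sum.cong refl)
        fix p j assume pj: "p \<in> P" "j \<in> {..<d}"
        have "l j p = (\<lambda>s. v j p s + e j p s)" by (simp add: e_def)
        then show "taylor_sum N (l j p) z0 z = taylor_sum N (v j p) z0 z + taylor_sum N (e j p) z0 z"
          using taylor_sum_add[OF hv[OF pj(1), of j] he[of j p] open_ball z0in] pj by simp
      qed
      finally show ?thesis .
    qed
    have Te: "\<bar>Re (\<Sum>p\<in>P. \<Sum>j<d. taylor_sum N (e j p) z0 z)\<bar> \<le> d * (4 / (1 - q)) * S2"
    proof -
      have "\<bar>Re (\<Sum>p\<in>P. \<Sum>j<d. taylor_sum N (e j p) z0 z)\<bar> \<le> norm (\<Sum>p\<in>P. \<Sum>j<d. taylor_sum N (e j p) z0 z)"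
        by (rule abs_Re_le_cmod)
      also have "\<dots> \<le> (\<Sum>p\<in>P. \<Sum>j<d. 4 * real p powr (- 2 * \<sigma>0) / (1 - q))"
      proof (intro sum_norm_le)
        fix p j assume pj: "p \<in> P" "j \<in> {..<d}"
        have "norm (taylor_sum N (e j p) z0 z) \<le> 4 * real p powr (- 2 * \<sigma>0) / (1 - norm z / r')"
          using pj r by (intro norm_taylor_sum_le[OF he _ _ ele]) (auto simp: nzm)
        then show "norm (taylor_sum N (e j p) z0 z) \<le> 4 * real p powr (- 2 * \<sigma>0) / (1 - q)"
          by (simp add: q_def nzm)
      qed
      also have "\<dots> = d * (4 / (1 - q)) * (\<Sum>p\<in>P. real p powr (- 2 * \<sigma>0))"
        by (simp add: sum_distrib_left mult_ac)
      also have "\<dots> \<le> d * (4 / (1 - q)) * S2"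
        unfolding S2_def using q by (intro mult_left_mono sum_le_suminf sS2 P) auto
      finally show ?thesis .
    qed
    have Tv: "(\<Sum>p\<in>P. \<Sum>j<d. taylor_sum N (v j p) z0 z) =
        (\<Sum>p\<in>P. a p * of_real (exp_weight N r p) / of_nat p powr (Complex \<sigma> t))"
    proof (intro sum.cong refl)
      fix p assume p: "p \<in> P"
      have "taylor_sum N (v j p) z0 z = aj j p * of_real (exp_weight N r p) / of_nat p powr (Complex \<sigma> t)" for j
        unfolding v_def z0_def z_def r_def using pos[OF p] by (rule taylor_sum_nat_powr)
      then show "(\<Sum>j<d. taylor_sum N (v j p) z0 z) = a p * of_real (exp_weight N r p) / of_nat p powr (Complex \<sigma> t)"
        using ap[OF P(2)[OF p]] by (simp add: sum_distrib_right sum_divide_distrib)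
    qed
    have rem: "\<bar>Re (g (z0 + z)) - Re (taylor_sum N g z0 z)\<bar> \<le> A * (ln C + 2 * n + 1 + B) * (ln t * q ^ N)"
    proof -
      have "\<bar>Re (g (z0 + z)) - Re (taylor_sum N g z0 z)\<bar> \<le> norm (g (z0 + z) - taylor_sum N g z0 z)"
        using abs_Re_le_cmod[of "g (z0 + z) - taylor_sum N g z0 z"] by simp
      also have "\<dots> \<le> 2 * (M t - Re (g z0)) * r' / (R - r') * (norm z / r') ^ N / (1 - norm z / r')"
        using r by (intro taylor_remainder_Re[OF g(1) gM]) (auto simp: nzm N)
      also have "\<dots> = (A * q ^ N) * (M t - Re (g z0))"
        by (simp add: A_def q_def nzm)
      also have "\<dots> \<le> (A * q ^ N) * ((ln C + 2 * n + 1 + B) * ln t)"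
      proof (rule mult_left_mono)
        have "- Re (g z0) \<le> B" using Reg[OF z0in] B(2)[of z0] by (simp add: z0_def)
        then have "M t - Re (g z0) \<le> (ln C + 1 + B) * 1 + 2 * n * ln t" by (simp add: M_def)
        also have "\<dots> \<le> (ln C + 1 + B) * ln t + 2 * n * ln t"
          using lnt lnC B by (intro add_mono mult_left_mono) auto
        finally show "M t - Re (g z0) \<le> (ln C + 2 * n + 1 + B) * ln t" by (simp add: algebra_simps)
      qed (use A q in auto)
      finally show ?thesis by (simp add: mult_ac)
    qed
    have inb: "z0 + z \<in> ball z0 R" using r by (simp add: dist_norm nzm)
    have fnz: "f (Complex \<sigma> t) \<noteq> 0"
      by (rule nz) (rule inb[unfolded z0z, unfolded z0_def R_def])
    have "Re (taylor_sum N L z0 z) = (\<Sum>p\<in>P. Re (a p * of_real (exp_weight N r p) / of_nat p powr (Complex \<sigma> t)))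
        + Re (\<Sum>p\<in>P. \<Sum>j<d. taylor_sum N (e j p) z0 z)"
      unfolding TL sum.distrib Tv by (simp only: plus_complex.sel Re_sum)
    then have "\<bar>ln (norm (f (Complex \<sigma> t))) -
        (\<Sum>p\<in>P. Re (a p * of_real (exp_weight N r p) / of_nat p powr (Complex \<sigma> t)))\<bar> \<le>
        A * (ln C + 2 * n + 1 + B) * (ln t * q ^ N) + 6 * \<eta> * N * 8 ^ N + d * (4 / (1 - q)) * S2"
      using Reg[OF inb] rem Tu Te Tg unfolding z0z by (simp only: plus_complex.sel)
    also have "\<dots> \<le> K * (ln t * q ^ N) + K * (real N * 8 ^ N * real (Z + 1) powr (-3/4)) + K"
    proof (intro add_mono K)
      show "A * (ln C + 2 * n + 1 + B) * (ln t * q ^ N) \<le> K * (ln t * q ^ N)"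
        using K q lnt by (intro mult_right_mono) auto
      have "6 * \<eta> * N * 8 ^ N = 6 * K1 * (real N * 8 ^ N * real (Z + 1) powr (-3/4))"
        by (simp add: \<eta>_def mult_ac)
      also have "\<dots> \<le> K * (real N * 8 ^ N * real (Z + 1) powr (-3/4))"
        using K by (intro mult_right_mono) auto
      finally show "6 * \<eta> * N * 8 ^ N \<le> K * (real N * 8 ^ N * real (Z + 1) powr (-3/4))" .
    qed
    finally show "f (Complex \<sigma> t) \<noteq> 0 \<and>
      \<bar>ln (norm (f (Complex \<sigma> t))) - (\<Sum>p | prime p \<and> p \<le> Z.
          Re (a p * of_real (exp_weight N (4 - \<sigma>) p) / of_nat p powr (Complex \<sigma> t)))\<bar>
        \<le> K * (1 + ln t * q ^ N + real N * 8 ^ N * real (Z + 1) powr (-3/4))"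
      using fnz by (simp add: P_def r_def algebra_simps)
  qed
qed

section \<open>Mean values with respect to a Riesz product\<close>

lemma prod_primes_dvd:
  fixes n :: nat
  assumes "finite A" "\<And>p. p \<in> A \<Longrightarrow> prime p" "\<And>p. p \<in> A \<Longrightarrow> p dvd n"
  shows "\<Prod>A dvd n"
  using assms
proof (induction A rule: finite_induct)
  case (insert p A)
  have "coprime p (\<Prod>A)"
    using insert by (intro prod_coprime_right primes_coprime) auto
  then show ?case using insert by (simp add: divides_mult)
qed simp

text \<open>Erdos's argument: for n = 2m + 1 every prime in (m + 1, n] divides the binomial
  coefficient of n over m, which is at most 4^m because it occurs twice in a row of sum 2 *
  4^m.\<close>

lemma primorial_le: "\<Prod>{p::nat. prime p \<and> p \<le> n} \<le> 4 ^ n"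
proof (induction n rule: less_induct)
  case (less n)
  have fin: "finite {p::nat. prime p \<and> p \<le> m}" for m
    by (rule finite_subset[of _ "{..m}"]) auto
  have "n \<le> 1 \<or> n = 2 \<or> n > 2" by arith
  then consider "n \<le> 1" | "n = 2" | "n > 2" "even n" | "n > 2" "odd n" by blast
  then show ?case
  proof cases
    case 1
    then have e: "{p::nat. prime p \<and> p \<le> n} = {}" by (auto dest!: prime_gt_1_nat)
    show ?thesis unfolding e by simp
  next
    case 2
    then have e: "{p::nat. prime p \<and> p \<le> n} = {2}" by (auto dest: prime_ge_2_nat intro: le_antisym)
    show ?thesis unfolding e using 2 by simp
  next
    case 3
    have np: "\<not> prime n" using 3 prime_odd_nat by blast
    have "{p::nat. prime p \<and> p \<le> n} = {p. prime p \<and> p \<le> n - 1}"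
    proof -
      have "p \<le> n \<longleftrightarrow> p \<le> n - 1" if "prime p" for p using that np 3 by (cases "p = n") auto
      then show ?thesis by auto
    qed
    then have "\<Prod>{p::nat. prime p \<and> p \<le> n} \<le> 4 ^ (n - 1)" using less[of "n - 1"] 3 by simp
    also have "\<dots> \<le> 4 ^ n" by (intro power_increasing) auto
    finally show ?thesis .
  next
    case 4
    then obtain m where m: "n = 2 * m + 1" by (elim oddE)
    have m1: "m \<ge> 1" using 4 m by simp
    define B where "B = {p::nat. prime p \<and> m + 1 < p \<and> p \<le> n}"
    have finB: "finite B" by (rule finite_subset[of _ "{..n}"]) (auto simp: B_def)
    have "{p::nat. prime p \<and> p \<le> n} = {p. prime p \<and> p \<le> m + 1} \<union> B" using m by (auto simp: B_def)
    moreover have "{p. prime p \<and> p \<le> m + 1} \<inter> B = {}" by (auto simp: B_def)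
    ultimately have eq: "\<Prod>{p::nat. prime p \<and> p \<le> n} = \<Prod>{p. prime p \<and> p \<le> m + 1} * \<Prod>B"
      using fin finB by (simp add: prod.union_disjoint)
    have "\<Prod>B dvd (n choose m)"
    proof (rule prod_primes_dvd[OF finB])
      fix p assume p: "p \<in> B"
      show "prime p" using p by (simp add: B_def)
      have "fact m * fact (n - m) * (n choose m) = (fact n :: nat)"
        using m by (intro binomial_fact_lemma) auto
      moreover have "p dvd fact n" using p by (simp add: B_def prime_dvd_fact_iff)
      ultimately have "p dvd fact m * fact (n - m) * (n choose m)" by simp
      moreover have "m < p" "n - m < p" using p m by (auto simp: B_def)
      then have "\<not> p dvd fact m" "\<not> p dvd fact (n - m)"
        using \<open>prime p\<close> by (simp_all add: prime_dvd_fact_iff)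
      ultimately show "p dvd (n choose m)" using \<open>prime p\<close> by (simp add: prime_dvd_mult_iff)
    qed
    moreover have "n choose m > 0" using m by simp
    ultimately have "\<Prod>B \<le> (n choose m)" by (rule dvd_imp_le)
    also have "\<dots> \<le> 4 ^ m"
    proof -
      have "(n choose m) + (n choose (m + 1)) = (\<Sum>k\<in>{m, m + 1}. n choose k)" by simp
      also have "\<dots> \<le> (\<Sum>k\<le>n. n choose k)" using m by (intro sum_mono2) auto
      also have "\<dots> = 2 * 4 ^ m" by (subst choose_row_sum) (simp add: m power_mult)
      finally have "(n choose m) + (n choose (m + 1)) \<le> 2 * 4 ^ m" .
      moreover have "n choose (m + 1) = n choose m"
        using binomial_symmetric[of m n] m by simp
      ultimately show ?thesis by simp
    qed
    finally have "\<Prod>B \<le> 4 ^ m" .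
    moreover have "\<Prod>{p::nat. prime p \<and> p \<le> m + 1} \<le> 4 ^ (m + 1)" using less[of "m + 1"] m m1 by simp
    ultimately have "\<Prod>{p::nat. prime p \<and> p \<le> n} \<le> 4 ^ (m + 1) * 4 ^ m"
      unfolding eq by (intro mult_mono) auto
    also have "\<dots> = 4 ^ n" by (simp add: m mult_2 flip: power_add)
    finally show ?thesis .
  qed
qed

lemma norm_integral_exp_le:
  fixes l T :: real
  assumes "l \<noteq> 0" "T \<ge> 0"
  shows "norm (integral {T..2*T} (\<lambda>t. exp (\<i> * of_real (l * t)))) \<le> 2 / \<bar>l\<bar>"
proof -
  define F where "F t = exp (\<i> * of_real (l * t)) / (\<i> * of_real l)" for t
  have "((\<lambda>t. exp (\<i> * of_real (l * t))) has_integral (F (2 * T) - F T)) {T..2*T}"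
  proof (rule fundamental_theorem_of_calculus)
    show "T \<le> 2 * T" using assms by simp
    fix t
    have "((\<lambda>z. exp (\<i> * of_real l * z) / (\<i> * of_real l)) has_field_derivative exp (\<i> * of_real l * of_real t)) (at (of_real t))"
      using assms by (auto intro!: derivative_eq_intros)
    from has_vector_derivative_real_field[OF this]
    show "(F has_vector_derivative exp (\<i> * of_real (l * t))) (at t within {T..2*T})"
      unfolding F_def by (simp add: mult.assoc o_def)
  qed
  then have "integral {T..2*T} (\<lambda>t. exp (\<i> * of_real (l * t))) = F (2 * T) - F T" by (rule integral_unique)
  also have "norm \<dots> \<le> norm (F (2 * T)) + norm (F T)" by (rule norm_triangle_ineq4)
  also have "\<dots> = 2 / \<bar>l\<bar>" by (simp add: F_def norm_divide norm_mult)
  finally show ?thesis .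
qed

lemma abs_ln_diff_ge:
  fixes u v W :: nat
  assumes "u > 0" "v > 0" "u \<le> W" "v \<le> W" "u \<noteq> v"
  shows "\<bar>ln u - ln v\<bar> \<ge> 1 / W"
proof -
  have *: "ln (real u) - ln v \<ge> 1 / W" if "v < u" "v > 0" "u \<le> W" for u v :: nat
  proof -
    have "ln (real v / u) \<le> real v / u - 1" using that by (intro ln_le_minus_one) auto
    then have "ln (real u) - ln v \<ge> 1 - real v / u" using that by (simp add: ln_div)
    moreover have "1 - real v / u = (real u - v) / u" using that by (simp add: field_simps)
    moreover have "(real u - v) / u \<ge> 1 / u" using that by (intro divide_right_mono) auto
    moreover have "1 / real u \<ge> 1 / W" using that by (intro divide_left_mono) auto
    ultimately show ?thesis by linarith
  qed
  show ?thesis using *[of v u] *[of u v] assms by (cases "u < v") auto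
qed

text \<open>The combination is log (u / v) for two integers that differ by unique factorisation and
  do not exceed the cube of the product of the primes. The exponent 3 fits products of three
  trigonometric polynomials with frequencies -1, 0, 1 at each prime.\<close>

lemma abs_ln_prime_combination_ge:
  fixes P :: "nat set" and k :: "nat \<Rightarrow> int"
  assumes P: "finite P" "\<And>p. p \<in> P \<Longrightarrow> prime p" and k: "\<And>p. p \<in> P \<Longrightarrow> \<bar>k p\<bar> \<le> 3"
    and nz: "\<exists>p\<in>P. k p \<noteq> 0"
  shows "\<bar>\<Sum>p\<in>P. of_int (k p) * ln (real p)\<bar> \<ge> 1 / (real (\<Prod>P) ^ 3)"
proof -
  define u where "u = (\<Prod>p\<in>P. p ^ nat (k p))"
  define v where "v = (\<Prod>p\<in>P. p ^ nat (- k p))"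
  have pos: "p > 0" if "p \<in> P" for p using prime_gt_0_nat[OF P(2)[OF that]] .
  have uv: "u > 0" "v > 0" using pos by (auto simp: u_def v_def intro!: prod_pos)
  have le: "(\<Prod>p\<in>P. p ^ n p) \<le> (\<Prod>P) ^ 3" if "\<And>p. p \<in> P \<Longrightarrow> n p \<le> 3" for n
  proof -
    have "(\<Prod>p\<in>P. p ^ n p) \<le> (\<Prod>p\<in>P. p ^ 3)"
      using that pos by (intro prod_mono conjI power_increasing) (auto simp: Suc_le_eq)
    then show ?thesis by (simp add: prod_power_distrib)
  qed
  have "nat (k p) \<le> 3" "nat (- k p) \<le> 3" if "p \<in> P" for p using k[OF that] by auto
  then have uW: "u \<le> (\<Prod>P) ^ 3" "v \<le> (\<Prod>P) ^ 3"
    unfolding u_def v_def by (auto intro!: le)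
  have ln: "ln (real (\<Prod>p\<in>P. p ^ n p)) = (\<Sum>p\<in>P. n p * ln p)" for n
    using pos by (simp add: ln_prod P ln_realpow)
  have nat_diff: "real (nat i) - real (nat (- i)) = of_int i" for i :: int
    by (cases "i \<ge> 0") auto
  have "ln (real u) - ln (real v) = (\<Sum>p\<in>P. of_int (k p) * ln (real p))"
    unfolding u_def v_def ln sum_subtractf[symmetric]
    by (intro sum.cong refl) (simp add: nat_diff flip: left_diff_distrib)
  moreover have "u \<noteq> v"
  proof
    assume eq: "u = v"
    obtain p where p: "p \<in> P" "k p \<noteq> 0" using nz by blast
    have dvd: "p dvd (\<Prod>q\<in>P. q ^ n q) \<longleftrightarrow> n p > 0" for n
    proof -
      have "p dvd (\<Prod>q\<in>P. q ^ n q) \<longleftrightarrow> (\<exists>q\<in>P. p dvd q ^ n q)"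
        using P(2)[OF p(1)] P(1) by (simp add: prime_dvd_prod_iff)
      also have "\<dots> \<longleftrightarrow> n p > 0"
      proof
        assume "\<exists>q\<in>P. p dvd q ^ n q"
        then obtain q where q: "q \<in> P" "p dvd q ^ n q" by blast
        then have "p dvd q" using P(2)[OF p(1)] prime_dvd_power by blast
        then have "p = q" using P p q primes_dvd_imp_eq by blast
        then show "n p > 0" using q P(2)[OF p(1)] by (cases "n p") auto
      qed (use p in \<open>auto intro!: bexI[of _ p] dvd_power\<close>)
      finally show ?thesis .
    qed
    have "nat (k p) > 0 \<longleftrightarrow> nat (- k p) > 0"
      using dvd[of "\<lambda>q. nat (k q)"] dvd[of "\<lambda>q. nat (- k q)"] eq unfolding u_def v_def by simp
    then show False using p by auto
  qed
  ultimately show ?thesis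
    using abs_ln_diff_ge[OF uv uW] by simp
qed

text \<open>Expansion yields one exponential for each choice of an index at every prime. Its
  frequency vanishes only if all chosen \<open>e\<close> vanish, and these choices recombine to the
  product of the zero-frequency sums. Every other frequency is at least 1 / W, with W the cube of
  the product of the primes, so its integral is at most 2 * W.\<close>

lemma integral_trig_product:
  fixes P :: "nat set" and \<gamma> :: "nat \<Rightarrow> 'i \<Rightarrow> complex" and e :: "'i \<Rightarrow> int" and T :: real
  assumes P: "finite P" "\<And>p. p \<in> P \<Longrightarrow> prime p" and I: "finite I" "\<And>i. i \<in> I \<Longrightarrow> \<bar>e i\<bar> \<le> 3"
    and T: "T \<ge> 0"
  shows "norm (integral {T..2*T} (\<lambda>t. \<Prod>p\<in>P. \<Sum>i\<in>I. \<gamma> p i * exp (\<i> * of_real (of_int (e i) * ln p * t)))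
      - of_real T * (\<Prod>p\<in>P. \<Sum>i\<in>{i\<in>I. e i = 0}. \<gamma> p i))
    \<le> 2 * real (\<Prod>P) ^ 3 * (\<Prod>p\<in>P. \<Sum>i\<in>I. norm (\<gamma> p i))"
proof -
  define E where "E = PiE P (\<lambda>_. I)"
  define l where "l k = (\<Sum>p\<in>P. of_int (e (k p)) * ln (real p))" for k
  define J where "J k = integral {T..2*T} (\<lambda>t. exp (\<i> * of_real (l k * t)))" for k
  define W where "W = real (\<Prod>P) ^ 3"
  have finE: "finite E" unfolding E_def using P I by (intro finite_PiE) auto
  have pos: "p > 0" if "p \<in> P" for p using prime_gt_0_nat[OF P(2)[OF that]] .
  have W: "W > 0" using pos by (auto simp: W_def intro!: prod_pos)
  have "(\<Prod>p\<in>P. \<Sum>i\<in>I. \<gamma> p i * exp (\<i> * of_real (of_int (e i) * ln p * t))) =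
      (\<Sum>k\<in>E. (\<Prod>p\<in>P. \<gamma> p (k p)) * exp (\<i> * of_real (l k * t)))" for t
  proof -
    have "(\<Prod>p\<in>P. \<Sum>i\<in>I. \<gamma> p i * exp (\<i> * of_real (of_int (e i) * ln p * t))) =
      (\<Sum>k\<in>E. \<Prod>p\<in>P. \<gamma> p (k p) * exp (\<i> * of_real (of_int (e (k p)) * ln p * t)))"
      unfolding E_def using P I by (intro prod_sum_PiE) auto
    also have "\<dots> = (\<Sum>k\<in>E. (\<Prod>p\<in>P. \<gamma> p (k p)) * exp (\<i> * of_real (l k * t)))"
    proof (intro sum.cong refl)
      fix k
      have "(\<Sum>p\<in>P. \<i> * of_real (of_int (e (k p)) * ln p * t)) = \<i> * of_real (l k * t)"
        by (simp add: l_def sum_distrib_left sum_distrib_right)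
      then show "(\<Prod>p\<in>P. \<gamma> p (k p) * exp (\<i> * of_real (of_int (e (k p)) * ln p * t))) =
          (\<Prod>p\<in>P. \<gamma> p (k p)) * exp (\<i> * of_real (l k * t))"
        by (simp add: prod.distrib exp_sum[symmetric] P)
    qed
    finally show ?thesis .
  qed
  then have "integral {T..2*T} (\<lambda>t. \<Prod>p\<in>P. \<Sum>i\<in>I. \<gamma> p i * exp (\<i> * of_real (of_int (e i) * ln p * t))) =
     integral {T..2*T} (\<lambda>t. \<Sum>k\<in>E. (\<Prod>p\<in>P. \<gamma> p (k p)) * exp (\<i> * of_real (l k * t)))"
    by presburger
  also have "\<dots> = (\<Sum>k\<in>E. integral {T..2*T} (\<lambda>t. (\<Prod>p\<in>P. \<gamma> p (k p)) * exp (\<i> * of_real (l k * t))))"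
    by (intro integral_sum finE integrable_continuous_real continuous_intros)
  also have "\<dots> = (\<Sum>k\<in>E. (\<Prod>p\<in>P. \<gamma> p (k p)) * J k)"
    by (simp add: J_def)
  finally have 1: "integral {T..2*T} (\<lambda>t. \<Prod>p\<in>P. \<Sum>i\<in>I. \<gamma> p i * exp (\<i> * of_real (of_int (e i) * ln p * t))) =
    (\<Sum>k\<in>E. (\<Prod>p\<in>P. \<gamma> p (k p)) * J k)" .
  define D where "D k = (if \<forall>p\<in>P. e (k p) = 0 then complex_of_real T else 0)" for k
  have "(\<Prod>p\<in>P. \<Sum>i\<in>{i\<in>I. e i = 0}. \<gamma> p i) = (\<Sum>k\<in>PiE P (\<lambda>_. {i\<in>I. e i = 0}). \<Prod>p\<in>P. \<gamma> p (k p))"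
    using P I by (intro prod_sum_PiE) auto
  also have "PiE P (\<lambda>_. {i\<in>I. e i = 0}) = {k\<in>E. \<forall>p\<in>P. e (k p) = 0}"
    by (auto simp: E_def PiE_def Pi_def)
  also have "(\<Sum>k\<in>{k\<in>E. \<forall>p\<in>P. e (k p) = 0}. \<Prod>p\<in>P. \<gamma> p (k p)) =
      (\<Sum>k\<in>E. if \<forall>p\<in>P. e (k p) = 0 then \<Prod>p\<in>P. \<gamma> p (k p) else 0)"
    by (rule sum.inter_filter[OF finE])
  finally have 2: "of_real T * (\<Prod>p\<in>P. \<Sum>i\<in>{i\<in>I. e i = 0}. \<gamma> p i) = (\<Sum>k\<in>E. (\<Prod>p\<in>P. \<gamma> p (k p)) * D k)"
    by (auto simp: sum_distrib_left D_def intro!: sum.cong)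
  have JD: "norm (J k - D k) \<le> 2 * W" if k: "k \<in> E" for k
  proof (cases "\<forall>p\<in>P. e (k p) = 0")
    case True
    then have "l k = 0" by (simp add: l_def)
    then have "J k = of_real T" using T by (simp add: J_def scaleR_conv_of_real)
    then show ?thesis using True W by (simp add: D_def)
  next
    case False
    have "1 / W \<le> \<bar>l k\<bar>"
      unfolding W_def l_def using P k False I(2)
      by (intro abs_ln_prime_combination_ge) (auto simp: E_def PiE_iff)
    moreover from this have "l k \<noteq> 0" using W by auto
    ultimately have "2 / \<bar>l k\<bar> \<le> 2 * W" using W by (simp add: field_simps)
    then show ?thesis
      using norm_integral_exp_le[OF \<open>l k \<noteq> 0\<close> T] False by (auto simp: J_def D_def)
  qed
  have "norm ((\<Sum>k\<in>E. (\<Prod>p\<in>P. \<gamma> p (k p)) * J k) - (\<Sum>k\<in>E. (\<Prod>p\<in>P. \<gamma> p (k p)) * D k)) =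
     norm (\<Sum>k\<in>E. (\<Prod>p\<in>P. \<gamma> p (k p)) * (J k - D k))"
    by (simp add: sum_subtractf right_diff_distrib)
  also have "\<dots> \<le> (\<Sum>k\<in>E. (\<Prod>p\<in>P. norm (\<gamma> p (k p))) * (2 * W))"
    using JD by (intro sum_norm_le) (auto simp: norm_mult prod_norm intro!: mult_left_mono prod_nonneg)
  also have "\<dots> = 2 * W * (\<Sum>k\<in>E. \<Prod>p\<in>P. norm (\<gamma> p (k p)))"
    by (simp add: sum_distrib_left mult_ac)
  also have "(\<Sum>k\<in>E. \<Prod>p\<in>P. norm (\<gamma> p (k p))) = (\<Prod>p\<in>P. \<Sum>i\<in>I. norm (\<gamma> p i))"
    unfolding E_def using P I by (intro prod_sum_PiE[symmetric]) auto
  finally show ?thesis unfolding 1 2 W_def .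
qed

section \<open>Three trigonometric factors at each prime\<close>

definition trig3 :: "(int \<Rightarrow> complex) \<Rightarrow> nat \<Rightarrow> real \<Rightarrow> complex" where
  "trig3 c p t = (\<Sum>i\<in>{-1,0,1}. c i * exp (\<i> * of_real (of_int i * ln p * t)))"

definition norm3 :: "(int \<Rightarrow> complex) \<Rightarrow> real" where
  "norm3 c = (\<Sum>i\<in>{-1,0,1}. norm (c i))"

text \<open>The constant Fourier coefficient of a product of three \<open>trig3\<close> at one
  prime, that is, its mean when p^(it) is replaced by a uniformly distributed point of the unit
  circle. One factor will come from the Riesz product, the other two from the variables being
  correlated.\<close>

definition const3 :: "(int \<Rightarrow> complex) \<Rightarrow> (int \<Rightarrow> complex) \<Rightarrow> (int \<Rightarrow> complex) \<Rightarrow> complex" where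
  "const3 a b c = (\<Sum>(i, j, k)\<in>{x\<in>{-1,0,1} \<times> {-1,0,1} \<times> {-1,0,1}. fst x + fst (snd x) + snd (snd x) = 0}.
      a i * b j * c k)"

lemma sum_triple_prod:
  fixes f g h :: "'i \<Rightarrow> 'a :: comm_semiring_1"
  shows "(\<Sum>x\<in>I \<times> I \<times> I. f (fst x) * g (fst (snd x)) * h (snd (snd x))) = sum f I * sum g I * sum h I"
proof -
  have "sum f I * sum g I * sum h I = (\<Sum>i\<in>I. \<Sum>j\<in>I. \<Sum>k\<in>I. f i * g j * h k)"
    by (simp only: sum_distrib_left[symmetric] sum_distrib_right[symmetric])
  also have "\<dots> = (\<Sum>x\<in>I \<times> I \<times> I. f (fst x) * g (fst (snd x)) * h (snd (snd x)))"
    by (simp add: sum.cartesian_product case_prod_unfold)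
  finally show ?thesis ..
qed

lemma integral_trig3_product:
  fixes P :: "nat set" and r a b :: "nat \<Rightarrow> int \<Rightarrow> complex"
  assumes P: "finite P" "\<And>p. p \<in> P \<Longrightarrow> prime p" and T: "T \<ge> 0"
  shows "norm (integral {T..2*T} (\<lambda>t. \<Prod>p\<in>P. trig3 (r p) p t * trig3 (a p) p t * trig3 (b p) p t)
      - of_real T * (\<Prod>p\<in>P. const3 (r p) (a p) (b p)))
    \<le> 2 * real (\<Prod>P) ^ 3 * (\<Prod>p\<in>P. norm3 (r p) * norm3 (a p) * norm3 (b p))"
proof -
  define I where "I = {-1,0,1::int} \<times> {-1,0,1::int} \<times> {-1,0,1::int}"
  define e where "e x = fst x + fst (snd x) + snd (snd x)" for x :: "int \<times> int \<times> int"
  define \<gamma> where "\<gamma> p x = r p (fst x) * a p (fst (snd x)) * b p (snd (snd x))" for p and x :: "int \<times> int \<times> int"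
  have "finite I" "\<And>x. x \<in> I \<Longrightarrow> \<bar>e x\<bar> \<le> 3" by (auto simp: I_def e_def)
  note main = integral_trig_product[where \<gamma> = \<gamma> and e = e, OF P this T]
  have 1: "(\<Sum>x\<in>I. \<gamma> p x * exp (\<i> * of_real (of_int (e x) * ln p * t))) =
      trig3 (r p) p t * trig3 (a p) p t * trig3 (b p) p t" for p t
    unfolding trig3_def sum_triple_prod[symmetric] I_def[symmetric]
    by (intro sum.cong refl) (simp add: \<gamma>_def e_def ring_distribs exp_add mult_ac)
  have 2: "(\<Sum>x\<in>I. norm (\<gamma> p x)) = norm3 (r p) * norm3 (a p) * norm3 (b p)" for p
    unfolding norm3_def sum_triple_prod[symmetric] I_def[symmetric] by (simp add: \<gamma>_def norm_mult)
  have 3: "(\<Sum>x\<in>{x\<in>I. e x = 0}. \<gamma> p x) = const3 (r p) (a p) (b p)" for p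
    unfolding const3_def I_def e_def \<gamma>_def by (simp add: case_prod_unfold)
  show ?thesis using main unfolding 1 2 3 .
qed

lemma norm_const3_le: "norm (const3 a b c) \<le> norm3 a * norm3 b * norm3 c"
proof -
  have "norm (const3 a b c) \<le> (\<Sum>x\<in>{x\<in>{-1,0,1} \<times> {-1,0,1} \<times> {-1,0,1}. fst x + fst (snd x) + snd (snd x) = 0}.
      norm (a (fst x)) * norm (b (fst (snd x))) * norm (c (snd (snd x))))"
    unfolding const3_def by (intro sum_norm_le) (auto simp: norm_mult)
  also have "\<dots> \<le> (\<Sum>x\<in>{-1,0,1} \<times> {-1,0,1} \<times> {-1,0,1}.
      norm (a (fst x)) * norm (b (fst (snd x))) * norm (c (snd (snd x))))"
    by (intro sum_mono2) auto
  finally show ?thesis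
    using sum_triple_prod[of "\<lambda>i. norm (a i)" "\<lambda>i. norm (b i)" "\<lambda>i. norm (c i)" "{-1,0,1}"]
    by (simp only: norm3_def)
qed

lemma const3_eq: "const3 a b c =
    a (-1) * b 0 * c 1 + a (-1) * b 1 * c 0 + a 0 * b (-1) * c 1 + a 0 * b 0 * c 0 + a 0 * b 1 * c (-1)
    + a 1 * b (-1) * c 0 + a 1 * b 0 * c (-1)"
proof -
  have "const3 a b c = (\<Sum>x\<in>{-1,0,1} \<times> {-1,0,1} \<times> {-1,0,1}.
      if fst x + fst (snd x) + snd (snd x) = 0 then a (fst x) * b (fst (snd x)) * c (snd (snd x)) else 0)"
    unfolding const3_def case_prod_unfold by (rule sum.inter_filter) simp
  also have "\<dots> = (\<Sum>i\<in>{-1,0,1}. \<Sum>j\<in>{-1,0,1}. \<Sum>k\<in>{-1,0,1}. if i + j + k = 0 then a i * b j * c k else 0)"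
    by (simp only: sum.cartesian_product case_prod_unfold fst_conv snd_conv)
  also have "\<dots> = a (-1) * b 0 * c 1 + a (-1) * b 1 * c 0 + a 0 * b (-1) * c 1 + a 0 * b 0 * c 0 + a 0 * b 1 * c (-1)
    + a 1 * b (-1) * c 0 + a 1 * b 0 * c (-1)"
    by (simp add: add_ac)
  finally show ?thesis .
qed

definition coeff3 :: "complex \<Rightarrow> complex \<Rightarrow> int \<Rightarrow> complex" where
  "coeff3 m c i = (if i = 0 then m else if i = 1 then cnj c / 2 else c / 2)"

lemma trig3_coeff3:
  "trig3 (coeff3 (of_real m) c) p t = of_real (m + Re (c * exp (- (\<i> * of_real (ln p * t)))))"
proof -
  define y where "y = exp (- (\<i> * of_real (ln p * t)))"
  have "cnj y = exp (\<i> * of_real (ln p * t))" by (simp add: y_def exp_cnj)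
  then have "trig3 (coeff3 (of_real m) c) p t = of_real m + (c * y + cnj (c * y)) / 2"
    by (simp add: trig3_def coeff3_def y_def add_divide_distrib)
  also have "\<dots> = of_real (m + Re (c * y))" by (subst complex_add_cnj) simp
  finally show ?thesis by (simp add: y_def)
qed

lemma norm3_coeff3: "norm3 (coeff3 m c) = norm m + norm c"
  by (simp add: norm3_def coeff3_def norm_divide)

lemma const3_unit: "const3 a (coeff3 1 0) (coeff3 1 0) = a 0"
  by (simp add: const3_eq coeff3_def)

text \<open>For z uniform on the unit circle, Re (b z) has mean Re (c b) / 2 under the density 1 +
  Re (cnj c * z). After subtraction of this mean it is centred, which is why correlations between
  different primes vanish.\<close>

lemma const3_right_unit:
  "const3 (coeff3 1 (cnj c)) (coeff3 (of_real (- (Re (c * b) / 2))) b) (coeff3 1 0) = 0"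
  by (simp add: const3_eq coeff3_def complex_eq_iff field_simps)

section \<open>Mass and second moments of the Riesz product\<close>

definition riesz :: "nat \<Rightarrow> (nat \<Rightarrow> complex) \<Rightarrow> real \<Rightarrow> real" where
  "riesz X c t = (\<Prod>p | prime p \<and> p \<le> X. 1 + Re (cnj (c p) * exp (- (\<i> * of_real (ln p * t)))))"

lemma card_primes_le: "card {p::nat. prime p \<and> p \<le> X} \<le> X"
proof -
  have "card {p::nat. prime p \<and> p \<le> X} \<le> card {1..X}"
    by (intro card_mono) (auto dest: prime_ge_1_nat)
  then show ?thesis by simp
qed

lemma riesz_bounds:
  assumes "\<And>p. norm (c p) \<le> 1"
  shows "0 \<le> riesz X c t" "riesz X c t \<le> 2 ^ X"
proof -
  have b: "\<bar>Re (cnj (c p) * exp (- (\<i> * of_real (ln p * t))))\<bar> \<le> 1" for p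
    using abs_Re_le_cmod[of "cnj (c p) * exp (- (\<i> * of_real (ln p * t)))"] assms[of p]
    by (simp add: norm_mult)
  have b': "0 \<le> 1 + Re (cnj (c p) * exp (- (\<i> * of_real (ln p * t))))"
    "1 + Re (cnj (c p) * exp (- (\<i> * of_real (ln p * t)))) \<le> 2" for p
    using b[of p] by linarith+
  show "0 \<le> riesz X c t"
    unfolding riesz_def by (intro prod_nonneg b')
  have "riesz X c t \<le> (\<Prod>p::nat | prime p \<and> p \<le> X. 2)"
    unfolding riesz_def by (intro prod_mono conjI b')
  also have "\<dots> \<le> 2 ^ X" using card_primes_le by (simp add: power_increasing)
  finally show "riesz X c t \<le> 2 ^ X" .
qed

lemma continuous_on_riesz [continuous_intros]: "continuous_on A (riesz X c)"
  unfolding riesz_def by (intro continuous_intros)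

lemma integral_of_real_complex:
  fixes f :: "real \<Rightarrow> real"
  assumes "continuous_on {a..b} f"
  shows "integral {a..b} (\<lambda>t. complex_of_real (f t)) = of_real (integral {a..b} f)"
  using integral_linear[OF integrable_continuous_real[OF assms] bounded_linear_of_real]
  by (simp add: o_def)

text \<open>For p1 \<noteq> p2 the local factor at p1 has mean zero, so only the error of the
  integral survives. On the diagonal the local factor is bounded by 2 * (2 |b|) * (2 |b|). The error
  multiplies the cube of 4^X * Z^2 by the coefficient sums 2^X and (2B)^2, and 4^3 * 2 =
  128.\<close>

lemma riesz_correlation:
  fixes X Z p1 p2 :: nat and c b :: "nat \<Rightarrow> complex" and T B :: real
  assumes c: "\<And>p. norm (c p) \<le> 1" and b: "\<And>p. norm (b p) \<le> B" and T: "T \<ge> 0"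
    and p1: "prime p1" "p1 \<le> Z" and p2: "prime p2" "p2 \<le> Z"
  defines "V \<equiv> \<lambda>p t. Re (b p * exp (- (\<i> * of_real (ln p * t)))) - (if p \<le> X then Re (c p * b p) / 2 else 0)"
  shows "integral {T..2*T} (\<lambda>t. riesz X c t * V p1 t * V p2 t) \<le>
      (if p1 = p2 then 8 * (norm (b p1))\<^sup>2 * T else 0) + 8 * B\<^sup>2 * real Z ^ 6 * 128 ^ X"
proof -
  define PX where "PX = {p. prime p \<and> p \<le> X}"
  \<comment> \<open>The primes p1 and p2 may exceed X; they are what adds Z^2 to the
    primorial.\<close>
  define P where "P = PX \<union> {p1, p2}"
  \<comment> \<open>Extended by zero beyond X, so that the Riesz product has a factor 1 there and
    both ranges of primes are treated alike.\<close>
  define c' where "c' p = (if p \<le> X then c p else 0)" for p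
  define m where "m p = - (Re (c' p * b p) / 2)" for p
  define r where "r p = coeff3 1 (cnj (c' p))" for p
  define a where "a q p = (if p = q then coeff3 (of_real (m p)) (b p) else coeff3 1 0)" for q p
  have finX: "finite PX" unfolding PX_def by (rule finite_subset[of _ "{..X}"]) auto
  have P: "finite P" "\<And>p. p \<in> P \<Longrightarrow> prime p" using finX p1 p2 by (auto simp: P_def PX_def)
  have c'1: "norm (c' p) \<le> 1" for p using c by (simp add: c'_def)
  have B0: "B \<ge> 0" using order_trans[OF norm_ge_zero b] .
  have Va: "(\<Prod>p\<in>P. trig3 (a q p) p t) = of_real (V q t)" if "q \<in> P" for q t
  proof -
    have "(\<Prod>p\<in>P. trig3 (a q p) p t) = trig3 (a q q) q t * (\<Prod>p\<in>P - {q}. trig3 (a q p) p t)"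
      using that P by (intro prod.remove) auto
    also have "(\<Prod>p\<in>P - {q}. trig3 (a q p) p t) = 1"
      using trig3_coeff3[of 1 0] by (intro prod.neutral) (auto simp: a_def)
    also have "trig3 (a q q) q t = of_real (m q + Re (b q * exp (- (\<i> * of_real (ln q * t)))))"
      unfolding a_def trig3_coeff3[symmetric] by simp
    also have "m q + Re (b q * exp (- (\<i> * of_real (ln q * t)))) = V q t"
      by (auto simp: V_def m_def c'_def)
    finally show ?thesis by simp
  qed
  have Rr: "(\<Prod>p\<in>P. trig3 (r p) p t) = of_real (riesz X c t)" for t
  proof -
    have "(\<Prod>p\<in>P. trig3 (r p) p t) = (\<Prod>p\<in>PX. trig3 (r p) p t)"
    proof (rule prod.mono_neutral_right)
      show "finite P" by (rule P(1))
      show "PX \<subseteq> P" by (auto simp: P_def)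
      show "\<forall>p\<in>P - PX. trig3 (r p) p t = 1"
      proof
        fix p assume "p \<in> P - PX"
        then have "c' p = 0" using P(2)[of p] by (auto simp: PX_def c'_def)
        then show "trig3 (r p) p t = 1" using trig3_coeff3[of 1 0 p t] by (simp add: r_def)
      qed
    qed
    also have "\<dots> = (\<Prod>p\<in>PX. of_real (1 + Re (cnj (c p) * exp (- (\<i> * of_real (ln p * t))))))"
    proof (rule prod.cong)
      fix p assume "p \<in> PX"
      then have "c' p = c p" by (simp add: PX_def c'_def)
      then show "trig3 (r p) p t = of_real (1 + Re (cnj (c p) * exp (- (\<i> * of_real (ln p * t)))))"
        using trig3_coeff3[of 1 "cnj (c p)" p t] by (simp only: r_def of_real_1)
    qed simp
    finally show ?thesis by (simp add: riesz_def PX_def)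
  qed
  have int_eq: "integral {T..2*T} (\<lambda>t. \<Prod>p\<in>P. trig3 (r p) p t * trig3 (a p1 p) p t * trig3 (a p2 p) p t) =
     of_real (integral {T..2*T} (\<lambda>t. riesz X c t * V p1 t * V p2 t))"
  proof -
    have "(\<Prod>p\<in>P. trig3 (r p) p t * trig3 (a p1 p) p t * trig3 (a p2 p) p t) =
        complex_of_real (riesz X c t * V p1 t * V p2 t)" for t
      using Va[of p1 t] Va[of p2 t] Rr[of t] by (simp add: prod.distrib P_def)
    moreover have "continuous_on {T..2*T} (\<lambda>t. riesz X c t * V p1 t * V p2 t)"
      unfolding V_def by (intro continuous_intros)
    ultimately show ?thesis by (simp only: integral_of_real_complex)
  qed
  have n_r: "norm3 (r p) \<le> 2" "p \<notin> PX \<Longrightarrow> norm3 (r p) = 1" "norm3 (r p) \<ge> 1" if "p \<in> P" for p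
    using c'1[of p] P(2)[OF that] by (auto simp: r_def norm3_coeff3 c'_def PX_def)
  have n_a: "norm3 (a q p) \<le> (if p = q then 2 * norm (b q) else 1)" for p q
  proof -
    have "norm (of_real (m q) :: complex) \<le> norm (b q)"
    proof -
      have "\<bar>Re (c' q * b q)\<bar> \<le> norm (c' q) * norm (b q)"
        using abs_Re_le_cmod[of "c' q * b q"] by (simp add: norm_mult)
      also have "\<dots> \<le> 1 * norm (b q)" using c'1 by (intro mult_right_mono) auto
      finally show ?thesis unfolding m_def norm_of_real by linarith
    qed
    then show ?thesis by (simp add: a_def norm3_coeff3)
  qed
  have n_0: "norm3 x \<ge> 0" for x by (auto simp: norm3_def intro!: sum_nonneg)
  have prod_a: "(\<Prod>p\<in>P. norm3 (a q p)) \<le> 2 * norm (b q)" if "q \<in> P" for q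
  proof -
    have "(\<Prod>p\<in>P. norm3 (a q p)) \<le> (\<Prod>p\<in>P. if p = q then 2 * norm (b q) else 1)"
      using n_a n_0 by (intro prod_mono) auto
    also have "\<dots> = 2 * norm (b q)" using that P by (simp add: prod.delta)
    finally show ?thesis .
  qed
  have prod_r: "(\<Prod>p\<in>P. norm3 (r p)) \<le> 2 ^ X"
  proof -
    have "(\<Prod>p\<in>P. norm3 (r p)) = (\<Prod>p\<in>PX. norm3 (r p))"
      using P n_r(2) by (intro prod.mono_neutral_right) (auto simp: P_def)
    also have "\<dots> \<le> (\<Prod>p\<in>PX. 2)" using n_r(1) n_0 by (intro prod_mono) (auto simp: P_def)
    also have "\<dots> \<le> 2 ^ X" using card_primes_le[of X] by (simp add: PX_def power_increasing)
    finally show ?thesis .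
  qed
  have Z1: "real Z \<ge> 1" using p1 prime_ge_1_nat[of p1] by linarith
  have prodP: "real (\<Prod>P) \<le> 4 ^ X * real Z ^ 2"
  proof -
    have "\<Prod>P \<le> \<Prod>PX * \<Prod>{p1, p2}"
    proof -
      have "\<Prod>P * \<Prod>(PX \<inter> {p1, p2}) = \<Prod>PX * \<Prod>{p1, p2}"
        unfolding P_def using finX by (intro prod.union_inter) auto
      moreover have "\<Prod>(PX \<inter> {p1, p2}) \<ge> 1"
        using finX by (intro prod_ge_1) (auto simp: PX_def dest: prime_ge_1_nat)
      ultimately show ?thesis by (metis mult.right_neutral mult_le_mono2)
    qed
    also have "\<dots> \<le> 4 ^ X * Z ^ 2"
    proof (rule mult_le_mono)
      show "\<Prod>PX \<le> 4 ^ X" unfolding PX_def by (rule primorial_le)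
      show "\<Prod>{p1, p2} \<le> Z ^ 2"
        using p1 p2 Z1 by (cases "p1 = p2") (auto simp: power2_eq_square mult_le_mono intro: order_trans[of _ Z])
    qed
    finally have "real (\<Prod>P) \<le> real (4 ^ X * Z ^ 2)" by (simp only: of_nat_le_iff)
    then show ?thesis by simp
  qed
  have err: "2 * real (\<Prod>P) ^ 3 * (\<Prod>p\<in>P. norm3 (r p) * norm3 (a p1 p) * norm3 (a p2 p))
      \<le> 8 * B\<^sup>2 * real Z ^ 6 * 128 ^ X"
  proof -
    have "(\<Prod>p\<in>P. norm3 (r p) * norm3 (a p1 p) * norm3 (a p2 p)) =
        (\<Prod>p\<in>P. norm3 (r p)) * (\<Prod>p\<in>P. norm3 (a p1 p)) * (\<Prod>p\<in>P. norm3 (a p2 p))"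
      by (simp add: prod.distrib)
    also have "\<dots> \<le> 2 ^ X * (2 * B) * (2 * B)"
      using prod_r prod_a[of p1] prod_a[of p2] b[of p1] b[of p2] B0 n_0
      by (intro mult_mono) (auto simp: P_def intro!: prod_nonneg mult_nonneg_nonneg)
    finally have "2 * real (\<Prod>P) ^ 3 * (\<Prod>p\<in>P. norm3 (r p) * norm3 (a p1 p) * norm3 (a p2 p))
      \<le> 2 * (4 ^ X * real Z ^ 2) ^ 3 * (2 ^ X * (2 * B) * (2 * B))"
      using prodP n_0 B0 by (intro mult_mono power_mono) (auto intro!: prod_nonneg mult_nonneg_nonneg)
    also have "\<dots> = 8 * B\<^sup>2 * real Z ^ 6 * ((4 ^ X) ^ 3 * 2 ^ X)"
      by (simp add: power_mult_distrib power2_eq_square flip: power_mult)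
    also have "((4::real) ^ X) ^ 3 * 2 ^ X = 128 ^ X"
    proof -
      have "((4::real) ^ X) ^ 3 = (4 ^ 3) ^ X" by (simp only: power_mult[symmetric] mult.commute)
      then show ?thesis by (simp flip: power_mult_distrib)
    qed
    finally show ?thesis .
  qed
  have const: "norm (\<Prod>p\<in>P. const3 (r p) (a p1 p) (a p2 p)) \<le> (if p1 = p2 then 8 * (norm (b p1))\<^sup>2 else 0)"
  proof (cases "p1 = p2")
    case True
    have "(\<Prod>p\<in>P. const3 (r p) (a p1 p) (a p2 p)) = const3 (r p1) (a p1 p1) (a p2 p1) * (\<Prod>p\<in>P - {p1}. const3 (r p) (a p1 p) (a p2 p))"
      using P by (intro prod.remove) (auto simp: P_def)
    also have "(\<Prod>p\<in>P - {p1}. const3 (r p) (a p1 p) (a p2 p)) = 1"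
      using True by (intro prod.neutral) (auto simp: a_def const3_unit r_def coeff3_def)
    finally have "norm (\<Prod>p\<in>P. const3 (r p) (a p1 p) (a p2 p)) \<le> norm3 (r p1) * norm3 (a p1 p1) * norm3 (a p1 p1)"
      using norm_const3_le True by simp
    also have "\<dots> \<le> 2 * (2 * norm (b p1)) * (2 * norm (b p1))"
      using n_r[of p1] n_a[of p1 p1] n_0 by (intro mult_mono) (auto simp: P_def)
    finally show ?thesis using True by (simp add: power2_eq_square)
  next
    case False
    have "const3 (r p1) (a p1 p1) (a p2 p1) = 0"
      using False const3_right_unit[of "c' p1" "b p1"] by (simp add: r_def a_def m_def)
    then have "(\<Prod>p\<in>P. const3 (r p) (a p1 p) (a p2 p)) = 0"
      using P by (intro prod_zero) (auto simp: P_def)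
    then show ?thesis using False by simp
  qed
  define J where "J = integral {T..2*T} (\<lambda>t. riesz X c t * V p1 t * V p2 t)"
  have "norm (of_real J - of_real T * (\<Prod>p\<in>P. const3 (r p) (a p1 p) (a p2 p))) \<le> 8 * B\<^sup>2 * real Z ^ 6 * 128 ^ X"
    using integral_trig3_product[OF P T, of r "a p1" "a p2"] err unfolding int_eq J_def by linarith
  then have "norm (of_real J :: complex) \<le> 8 * B\<^sup>2 * real Z ^ 6 * 128 ^ X +
      norm (of_real T * (\<Prod>p\<in>P. const3 (r p) (a p1 p) (a p2 p)))"
    using norm_triangle_sub[of "of_real J" "of_real T * (\<Prod>p\<in>P. const3 (r p) (a p1 p) (a p2 p))"] by linarith
  also have "norm (of_real T * (\<Prod>p\<in>P. const3 (r p) (a p1 p) (a p2 p))) \<le>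
      T * (if p1 = p2 then 8 * (norm (b p1))\<^sup>2 else 0)"
    unfolding norm_mult using const T by (auto intro!: mult_mono)
  finally have "J \<le> 8 * B\<^sup>2 * real Z ^ 6 * 128 ^ X + T * (if p1 = p2 then 8 * (norm (b p1))\<^sup>2 else 0)"
    unfolding norm_of_real by linarith
  moreover have "T * (if p1 = p2 then 8 * (norm (b p1))\<^sup>2 else 0) = (if p1 = p2 then 8 * (norm (b p1))\<^sup>2 * T else 0)"
    by simp
  ultimately show ?thesis unfolding J_def[symmetric] by linarith
qed

lemma riesz_mean:
  assumes c: "\<And>p. norm (c p) \<le> 1" and T: "T \<ge> 0"
  shows "integral {T..2*T} (riesz X c) \<ge> T - 2 * 128 ^ X"
proof -
  define P where "P = {p::nat. prime p \<and> p \<le> X}"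
  have P: "finite P" "\<And>p. p \<in> P \<Longrightarrow> prime p"
    unfolding P_def by (auto intro: finite_subset[of _ "{..X}"])
  define r where "r p = coeff3 1 (cnj (c p))" for p
  define u where "u p = coeff3 1 0" for p :: nat
  have Rr: "(\<Prod>p\<in>P. trig3 (r p) p t * trig3 (u p) p t * trig3 (u p) p t) = of_real (riesz X c t)" for t
    using trig3_coeff3[of 1] by (simp add: r_def u_def riesz_def P_def)
  have "norm (of_real (integral {T..2*T} (riesz X c)) - of_real T * (1::complex))
      \<le> 2 * real (\<Prod>P) ^ 3 * (\<Prod>p\<in>P. norm3 (r p) * norm3 (u p) * norm3 (u p))"
    using integral_trig3_product[OF P T, of r u u] unfolding Rr
    by (simp add: integral_of_real_complex continuous_on_riesz u_def const3_unit) (simp add: r_def coeff3_def)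
  also have "\<dots> \<le> 2 * (4 ^ X) ^ 3 * 2 ^ X"
  proof (intro mult_mono power_mono)
    have "real (\<Prod>P) \<le> real (4 ^ X)" unfolding P_def of_nat_le_iff by (rule primorial_le)
    then show "real (\<Prod>P) \<le> 4 ^ X" by simp
    have "(\<Prod>p\<in>P. norm3 (r p) * norm3 (u p) * norm3 (u p)) \<le> (\<Prod>p\<in>P. 2)"
      using c by (intro prod_mono) (auto simp: r_def u_def norm3_coeff3)
    also have "\<dots> \<le> 2 ^ X" using card_primes_le[of X] by (simp add: P_def power_increasing)
    finally show "(\<Prod>p\<in>P. norm3 (r p) * norm3 (u p) * norm3 (u p)) \<le> 2 ^ X" .
  qed (auto simp: norm3_def intro!: prod_nonneg mult_nonneg_nonneg sum_nonneg)
  also have "2 * (4 ^ X) ^ 3 * 2 ^ X = 2 * (128::real) ^ X"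
  proof -
    have "((4::real) ^ X) ^ 3 = (4 ^ 3) ^ X" by (simp only: power_mult[symmetric] mult.commute)
    then show ?thesis by (simp add: mult.assoc flip: power_mult_distrib)
  qed
  finally have "norm (complex_of_real (integral {T..2*T} (riesz X c) - T)) \<le> 2 * 128 ^ X" by simp
  then show ?thesis unfolding norm_of_real by linarith
qed

text \<open>The square is expanded into correlations. The diagonal gives the variance term; the at
  most Z^2 pairs turn the error Z^6 into Z^8.\<close>

lemma riesz_second_moment:
  fixes X Z :: nat and c b :: "nat \<Rightarrow> complex" and T B :: real
  assumes c: "\<And>p. norm (c p) \<le> 1" and b: "\<And>p. norm (b p) \<le> B" and T: "T \<ge> 0"
  defines "V \<equiv> \<lambda>p t. Re (b p * exp (- (\<i> * of_real (ln p * t)))) - (if p \<le> X then Re (c p * b p) / 2 else 0)"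
  defines "PZ \<equiv> {p. prime p \<and> p \<le> Z}"
  shows "integral {T..2*T} (\<lambda>t. riesz X c t * (\<Sum>p\<in>PZ. V p t)\<^sup>2) \<le>
      8 * T * (\<Sum>p\<in>PZ. (norm (b p))\<^sup>2) + 8 * B\<^sup>2 * real Z ^ 8 * 128 ^ X"
proof -
  have fin: "finite PZ" unfolding PZ_def by (rule finite_subset[of _ "{..Z}"]) auto
  have cont: "continuous_on A (V p)" for A p unfolding V_def by (intro continuous_intros)
  have "riesz X c t * (\<Sum>p\<in>PZ. V p t)\<^sup>2 = (\<Sum>p\<in>PZ. \<Sum>q\<in>PZ. riesz X c t * V p t * V q t)" for t
    by (simp add: power2_eq_square sum_product sum_distrib_left mult_ac)
  then have "integral {T..2*T} (\<lambda>t. riesz X c t * (\<Sum>p\<in>PZ. V p t)\<^sup>2) =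
     (\<Sum>p\<in>PZ. \<Sum>q\<in>PZ. integral {T..2*T} (\<lambda>t. riesz X c t * V p t * V q t))"
    using fin by (simp add: integral_sum integrable_continuous_real continuous_intros cont)
  also have "\<dots> \<le> (\<Sum>p\<in>PZ. \<Sum>q\<in>PZ. (if p = q then 8 * (norm (b p))\<^sup>2 * T else 0) + 8 * B\<^sup>2 * real Z ^ 6 * 128 ^ X)"
    unfolding V_def using c b T by (intro sum_mono riesz_correlation) (auto simp: PZ_def)
  also have "\<dots> = (\<Sum>p\<in>PZ. 8 * (norm (b p))\<^sup>2 * T) + (real (card PZ))\<^sup>2 * (8 * B\<^sup>2 * real Z ^ 6 * 128 ^ X)"
    using fin by (simp add: sum.distrib power2_eq_square algebra_simps)
  also have "\<dots> \<le> (\<Sum>p\<in>PZ. 8 * (norm (b p))\<^sup>2 * T) + (real Z)\<^sup>2 * (8 * B\<^sup>2 * real Z ^ 6 * 128 ^ X)"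
    using card_primes_le[of Z] by (intro add_left_mono mult_right_mono power_mono) (auto simp: PZ_def)
  also have "\<dots> = 8 * T * (\<Sum>p\<in>PZ. (norm (b p))\<^sup>2) + 8 * B\<^sup>2 * real Z ^ 8 * 128 ^ X"
    using power_add[of "real Z" 2 6] by (simp add: sum_distrib_left mult_ac)
  finally show ?thesis .
qed

section \<open>Simultaneous values\<close>

text \<open>The third bound is a Chernoff bound for the Poisson tail: for n \<ge> N each term y^n /
  n! is at most (2y)^n / n! divided by 2^N, so the tail is at most e^(2y) / 2^N, and the factor
  e^(-y) leaves p^r / 2^N.\<close>

lemma exp_weight_bounds:
  assumes "p > 0" "r \<ge> 0"
  shows "0 \<le> exp_weight N r p" "exp_weight N r p \<le> 1"
    "1 - exp_weight N r p \<le> real p powr r / 2 ^ N"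
proof -
  define y where "y = r * ln p"
  have y: "y \<ge> 0" using assms by (simp add: y_def)
  have pr: "real p powr r = exp y" "real p powr (-r) = exp (- y)"
    using assms by (simp_all add: powr_def y_def)
  have w: "exp_weight N r p = exp (- y) * (\<Sum>n<N. y ^ n / fact n)"
    by (simp add: exp_weight_def pr y_def)
  have es: "(\<lambda>n. z ^ n / fact n) sums exp z" for z :: real
    using exp_converges[of z] by (simp add: field_simps)
  show "0 \<le> exp_weight N r p" unfolding w using y by (auto intro!: mult_nonneg_nonneg sum_nonneg)
  have "(\<Sum>n<N. y ^ n / fact n) \<le> exp y"
    using sum_le_suminf[OF sums_summable[OF es[of y]], of "{..<N}"] es[of y] y by (simp add: sums_iff)
  then have "exp (- y) * (\<Sum>n<N. y ^ n / fact n) \<le> exp (- y) * exp y" by (intro mult_left_mono) auto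
  then show "exp_weight N r p \<le> 1" unfolding w by (simp add: exp_minus)
  have tail: "(\<lambda>n. y ^ (n + N) / fact (n + N)) sums (exp y - (\<Sum>n<N. y ^ n / fact n))"
    by (rule sums_split_initial_segment[OF es])
  have tail2: "(\<lambda>n. (2 * y) ^ (n + N) / fact (n + N)) sums (exp (2 * y) - (\<Sum>n<N. (2 * y) ^ n / fact n))"
    by (rule sums_split_initial_segment[OF es])
  have "exp y - (\<Sum>n<N. y ^ n / fact n) \<le> (exp (2 * y) - (\<Sum>n<N. (2 * y) ^ n / fact n)) / 2 ^ N"
  proof (rule sums_le[OF _ tail sums_divide[OF tail2]])
    fix n
    have "y ^ (n + N) * 2 ^ N \<le> (2 * y) ^ (n + N)"
      using y one_le_power[of "2::real" n] by (simp add: power_mult_distrib power_add mult_ac mult_left_mono mult_le_cancel_left1)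
    then have "y ^ (n + N) \<le> (2 * y) ^ (n + N) / 2 ^ N" by (simp add: field_simps)
    then have "y ^ (n + N) / fact (n + N) \<le> (2 * y) ^ (n + N) / 2 ^ N / fact (n + N)"
      by (rule divide_right_mono) simp
    then show "y ^ (n + N) / fact (n + N) \<le> (2 * y) ^ (n + N) / fact (n + N) / 2 ^ N" by (simp add: mult.commute)
  qed
  also have "\<dots> \<le> exp (2 * y) / 2 ^ N"
    using y by (intro divide_right_mono) (auto intro!: sum_nonneg)
  finally have "exp (- y) * (exp y - (\<Sum>n<N. y ^ n / fact n)) \<le> exp (- y) * (exp (2 * y) / 2 ^ N)"
    by (intro mult_left_mono) auto
  also have "exp (- y) * (exp (2 * y) / 2 ^ N) = exp y / 2 ^ N"
    by (simp flip: exp_add)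
  finally show "1 - exp_weight N r p \<le> real p powr r / 2 ^ N"
    unfolding w pr by (simp add: right_diff_distrib exp_minus)
qed

text \<open>A product converging in the sense of \<open>has_prod\<close> vanishes only if a factor
  does. As \<open>inverse 0 = 0\<close>, a factor vanishes only where 1 - a_j(p) p^(-s) does, which
  |a_j(p)| \<le> 1 < p^(Re s) excludes.\<close>

lemma euler_product_nonzero:
  fixes d :: nat and aj :: "nat \<Rightarrow> nat \<Rightarrow> complex"
  assumes aj: "\<And>j p. j < d \<Longrightarrow> prime p \<Longrightarrow> norm (aj j p) \<le> 1"
    and hp: "(\<lambda>p. if prime p then (\<Prod>j<d. inverse (1 - aj j p / of_nat p powr s)) else 1) has_prod w"
    and s: "Re s > 1"
  shows "w \<noteq> 0"
proof
  assume "w = 0"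
  then have "0 \<in> range (\<lambda>p. if prime p then (\<Prod>j<d. inverse (1 - aj j p / of_nat p powr s)) else 1)"
    using has_prod_eq_0_iff[OF hp] by simp
  then obtain p j where pj: "prime p" "j < d" "1 - aj j p / of_nat p powr s = 0"
    by (auto split: if_splits)
  have "1 < real p powr Re s" using prime_gt_1_nat[OF pj(1)] s by (intro gr_one_powr) auto
  moreover have "norm (aj j p / of_nat p powr s) = 1" using pj(3) by (metis eq_iff_diff_eq_0 norm_one)
  ultimately show False
    using aj[OF pj(2,1)] by (simp add: norm_divide norm_of_nat_powr)
qed

text \<open>\<open>zero_count\<close> is a \<open>card\<close> and would be 0 for an infinite set,
  so finiteness is needed before it can bound the number of excluded points. The absence of zeros in
  Re s > 1 confines them to a compact box.\<close>

lemma finite_zeros_strip: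
  assumes S: "selberg_class a f" and nz: "\<And>s. Re s > 1 \<Longrightarrow> f s \<noteq> 0" and T: "T > 0"
  shows "finite {\<rho>. f \<rho> = 0 \<and> T \<le> Im \<rho> \<and> Im \<rho> \<le> 2 * T \<and> Re \<rho> \<ge> \<sigma>}"
proof -
  define U where "U = {s. Im s > 0}"
  define K where "K = cbox (Complex \<sigma> T) (Complex 1 (2 * T))"
  have hol: "f holomorphic_on U"
    using selberg_class_holomorphic[OF S] by (rule holomorphic_on_subset) (auto simp: U_def)
  have KU: "K \<subseteq> U" using T by (auto simp: K_def U_def in_cbox_complex_iff)
  have "finite {z\<in>K. f z = 0}"
  proof (cases "f constant_on U")
    case True
    have "f z = f (Complex 2 1)" if "z \<in> U" for z
      using True that unfolding constant_on_def U_def by (metis (mono_tags, lifting) complex.sel(2) mem_Collect_eq zero_less_one)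
    then have e: "{z\<in>K. f z = 0} = {}" using KU nz[of "Complex 2 1"] by auto
    show ?thesis unfolding e by simp
  next
    case False
    have "open U" unfolding U_def by (rule open_halfspace_Im_gt)
    moreover have "connected U" unfolding U_def by (intro convex_connected convex_halfspace_Im_gt)
    ultimately show ?thesis
      using KU False hol by (intro holomorphic_compact_finite_zeros[where S = U]) (auto simp: K_def)
  qed
  moreover have "{\<rho>. f \<rho> = 0 \<and> T \<le> Im \<rho> \<and> Im \<rho> \<le> 2 * T \<and> Re \<rho> \<ge> \<sigma>} \<subseteq> {z\<in>K. f z = 0}"
  proof
    fix \<rho> assume "\<rho> \<in> {\<rho>. f \<rho> = 0 \<and> T \<le> Im \<rho> \<and> Im \<rho> \<le> 2 * T \<and> Re \<rho> \<ge> \<sigma>}"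
    moreover from this have "Re \<rho> \<le> 1" using nz[of \<rho>] by (cases "Re \<rho> \<le> 1") auto
    ultimately show "\<rho> \<in> {z\<in>K. f z = 0}" by (auto simp: K_def in_cbox_complex_iff)
  qed
  ultimately show ?thesis by (rule finite_subset[rotated])
qed

lemma integral_near_point_le:
  fixes y :: real
  shows "(\<lambda>t. if t \<in> {y-4..y+4} then 1 else 0 :: real) integrable_on {a..b}"
    "integral {a..b} (\<lambda>t. if t \<in> {y-4..y+4} then 1 else 0 :: real) \<le> 8"
proof -
  have e: "{y-4..y+4} \<inter> {a..b} = {max (y-4) a..min (y+4) b}" by auto
  have "(\<lambda>t. 1 :: real) integrable_on ({y-4..y+4} \<inter> {a..b})" unfolding e by (rule integrable_const_ivl)
  then show "(\<lambda>t. if t \<in> {y-4..y+4} then 1 else 0 :: real) integrable_on {a..b}"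
    by (simp only: integrable_restrict_Int)
  have "integral {a..b} (\<lambda>t. if t \<in> {y-4..y+4} then 1 else 0 :: real) = integral ({y-4..y+4} \<inter> {a..b}) (\<lambda>t. 1)"
    by (rule integral_restrict_Int)
  also have "\<dots> \<le> 8"
    unfolding e by (cases "max (y-4) a \<le> min (y+4) b") auto
  finally show "integral {a..b} (\<lambda>t. if t \<in> {y-4..y+4} then 1 else 0 :: real) \<le> 8" .
qed

text \<open>Chebyshev's inequality for the measure with density \<^const>\<open>riesz\<close>.\<close>

lemma exists_good_point:
  fixes I :: "'i set" and Y :: "real set" and X Z :: nat and c :: "nat \<Rightarrow> complex"
    and b :: "'i \<Rightarrow> nat \<Rightarrow> complex" and T B L :: real
  assumes I: "finite I" and Y: "finite Y" and c: "\<And>p. norm (c p) \<le> 1"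
    and b: "\<And>h p. h \<in> I \<Longrightarrow> norm (b h p) \<le> B" and T: "T \<ge> 0" and L: "L > 0"
  defines "W \<equiv> \<lambda>h t. \<Sum>p | prime p \<and> p \<le> Z. Re (b h p * exp (- (\<i> * of_real (ln p * t))))
       - (if p \<le> X then Re (c p * b h p) / 2 else 0)"
  assumes big: "(\<Sum>h\<in>I. 8 * T * (\<Sum>p | prime p \<and> p \<le> Z. (norm (b h p))\<^sup>2) + 8 * B\<^sup>2 * real Z ^ 8 * 128 ^ X)
     < L * (T - 2 * 128 ^ X - 8 * 2 ^ X * real (card Y))"
  shows "\<exists>t\<in>{T..2*T}. (\<forall>y\<in>Y. 4 < \<bar>t - y\<bar>) \<and> (\<Sum>h\<in>I. (W h t)\<^sup>2) \<le> L"
proof (rule ccontr)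
  assume contra: "\<not> ?thesis"
  define g where "g y t = (if t \<in> {y-4..y+4} then 1 else 0 :: real)" for y t :: real
  have contW: "continuous_on A (W h)" for A h unfolding W_def by (intro continuous_intros)
  \<comment> \<open>If no t were good, then at every t either the sum of squares exceeds L or t is
    within 4 of a point of Y. The indicator \<open>g\<close> pays for the second case, using that
    the Riesz product is at most 2^X. Integration contradicts \<open>big\<close>.\<close>
  have pw: "riesz X c t * L - (\<Sum>h\<in>I. riesz X c t * (W h t)\<^sup>2) \<le> (\<Sum>y\<in>Y. L * 2 ^ X * g y t)"
    if t: "t \<in> {T..2*T}" for t
  proof (cases "\<forall>y\<in>Y. 4 < \<bar>t - y\<bar>")
    case True
    then have "(\<Sum>h\<in>I. (W h t)\<^sup>2) > L" using contra t by auto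
    then have "riesz X c t * L \<le> riesz X c t * (\<Sum>h\<in>I. (W h t)\<^sup>2)"
      using riesz_bounds(1)[where c = c, OF c] by (intro mult_left_mono) auto
    also have "\<dots> = (\<Sum>h\<in>I. riesz X c t * (W h t)\<^sup>2)" by (simp add: sum_distrib_left)
    finally have "riesz X c t * L - (\<Sum>h\<in>I. riesz X c t * (W h t)\<^sup>2) \<le> 0" by simp
    also have "0 \<le> (\<Sum>y\<in>Y. L * 2 ^ X * g y t)" using L by (intro sum_nonneg) (auto simp: g_def)
    finally show ?thesis .
  next
    case False
    then obtain y where y: "y \<in> Y" "\<bar>t - y\<bar> \<le> 4" by auto
    have "riesz X c t * L - (\<Sum>h\<in>I. riesz X c t * (W h t)\<^sup>2) \<le> riesz X c t * L"
      using riesz_bounds(1)[where c = c, OF c] by (auto intro!: sum_nonneg)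
    also have "\<dots> \<le> 2 ^ X * L" using riesz_bounds(2)[where c = c, OF c] L by (intro mult_right_mono) auto
    also have "\<dots> = L * 2 ^ X * g y t" using y(2) by (auto simp: g_def abs_le_iff)
    also have "\<dots> \<le> (\<Sum>y\<in>Y. L * 2 ^ X * g y t)"
      using y(1) Y L by (intro member_le_sum) (auto simp: g_def)
    finally show ?thesis .
  qed
  have "integral {T..2*T} (\<lambda>t. riesz X c t * L - (\<Sum>h\<in>I. riesz X c t * (W h t)\<^sup>2)) \<le>
      integral {T..2*T} (\<lambda>t. \<Sum>y\<in>Y. L * 2 ^ X * g y t)"
  proof (rule integral_le[OF _ _ pw])
    show "(\<lambda>t. riesz X c t * L - (\<Sum>h\<in>I. riesz X c t * (W h t)\<^sup>2)) integrable_on {T..2*T}"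
      by (intro integrable_continuous_real continuous_intros contW)
    show "(\<lambda>t. \<Sum>y\<in>Y. L * 2 ^ X * g y t) integrable_on {T..2*T}"
      unfolding g_def using integral_near_point_le(1)
      by (intro integrable_sum Y integrable_on_mult_right) auto
  qed
  also have "\<dots> = (\<Sum>y\<in>Y. L * 2 ^ X * integral {T..2*T} (g y))"
    unfolding g_def using integral_near_point_le(1)
    by (subst integral_sum[OF Y]) (auto intro!: integrable_on_mult_right)
  also have "\<dots> \<le> (\<Sum>y\<in>Y. L * 2 ^ X * 8)"
    using L integral_near_point_le(2) by (intro sum_mono mult_left_mono) (auto simp: g_def[abs_def])
  also have "\<dots> = L * (8 * 2 ^ X * real (card Y))" by simp
  finally have up: "integral {T..2*T} (\<lambda>t. riesz X c t * L - (\<Sum>h\<in>I. riesz X c t * (W h t)\<^sup>2)) \<le> L * (8 * 2 ^ X * real (card Y))" .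
  have "integral {T..2*T} (\<lambda>t. riesz X c t * L - (\<Sum>h\<in>I. riesz X c t * (W h t)\<^sup>2)) =
     integral {T..2*T} (\<lambda>t. riesz X c t * L) - integral {T..2*T} (\<lambda>t. \<Sum>h\<in>I. riesz X c t * (W h t)\<^sup>2)"
    by (intro integral_diff integrable_continuous_real continuous_intros contW)
  also have "integral {T..2*T} (\<lambda>t. riesz X c t * L) = integral {T..2*T} (riesz X c) * L"
    by (rule integral_mult_left)
  also have "integral {T..2*T} (\<lambda>t. \<Sum>h\<in>I. riesz X c t * (W h t)\<^sup>2) =
      (\<Sum>h\<in>I. integral {T..2*T} (\<lambda>t. riesz X c t * (W h t)\<^sup>2))"
    by (intro integral_sum I integrable_continuous_real continuous_intros contW)
  finally have eq: "integral {T..2*T} (\<lambda>t. riesz X c t * L - (\<Sum>h\<in>I. riesz X c t * (W h t)\<^sup>2)) =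
     integral {T..2*T} (riesz X c) * L - (\<Sum>h\<in>I. integral {T..2*T} (\<lambda>t. riesz X c t * (W h t)\<^sup>2))" .
  have "(\<Sum>h\<in>I. integral {T..2*T} (\<lambda>t. riesz X c t * (W h t)\<^sup>2)) \<le>
     (\<Sum>h\<in>I. 8 * T * (\<Sum>p | prime p \<and> p \<le> Z. (norm (b h p))\<^sup>2) + 8 * B\<^sup>2 * real Z ^ 8 * 128 ^ X)"
  proof (rule sum_mono)
    fix h assume h: "h \<in> I"
    show "integral {T..2*T} (\<lambda>t. riesz X c t * (W h t)\<^sup>2) \<le>
        8 * T * (\<Sum>p | prime p \<and> p \<le> Z. (norm (b h p))\<^sup>2) + 8 * B\<^sup>2 * real Z ^ 8 * 128 ^ X"
      unfolding W_def by (rule riesz_second_moment[OF c b[OF h] T])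
  qed
  moreover have "(T - 2 * 128 ^ X) * L \<le> integral {T..2*T} (riesz X c) * L"
    using riesz_mean[where c = c, OF c T] L by (intro mult_right_mono) auto
  ultimately show False using big up eq by (simp add: algebra_simps)
qed

text \<open>The degree of the Taylor polynomials. It has to be large compared with log log T, to
  make q^N * log T tend to 0 and 2^N exceed X^5, and small compared with log T, so that Z = 256^N is
  T^o(1).\<close>

definition cutoff :: "real \<Rightarrow> nat" where
  "cutoff T = nat \<lceil>sqrt (ln T)\<rceil>"

lemma cutoff_bounds:
  assumes "T \<ge> 1"
  shows "sqrt (ln T) \<le> cutoff T" "cutoff T \<le> sqrt (ln T) + 1"
proof -
  have "0 \<le> sqrt (ln T)" using assms by simp
  then show "sqrt (ln T) \<le> cutoff T" "cutoff T \<le> sqrt (ln T) + 1"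
    unfolding cutoff_def by linarith+
qed

lemma filterlim_cutoff: "filterlim cutoff at_top at_top"
proof (rule filterlim_at_top[THEN iffD2, rule_format])
  fix n :: nat
  have "filterlim (\<lambda>T. sqrt (ln T)) at_top at_top" by real_asymp
  then have "eventually (\<lambda>T. real n \<le> sqrt (ln T)) at_top" by (simp add: filterlim_at_top)
  then show "eventually (\<lambda>T. n \<le> cutoff T) at_top"
    using eventually_ge_at_top[of 1]
  proof eventually_elim
    case (elim T)
    then have "real n \<le> real (cutoff T)" using cutoff_bounds(1)[of T] by linarith
    then show ?case by simp
  qed
qed

text \<open>Ties degree and length of the prime sum to T, which makes the error bounded. The
  constants are left under existential quantifiers so that they can be chosen for all functions at
  once by \<open>bchoice\<close>.\<close>

lemma ln_norm_approx_eventually: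
  assumes P: "selberg_poly a f" and R: "ramanujan a" and \<sigma>: "1/2 < \<sigma>0" "\<sigma>0 < \<sigma>" "\<sigma> \<le> 1"
  shows "\<exists>d K. 0 \<le> d \<and> 0 \<le> K \<and> (\<forall>p. prime p \<longrightarrow> norm (a p) \<le> d) \<and> (\<forall>s. Re s > 1 \<longrightarrow> f s \<noteq> 0) \<and>
     (\<forall>\<^sub>F T in at_top. \<forall>t\<in>{T..2*T}. (\<forall>s\<in>ball (Complex 4 t) (4 - \<sigma>0). f s \<noteq> 0) \<longrightarrow>
       f (Complex \<sigma> t) \<noteq> 0 \<and>
       \<bar>ln (norm (f (Complex \<sigma> t))) - (\<Sum>p | prime p \<and> p \<le> 256 ^ cutoff T.
          Re (a p * of_real (exp_weight (cutoff T) (4 - \<sigma>) p) / of_nat p powr (Complex \<sigma> t)))\<bar> \<le> K)"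
proof (rule selberg_poly_ramanujan_euler[OF P R])
  fix d :: nat and aj :: "nat \<Rightarrow> nat \<Rightarrow> complex"
  assume aj: "\<And>j p. j < d \<Longrightarrow> prime p \<Longrightarrow> norm (aj j p) \<le> 1"
    and ap: "\<And>p. prime p \<Longrightarrow> a p = (\<Sum>j<d. aj j p)"
    and hp: "\<And>s. Re s > 1 \<Longrightarrow>
      (\<lambda>p. if prime p then (\<Prod>j<d. inverse (1 - aj j p / of_nat p powr s)) else 1) has_prod f s"
  have S: "selberg_class a f" using P by (simp add: selberg_poly_def)
  show ?thesis
  proof (rule ln_norm_approx[OF S aj ap hp \<sigma>])
    fix K q t1 :: real and Z0 :: nat
    assume K: "K > 0" "0 < q" "q < 1" "t1 \<ge> 1" and
    approx: "\<And>(t::real) (N::nat) (Z::nat). t \<ge> t1 \<Longrightarrow> N > 0 \<Longrightarrow> Z \<ge> Z0 \<Longrightarrow> (\<And>s. s \<in> ball (Complex 4 t) (4 - \<sigma>0) \<Longrightarrow> f s \<noteq> 0) \<Longrightarrow>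
      f (Complex \<sigma> t) \<noteq> 0 \<and>
      \<bar>ln (norm (f (Complex \<sigma> t))) - (\<Sum>p | prime p \<and> p \<le> Z.
          Re (a p * of_real (exp_weight N (4 - \<sigma>) p) / of_nat p powr (Complex \<sigma> t)))\<bar>
        \<le> K * (1 + ln t * q ^ N + real N * 8 ^ N * real (Z + 1) powr (-3/4))"
    have ad: "norm (a p) \<le> real d" if "prime p" for p
    proof -
      have "norm (a p) \<le> (\<Sum>j<d. 1)" unfolding ap[OF that] using aj that by (intro sum_norm_le) auto
      then show ?thesis by simp
    qed
    have nz: "f s \<noteq> 0" if "Re s > 1" for s
      using euler_product_nonzero[OF aj hp[OF that] that] .
    have "((\<lambda>T. ln (2 * T) * q powr sqrt (ln T)) \<longlongrightarrow> 0) at_top" using K(2,3) by real_asymp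
    then have e1: "eventually (\<lambda>T. ln (2 * T) * q powr sqrt (ln T) < 1) at_top"
      by (rule order_tendstoD) simp
    have e2: "eventually (\<lambda>T. cutoff T \<ge> Z0 + 1) at_top"
      using filterlim_cutoff by (simp add: filterlim_at_top)
    have "\<forall>\<^sub>F T in at_top. \<forall>t\<in>{T..2*T}. (\<forall>s\<in>ball (Complex 4 t) (4 - \<sigma>0). f s \<noteq> 0) \<longrightarrow>
         f (Complex \<sigma> t) \<noteq> 0 \<and>
         \<bar>ln (norm (f (Complex \<sigma> t))) - (\<Sum>p | prime p \<and> p \<le> 256 ^ cutoff T.
            Re (a p * of_real (exp_weight (cutoff T) (4 - \<sigma>) p) / of_nat p powr (Complex \<sigma> t)))\<bar> \<le> 3 * K"
      using e1 e2 eventually_ge_at_top[of t1]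
    proof eventually_elim
      case (elim T)
      define N where "N = cutoff T"
      \<comment> \<open>256 = 2^8, so (Z + 1)^(-3/4) is at most 64^(-N), which outweighs N *
        8^N.\<close>
      define Z :: nat where "Z = 256 ^ N"
      have T1: "T \<ge> 1" using elim K by linarith
      have N: "N > 0" "N \<ge> Z0" using elim by (auto simp: N_def)
      have NZ: "N \<le> Z" unfolding Z_def using less_exp[of N] power_mono[of 2 "256::nat" N] by linarith
      have qN: "q ^ N \<le> q powr sqrt (ln T)"
      proof -
        have "q ^ N = q powr real N" using K by (simp add: powr_realpow)
        also have "\<dots> \<le> q powr sqrt (ln T)"
          using K cutoff_bounds(1)[OF T1] by (intro powr_mono') (auto simp: N_def)
        finally show ?thesis .
      qed
      have tail: "real N * 8 ^ N * real (Z + 1) powr (-3/4) \<le> 1"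
      proof -
        have "real (Z + 1) powr (-3/4) \<le> real Z powr (-3/4)" by (intro powr_mono2') (auto simp: Z_def)
        also have "real Z = 2 powr (8 * real N)"
        proof -
          have "real Z = (2 ^ 8) ^ N" by (simp add: Z_def)
          also have "\<dots> = 2 ^ (8 * N)" by (simp only: power_mult)
          finally show ?thesis by (simp flip: powr_realpow)
        qed
        also have "(2 powr (8 * real N)) powr (-3/4) = 2 powr (- (6 * real N))" by (simp add: powr_powr)
        also have "\<dots> = 1 / 64 ^ N"
        proof -
          have "(2::real) powr (6 * real N) = 2 ^ (6 * N)" by (simp flip: powr_realpow)
          also have "\<dots> = 64 ^ N" by (simp add: power_mult)
          finally show ?thesis by (simp add: powr_minus_divide)
        qed
        finally have "real N * 8 ^ N * real (Z + 1) powr (-3/4) \<le> real N * 8 ^ N * (1 / 64 ^ N)"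
          by (intro mult_left_mono) auto
        also have "\<dots> = real N / 8 ^ N"
        proof -
          have "(64::real) ^ N = 8 ^ N * 8 ^ N" by (simp flip: power_mult_distrib)
          then show ?thesis by simp
        qed
        also have "\<dots> \<le> 1"
        proof -
          have "real N \<le> 2 ^ N" using of_nat_less_two_power[of N, where ?'a = real] by linarith
          also have "\<dots> \<le> 8 ^ N" by (intro power_mono) auto
          finally show ?thesis by simp
        qed
        finally show ?thesis .
      qed
      show ?case
      proof (intro ballI impI)
        fix t assume t: "t \<in> {T..2*T}" and nz: "\<forall>s\<in>ball (Complex 4 t) (4 - \<sigma>0). f s \<noteq> 0"
        have A: "f (Complex \<sigma> t) \<noteq> 0 \<and>
          \<bar>ln (norm (f (Complex \<sigma> t))) - (\<Sum>p | prime p \<and> p \<le> Z.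
            Re (a p * of_real (exp_weight N (4 - \<sigma>) p) / of_nat p powr (Complex \<sigma> t)))\<bar>
          \<le> K * (1 + ln t * q ^ N + real N * 8 ^ N * real (Z + 1) powr (-3/4))"
          by (rule approx) (use t elim N NZ nz in auto)
        have "ln t * q ^ N \<le> ln (2 * T) * q powr sqrt (ln T)"
          using t T1 K qN by (intro mult_mono) auto
        then have "1 + ln t * q ^ N + real N * 8 ^ N * real (Z + 1) powr (-3/4) \<le> 3"
          using tail elim by linarith
        then have "K * (1 + ln t * q ^ N + real N * 8 ^ N * real (Z + 1) powr (-3/4)) \<le> K * 3"
          using K by (intro mult_left_mono) auto
        then show "f (Complex \<sigma> t) \<noteq> 0 \<and>
         \<bar>ln (norm (f (Complex \<sigma> t))) - (\<Sum>p | prime p \<and> p \<le> 256 ^ cutoff T.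
            Re (a p * of_real (exp_weight (cutoff T) (4 - \<sigma>) p) / of_nat p powr (Complex \<sigma> t)))\<bar> \<le> 3 * K"
          using A unfolding N_def Z_def by linarith
      qed
    qed
    then show ?thesis using ad nz K by (intro exI[of _ "real d"] exI[of _ "3 * K"]) auto
  qed
qed

text \<open>In order, the conditions bound the loss of mass of the Riesz product, the mass near
  zeros, the error of the second moment, and the deviation of the smoothing weight from 1 on p \<le>
  X. Since log 128 \<le> 5, the choice \<alpha>/10 gives 128^X \<le> T^(1/2), and 2^X \<le>
  T^(\<alpha>/10) is compatible with T^(1-\<alpha>) zeros.\<close>

lemma parameter_conditions:
  fixes \<alpha> :: real and M :: "real \<Rightarrow> real"
  assumes \<alpha>: "0 < \<alpha>" "\<alpha> < 1" and M: "M \<in> o[at_top](\<lambda>T. T powr (1 - \<alpha>))"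
  defines "X \<equiv> \<lambda>T. nat \<lfloor>\<alpha> / 10 * ln T\<rfloor>"
  shows "\<forall>\<^sub>F T in at_top. T \<ge> 1 \<and> real (X T) \<le> \<alpha> / 10 * ln T \<and> 2 * 128 ^ X T \<le> T / 4 \<and>
     8 * 2 ^ X T * (2 + M T) \<le> T / 4 \<and> real (256 ^ cutoff T) ^ 8 * 128 ^ X T \<le> T \<and>
     real (X T) ^ 5 \<le> 2 ^ cutoff T"
proof -
  have X: "real (X T) \<le> \<alpha> / 10 * ln T" if "T \<ge> 1" for T
    using that \<alpha> unfolding X_def by (intro of_nat_floor) auto
  have "\<forall>\<^sub>F T in at_top. norm (M T) \<le> 1 * norm (T powr (1 - \<alpha>))"
    by (rule landau_o.smallD[OF M]) simp
  then have eM: "\<forall>\<^sub>F T in at_top. M T \<le> T powr (1 - \<alpha>)"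
    by eventually_elim simp
  have e1: "\<forall>\<^sub>F T in at_top. 2 * T powr (1/2) \<le> T / (4::real)" by real_asymp
  have e2: "\<forall>\<^sub>F T in at_top. 8 * T powr (\<alpha> / 10) * (2 + T powr (1 - \<alpha>)) \<le> T / 4"
    using \<alpha> by real_asymp
  have e3: "\<forall>\<^sub>F T in at_top. exp (64 * (sqrt (ln T) + 1)) * T powr (1/2) \<le> (T::real)" by real_asymp
  have e4: "\<forall>\<^sub>F T in at_top. (ln T) ^ 5 \<le> (2::real) powr sqrt (ln T)" by real_asymp
  show ?thesis using eM e1 e2 e3 e4 eventually_ge_at_top[of 1]
  proof eventually_elim
    case (elim T)
    have T: "T \<ge> 1" by fact
    have XT: "real (X T) \<le> \<alpha> / 10 * ln T" by (rule X[OF T])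
    have pw: "b ^ X T \<le> T powr (\<alpha> / 10 * ln b)" if "b \<ge> 1" for b :: real
    proof -
      have "b ^ X T = b powr real (X T)" using that by (simp add: powr_realpow)
      also have "\<dots> \<le> b powr (\<alpha> / 10 * ln T)" using that XT by (intro powr_mono) auto
      also have "\<dots> = T powr (\<alpha> / 10 * ln b)" using that T by (simp add: powr_def mult_ac)
      finally show ?thesis .
    qed
    have ln2: "ln (2::real) \<le> 25/36" by (rule ln2_le_25_over_36)
    have "ln (128::real) = ln (2 ^ 7)" by simp
    also have "\<dots> = 7 * ln 2" by (subst ln_realpow) auto
    finally have "ln (128::real) \<le> 5" using ln2 by simp
    then have "\<alpha> / 10 * ln 128 \<le> \<alpha> / 10 * 5" using \<alpha> by (intro mult_left_mono) auto
    also have "\<dots> \<le> 1/2" using \<alpha> by simp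
    finally have "T powr (\<alpha> / 10 * ln 128) \<le> T powr (1/2)" using T by (intro powr_mono) auto
    then have p128: "128 ^ X T \<le> T powr (1/2)" using pw[of 128] by linarith
    have "\<alpha> / 10 * ln 2 \<le> \<alpha> / 10 * 1" using ln2 \<alpha> by (intro mult_left_mono) auto
    then have "T powr (\<alpha> / 10 * ln 2) \<le> T powr (\<alpha> / 10)" using T by (intro powr_mono) auto
    then have p2: "2 ^ X T \<le> T powr (\<alpha> / 10)" using pw[of 2] by linarith
    have 1: "2 * 128 ^ X T \<le> T / 4" using p128 elim by linarith
    have 2: "8 * 2 ^ X T * (2 + M T) \<le> T / 4"
    proof -
      have "8 * 2 ^ X T * (2 + M T) \<le> 8 * 2 ^ X T * (2 + T powr (1 - \<alpha>))"
        using elim by (intro mult_left_mono) auto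
      also have "\<dots> \<le> 8 * T powr (\<alpha> / 10) * (2 + T powr (1 - \<alpha>))"
        using p2 by (intro mult_right_mono) auto
      finally show ?thesis using elim by linarith
    qed
    have 3: "real (256 ^ cutoff T) ^ 8 * 128 ^ X T \<le> T"
    proof -
      have "real (256 ^ cutoff T) ^ 8 = (256 ^ 8) ^ cutoff T"
        by (simp only: of_nat_power of_nat_numeral power_mult[symmetric] mult.commute)
      also have "(256::real) ^ 8 = 2 ^ 64" by simp
      also have "(2 ^ 64) ^ cutoff T = (2::real) powr (64 * real (cutoff T))"
        by (simp only: power_mult[symmetric]) (simp flip: powr_realpow)
      also have "\<dots> = exp (64 * real (cutoff T) * ln 2)" by (simp add: powr_def)
      also have "\<dots> \<le> exp (64 * (sqrt (ln T) + 1))"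
      proof -
        have "64 * real (cutoff T) * ln 2 \<le> 64 * (sqrt (ln T) + 1) * 1"
          using cutoff_bounds(2)[OF T] ln2 T by (intro mult_mono) auto
        then show ?thesis by simp
      qed
      finally have "real (256 ^ cutoff T) ^ 8 * 128 ^ X T \<le> exp (64 * (sqrt (ln T) + 1)) * T powr (1/2)"
        using p128 by (intro mult_mono) auto
      then show ?thesis using elim by linarith
    qed
    have 4: "real (X T) ^ 5 \<le> 2 ^ cutoff T"
    proof -
      have "\<alpha> / 10 * ln T \<le> 1 * ln T" using \<alpha> T by (intro mult_right_mono) auto
      then have "real (X T) ^ 5 \<le> ln T ^ 5" using XT by (intro power_mono) auto
      also have "\<dots> \<le> 2 powr sqrt (ln T)" using elim by simp
      also have "\<dots> \<le> 2 powr real (cutoff T)" using cutoff_bounds(1)[OF T] by (intro powr_mono) auto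
      finally show ?thesis by (simp add: powr_realpow)
    qed
    show ?case using T XT 1 2 3 4 by blast
  qed
qed

lemma prime_powr_Complex:
  assumes "p > (0::nat)"
  shows "w * of_real x / of_nat p powr (Complex \<sigma> t) =
    (w * of_real (x * real p powr (- \<sigma>))) * exp (- (\<i> * of_real (ln p * t)))"
proof -
  have "of_nat p powr (Complex \<sigma> t) = exp (of_real (\<sigma> * ln p)) * exp (\<i> * of_real (ln p * t))"
    using assms by (simp add: powr_def Ln_of_nat Complex_eq ring_distribs mult_ac flip: exp_add)
  also have "exp (of_real (\<sigma> * ln p)) = complex_of_real (real p powr \<sigma>)"
    using assms by (simp only: exp_of_real powr_def) simp
  finally show ?thesis using assms by (simp add: exp_minus powr_minus field_simps)
qed

text \<open>The phases are quantified after T and K does not depend on them, because they will be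
  chosen in terms of T. The factor 1/2 is the mean c_p / 2 of p^(-it) under the Riesz
  product.\<close>

lemma simultaneous_values:
  fixes n :: nat and a :: "nat \<Rightarrow> nat \<Rightarrow> complex" and F :: "nat \<Rightarrow> complex \<Rightarrow> complex" and \<sigma>0 \<sigma> \<alpha> :: real
  assumes poly: "\<forall>h\<in>{1..n}. selberg_poly (a h) (F h)" and ram: "\<forall>h\<in>{1..n}. ramanujan (a h)"
    and \<sigma>: "1/2 < \<sigma>0" "\<sigma>0 < \<sigma>" "\<sigma> \<le> 1" and \<alpha>: "0 < \<alpha>" "\<alpha> < 1"
    and dens: "(\<lambda>T. real (\<Sum>h\<in>{1..n}. zero_count (F h) \<sigma>0 T)) \<in> o[at_top](\<lambda>T. T powr (1 - \<alpha>))"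
  shows "\<exists>K. \<forall>\<^sub>F T in at_top. \<forall>c. (\<forall>p. norm (c p) \<le> 1) \<longrightarrow>
    (\<exists>t\<in>{T..2*T}. \<forall>h\<in>{1..n}. F h (Complex \<sigma> t) \<noteq> 0 \<and>
       \<bar>ln (norm (F h (Complex \<sigma> t))) -
         (\<Sum>p | prime p \<and> p \<le> nat \<lfloor>\<alpha> / 10 * ln T\<rfloor>. Re (a h p * c p) * real p powr (- \<sigma>)) / 2\<bar> \<le> K)"
proof -
  define I where "I = {1..n}"
  have ex: "\<forall>h\<in>I. \<exists>d K. 0 \<le> d \<and> 0 \<le> K \<and> (\<forall>p. prime p \<longrightarrow> norm (a h p) \<le> d) \<and> (\<forall>s. Re s > 1 \<longrightarrow> F h s \<noteq> 0) \<and>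
     (\<forall>\<^sub>F T in at_top. \<forall>t\<in>{T..2*T}. (\<forall>s\<in>ball (Complex 4 t) (4 - \<sigma>0). F h s \<noteq> 0) \<longrightarrow>
       F h (Complex \<sigma> t) \<noteq> 0 \<and>
       \<bar>ln (norm (F h (Complex \<sigma> t))) - (\<Sum>p | prime p \<and> p \<le> 256 ^ cutoff T.
          Re (a h p * of_real (exp_weight (cutoff T) (4 - \<sigma>) p) / of_nat p powr (Complex \<sigma> t)))\<bar> \<le> K)"
    using poly ram unfolding I_def by (intro ballI ln_norm_approx_eventually \<sigma>) auto
  from bchoice[OF ex] obtain dh where "\<forall>h\<in>I. \<exists>K. 0 \<le> dh h \<and> 0 \<le> K \<and> (\<forall>p. prime p \<longrightarrow> norm (a h p) \<le> dh h) \<and> (\<forall>s. Re s > 1 \<longrightarrow> F h s \<noteq> 0) \<and>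
     (\<forall>\<^sub>F T in at_top. \<forall>t\<in>{T..2*T}. (\<forall>s\<in>ball (Complex 4 t) (4 - \<sigma>0). F h s \<noteq> 0) \<longrightarrow>
       F h (Complex \<sigma> t) \<noteq> 0 \<and>
       \<bar>ln (norm (F h (Complex \<sigma> t))) - (\<Sum>p | prime p \<and> p \<le> 256 ^ cutoff T.
          Re (a h p * of_real (exp_weight (cutoff T) (4 - \<sigma>) p) / of_nat p powr (Complex \<sigma> t)))\<bar> \<le> K)"
    by (elim exE)
  from bchoice[OF this] obtain Kh where data: "\<forall>h\<in>I. 0 \<le> dh h \<and> 0 \<le> Kh h \<and> (\<forall>p. prime p \<longrightarrow> norm (a h p) \<le> dh h) \<and> (\<forall>s. Re s > 1 \<longrightarrow> F h s \<noteq> 0) \<and>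
     (\<forall>\<^sub>F T in at_top. \<forall>t\<in>{T..2*T}. (\<forall>s\<in>ball (Complex 4 t) (4 - \<sigma>0). F h s \<noteq> 0) \<longrightarrow>
       F h (Complex \<sigma> t) \<noteq> 0 \<and>
       \<bar>ln (norm (F h (Complex \<sigma> t))) - (\<Sum>p | prime p \<and> p \<le> 256 ^ cutoff T.
          Re (a h p * of_real (exp_weight (cutoff T) (4 - \<sigma>) p) / of_nat p powr (Complex \<sigma> t)))\<bar> \<le> Kh h)"
    by (elim exE)
  have finI: "finite I" by (simp add: I_def)
  define d where "d = (\<Sum>h\<in>I. dh h)"
  define K where "K = (\<Sum>h\<in>I. Kh h)"
  have d0: "d \<ge> 0" unfolding d_def using data by (intro sum_nonneg) auto
  have ad: "norm (a h p) \<le> d" if "h \<in> I" "prime p" for h p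
  proof -
    have "norm (a h p) \<le> dh h" using data that by blast
    also have "dh h \<le> d" unfolding d_def using data that finI by (intro member_le_sum) auto
    finally show ?thesis .
  qed
  have KhK: "Kh h \<le> K" if "h \<in> I" for h
    unfolding K_def using data that finI by (intro member_le_sum) auto
  have nz1: "F h s \<noteq> 0" if "h \<in> I" "Re s > 1" for h s using data that by blast
  have ev: "\<forall>\<^sub>F T in at_top. \<forall>h\<in>I. \<forall>t\<in>{T..2*T}. (\<forall>s\<in>ball (Complex 4 t) (4 - \<sigma>0). F h s \<noteq> 0) \<longrightarrow>
       F h (Complex \<sigma> t) \<noteq> 0 \<and>
       \<bar>ln (norm (F h (Complex \<sigma> t))) - (\<Sum>p | prime p \<and> p \<le> 256 ^ cutoff T.
          Re (a h p * of_real (exp_weight (cutoff T) (4 - \<sigma>) p) / of_nat p powr (Complex \<sigma> t)))\<bar> \<le> Kh h"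
    using data by (intro eventually_ball_finite finI) blast
  define S where "S = (\<Sum>m. real m powr (- 2 * \<sigma>))"
  have sS: "summable (\<lambda>m. real m powr (- 2 * \<sigma>))" using \<sigma> by (simp add: summable_real_powr_iff)
  have S0: "S \<ge> 0" unfolding S_def by (intro suminf_nonneg sS) auto
  \<comment> \<open>The second moments add up to at most 8 n d^2 (S + 1) T, while the remaining mass
    is at least T / 2; the summand 1 makes the comparison strict.\<close>
  define L where "L = 16 * n * d\<^sup>2 * (S + 1) + 1"
  have L: "L > 0" using S0 by (simp add: L_def add_nonneg_pos)
  define M where "M T = real (\<Sum>h\<in>I. zero_count (F h) \<sigma>0 T)" for T
  have Mo: "M \<in> o[at_top](\<lambda>T. T powr (1 - \<alpha>))" using dens unfolding M_def I_def .
  have "\<forall>\<^sub>F T in at_top. \<forall>c. (\<forall>p. norm (c p) \<le> 1) \<longrightarrow>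
    (\<exists>t\<in>{T..2*T}. \<forall>h\<in>I. F h (Complex \<sigma> t) \<noteq> 0 \<and>
       \<bar>ln (norm (F h (Complex \<sigma> t))) -
         (\<Sum>p | prime p \<and> p \<le> nat \<lfloor>\<alpha> / 10 * ln T\<rfloor>. Re (a h p * c p) * real p powr (- \<sigma>)) / 2\<bar> \<le> K + (1 + L) + d)"
    using ev parameter_conditions[OF \<alpha> Mo]
  proof eventually_elim
    case (elim T)
    define X where "X = nat \<lfloor>\<alpha> / 10 * ln T\<rfloor>"
    define N where "N = cutoff T"
    define Z :: nat where "Z = 256 ^ N"
    have ap: "\<And>h t. h \<in> I \<Longrightarrow> t \<in> {T..2*T} \<Longrightarrow> (\<forall>s\<in>ball (Complex 4 t) (4 - \<sigma>0). F h s \<noteq> 0) \<Longrightarrow>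
       F h (Complex \<sigma> t) \<noteq> 0 \<and>
       \<bar>ln (norm (F h (Complex \<sigma> t))) - (\<Sum>p | prime p \<and> p \<le> Z.
          Re (a h p * of_real (exp_weight N (4 - \<sigma>) p) / of_nat p powr (Complex \<sigma> t)))\<bar> \<le> Kh h"
      using elim(1) unfolding N_def Z_def by blast
    have par: "T \<ge> 1" "2 * 128 ^ X \<le> T / 4" "8 * 2 ^ X * (2 + M T) \<le> T / 4"
        "real Z ^ 8 * 128 ^ X \<le> T" "real X ^ 5 \<le> 2 ^ N"
      using elim(2) unfolding X_def N_def Z_def by auto
    have XZ: "X \<le> Z"
    proof -
      have "X \<le> X ^ 5" by (cases "X = 0") (auto intro: self_le_power)
      also have "real X ^ 5 \<le> 256 ^ N" using par(5) power_mono[of 2 "256::real" N] by linarith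
      then have "real (X ^ 5) \<le> real (256 ^ N)" by simp
      then have "X ^ 5 \<le> 256 ^ N" by (simp only: of_nat_le_iff)
      finally show ?thesis by (simp add: Z_def)
    qed
    define zs where "zs h = {\<rho>. F h \<rho> = 0 \<and> T \<le> Im \<rho> \<and> Im \<rho> \<le> 2 * T \<and> Re \<rho> \<ge> \<sigma>0}" for h
    have fin_zs: "finite (zs h)" if "h \<in> I" for h
    proof -
      have "selberg_class (a h) (F h)" using poly that by (simp add: I_def selberg_poly_def)
      then show ?thesis unfolding zs_def using nz1[OF that] par by (intro finite_zeros_strip) auto
    qed
    \<comment> \<open>Zeros are counted only with imaginary part in [T, 2T]. Keeping t more than 4
      away from both endpoints leaves the disc about 4 + it inside that range; the endpoints account
      for the 2 in \<open>2 + M T\<close>.\<close>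
    define Y where "Y = {T, 2 * T} \<union> (\<Union>h\<in>I. Im ` zs h)"
    have finY: "finite Y" unfolding Y_def using finI fin_zs by auto
    have cardY: "real (card Y) \<le> 2 + M T"
    proof -
      have "card Y \<le> card {T, 2 * T} + card (\<Union>h\<in>I. Im ` zs h)" unfolding Y_def by (rule card_Un_le)
      also have "card {T, 2 * T} \<le> 2" by (simp add: card_insert_if)
      also have "card (\<Union>h\<in>I. Im ` zs h) \<le> (\<Sum>h\<in>I. card (Im ` zs h))" by (rule card_UN_le[OF finI])
      also have "\<dots> \<le> (\<Sum>h\<in>I. card (zs h))" using fin_zs by (intro sum_mono card_image_le)
      finally have "card Y \<le> 2 + (\<Sum>h\<in>I. zero_count (F h) \<sigma>0 T)" by (simp add: zero_count_def zs_def)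
      then have "real (card Y) \<le> real (2 + (\<Sum>h\<in>I. zero_count (F h) \<sigma>0 T))" by (simp only: of_nat_le_iff)
      then show ?thesis by (simp add: M_def)
    qed
    define w where "w p = exp_weight N (4 - \<sigma>) p" for p
    have w: "0 \<le> w p" "w p \<le> 1" "1 - w p \<le> real p powr (4 - \<sigma>) / 2 ^ N" if "prime p" for p
      unfolding w_def using exp_weight_bounds[of p "4 - \<sigma>" N] prime_gt_0_nat[OF that] \<sigma> by auto
    define b where "b h p = (if prime p then a h p * of_real (w p * real p powr (- \<sigma>)) else 0)" for h p
    have bn: "norm (b h p) \<le> d * real p powr (- \<sigma>)" if "h \<in> I" for h p
    proof (cases "prime p")
      case True
      have "norm (b h p) = norm (a h p) * (w p * real p powr (- \<sigma>))"
        using True w(1)[OF True] by (simp add: b_def norm_mult)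
      also have "\<dots> \<le> d * (1 * real p powr (- \<sigma>))"
        using ad[OF that True] w[OF True] d0 by (intro mult_mono) auto
      finally show ?thesis by simp
    qed (use d0 in \<open>auto simp: b_def\<close>)
    have bd: "norm (b h p) \<le> d" if "h \<in> I" for h p
    proof (cases "p = 0")
      case False
      then have "real p powr (- \<sigma>) \<le> 1" using \<sigma> powr_mono[of "-\<sigma>" 0 "real p"] by simp
      then have "d * real p powr (- \<sigma>) \<le> d * 1" using d0 by (intro mult_left_mono) auto
      then show ?thesis using bn[OF that, of p] by simp
    qed (use d0 in \<open>auto simp: b_def\<close>)
    have b2: "(\<Sum>p | prime p \<and> p \<le> Z. (norm (b h p))\<^sup>2) \<le> d\<^sup>2 * S" if "h \<in> I" for h
    proof -
      have "(\<Sum>p | prime p \<and> p \<le> Z. (norm (b h p))\<^sup>2) \<le> (\<Sum>p | prime p \<and> p \<le> Z. d\<^sup>2 * real p powr (- 2 * \<sigma>))"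
      proof (rule sum_mono)
        fix p
        have "(norm (b h p))\<^sup>2 \<le> (d * real p powr (- \<sigma>))\<^sup>2"
          using bn[OF that] by (intro power_mono) auto
        also have "\<dots> = d\<^sup>2 * real p powr (- 2 * \<sigma>)"
          by (simp add: power2_eq_square mult_ac flip: powr_add)
        finally show "(norm (b h p))\<^sup>2 \<le> d\<^sup>2 * real p powr (- 2 * \<sigma>)" .
      qed
      also have "\<dots> = d\<^sup>2 * (\<Sum>p | prime p \<and> p \<le> Z. real p powr (- 2 * \<sigma>))" by (simp add: sum_distrib_left)
      also have "\<dots> \<le> d\<^sup>2 * S"
        unfolding S_def by (intro mult_left_mono sum_le_suminf sS finite_primes_le) auto
      finally show ?thesis .
    qed
    show ?case
    proof (intro allI impI)
      fix c :: "nat \<Rightarrow> complex" assume "\<forall>p. norm (c p) \<le> 1"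
      then have c: "\<And>p. norm (c p) \<le> 1" by blast
      define W where "W h t = (\<Sum>p | prime p \<and> p \<le> Z. Re (b h p * exp (- (\<i> * of_real (ln p * t))))
         - (if p \<le> X then Re (c p * b h p) / 2 else 0))" for h t
      have "\<exists>t\<in>{T..2*T}. (\<forall>y\<in>Y. 4 < \<bar>t - y\<bar>) \<and> (\<Sum>h\<in>I. (W h t)\<^sup>2) \<le> L"
        unfolding W_def
      proof (rule exists_good_point[OF finI finY c bd _ L])
        show "0 \<le> T" using par by simp
        have "(\<Sum>h\<in>I. 8 * T * (\<Sum>p | prime p \<and> p \<le> Z. (norm (b h p))\<^sup>2) + 8 * d\<^sup>2 * real Z ^ 8 * 128 ^ X)
            \<le> (\<Sum>h\<in>I. 8 * T * (d\<^sup>2 * S) + 8 * d\<^sup>2 * T)"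
        proof (rule sum_mono)
          fix h assume h: "h \<in> I"
          have "8 * T * (\<Sum>p | prime p \<and> p \<le> Z. (norm (b h p))\<^sup>2) \<le> 8 * T * (d\<^sup>2 * S)"
            using b2[OF h] par by (intro mult_left_mono) auto
          moreover have "8 * d\<^sup>2 * (real Z ^ 8 * 128 ^ X) \<le> 8 * d\<^sup>2 * T"
            using par by (intro mult_left_mono) auto
          ultimately show "8 * T * (\<Sum>p | prime p \<and> p \<le> Z. (norm (b h p))\<^sup>2) + 8 * d\<^sup>2 * real Z ^ 8 * 128 ^ X
              \<le> 8 * T * (d\<^sup>2 * S) + 8 * d\<^sup>2 * T" by (simp add: mult.assoc)
        qed
        also have "\<dots> = n * (8 * T * (d\<^sup>2 * S) + 8 * d\<^sup>2 * T)" by (simp add: I_def)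
        also have "\<dots> < L * (T / 2)" using par by (simp add: L_def field_simps)
        also have "\<dots> \<le> L * (T - 2 * 128 ^ X - 8 * 2 ^ X * real (card Y))"
        proof (rule mult_left_mono)
          have "8 * 2 ^ X * real (card Y) \<le> 8 * 2 ^ X * (2 + M T)"
            using cardY by (intro mult_left_mono) auto
          then show "T / 2 \<le> T - 2 * 128 ^ X - 8 * 2 ^ X * real (card Y)" using par by linarith
        qed (use L in simp)
        finally show "(\<Sum>h\<in>I. 8 * T * (\<Sum>p | prime p \<and> p \<le> Z. (norm (b h p))\<^sup>2) + 8 * d\<^sup>2 * real Z ^ 8 * 128 ^ X)
            < L * (T - 2 * 128 ^ X - 8 * 2 ^ X * real (card Y))" .
      qed
      then obtain t where t: "t \<in> {T..2*T}" "\<And>y. y \<in> Y \<Longrightarrow> 4 < \<bar>t - y\<bar>" "(\<Sum>h\<in>I. (W h t)\<^sup>2) \<le> L"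
        by blast
      show "\<exists>t\<in>{T..2*T}. \<forall>h\<in>I. F h (Complex \<sigma> t) \<noteq> 0 \<and>
         \<bar>ln (norm (F h (Complex \<sigma> t))) -
         (\<Sum>p | prime p \<and> p \<le> nat \<lfloor>\<alpha> / 10 * ln T\<rfloor>. Re (a h p * c p) * real p powr (- \<sigma>)) / 2\<bar> \<le> K + (1 + L) + d"
      proof (intro bexI[OF _ t(1)] ballI)
        fix h assume h: "h \<in> I"
        have "\<forall>s\<in>ball (Complex 4 t) (4 - \<sigma>0). F h s \<noteq> 0"
        proof (intro ballI notI)
          fix s assume s: "s \<in> ball (Complex 4 t) (4 - \<sigma>0)" and zero: "F h s = 0"
          have "\<bar>Re (Complex 4 t - s)\<bar> < 4 - \<sigma>0" "\<bar>Im (Complex 4 t - s)\<bar> < 4 - \<sigma>0"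
            using s abs_Re_le_cmod[of "Complex 4 t - s"] abs_Im_le_cmod[of "Complex 4 t - s"]
            by (auto simp: dist_norm)
          then have re: "Re s \<ge> \<sigma>0" and im: "\<bar>t - Im s\<bar> < 4" using \<sigma> by auto
          have "4 < \<bar>t - T\<bar>" "4 < \<bar>t - 2 * T\<bar>" using t(2) by (auto simp: Y_def)
          then have "T \<le> Im s" "Im s \<le> 2 * T" using t(1) im by auto
          then have "Im s \<in> Y" using re zero h by (auto simp: Y_def zs_def)
          then show False using t(2) im by fastforce
        qed
        from ap[OF h t(1) this] have nzF: "F h (Complex \<sigma> t) \<noteq> 0" and
          A: "\<bar>ln (norm (F h (Complex \<sigma> t))) - (\<Sum>p | prime p \<and> p \<le> Z.
            Re (a h p * of_real (w p) / of_nat p powr (Complex \<sigma> t)))\<bar> \<le> Kh h"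
          unfolding w_def by auto
        have e1: "(\<Sum>p | prime p \<and> p \<le> Z. Re (a h p * of_real (w p) / of_nat p powr (Complex \<sigma> t))) =
            (\<Sum>p | prime p \<and> p \<le> Z. Re (b h p * exp (- (\<i> * of_real (ln p * t)))))"
        proof (rule sum.cong[OF refl])
          fix p assume p: "p \<in> {p. prime p \<and> p \<le> Z}"
          then have "p > 0" using prime_gt_0_nat by auto
          then show "Re (a h p * of_real (w p) / of_nat p powr (Complex \<sigma> t)) = Re (b h p * exp (- (\<i> * of_real (ln p * t))))"
            unfolding prime_powr_Complex[OF \<open>p > 0\<close>] using p by (simp only: b_def mem_Collect_eq if_True)
        qed
        define G where "G = (\<Sum>p | prime p \<and> p \<le> X. Re (c p * b h p) / 2)"
        have e2: "(\<Sum>p | prime p \<and> p \<le> Z. if p \<le> X then Re (c p * b h p) / 2 else 0) = G"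
        proof -
          have "{p. prime p \<and> p \<le> X} = {p\<in>{p. prime p \<and> p \<le> Z}. p \<le> X}" using XZ by auto
          then show ?thesis unfolding G_def by (simp only: sum.inter_filter[OF finite_primes_le])
        qed
        have We: "W h t = (\<Sum>p | prime p \<and> p \<le> Z. Re (b h p * exp (- (\<i> * of_real (ln p * t))))) - G"
          unfolding W_def sum_subtractf e2 ..
        have "(W h t)\<^sup>2 \<le> (\<Sum>h\<in>I. (W h t)\<^sup>2)" using h finI by (intro member_le_sum) auto
        then have "(W h t)\<^sup>2 \<le> L" using t(3) by linarith
        moreover have "\<bar>W h t\<bar> \<le> 1 + (W h t)\<^sup>2"
        proof -
          have "0 \<le> (\<bar>W h t\<bar> - 1)\<^sup>2" by simp
          then have "2 * \<bar>W h t\<bar> \<le> 1 + (W h t)\<^sup>2" by (simp add: power2_diff)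
          then show ?thesis by linarith
        qed
        ultimately have B: "\<bar>W h t\<bar> \<le> 1 + L" by linarith
        define G' where "G' = (\<Sum>p | prime p \<and> p \<le> X. Re (a h p * c p) * real p powr (- \<sigma>)) / 2"
        \<comment> \<open>Replacing the weight \<open>w p\<close> by 1 costs at most d * X^4 / 2^N
          for each of at most X primes, and X^5 \<le> 2^N.\<close>
        have C: "\<bar>G - G'\<bar> \<le> d"
        proof -
          have term_le: "\<bar>Re (c p * b h p) / 2 - Re (a h p * c p) * real p powr (- \<sigma>) / 2\<bar> \<le> d * (real X ^ 4 / 2 ^ N)"
            if p: "p \<in> {p. prime p \<and> p \<le> X}" for p
          proof -
            have pp: "prime p" "p \<le> X" "p \<ge> 1" using p prime_ge_1_nat by auto
            have "c p * b h p = (a h p * c p) * of_real (w p * real p powr (- \<sigma>))"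
              using pp by (simp add: b_def mult_ac)
            moreover have "Re (z * of_real x) = Re z * x" for z x by simp
            ultimately have "Re (c p * b h p) = Re (a h p * c p) * (w p * real p powr (- \<sigma>))"
              by (simp only:)
            then have "Re (c p * b h p) / 2 - Re (a h p * c p) * real p powr (- \<sigma>) / 2 =
                - (Re (a h p * c p) * ((1 - w p) * real p powr (- \<sigma>)) / 2)"
              by (simp only:) (simp add: field_simps)
            then have "\<bar>Re (c p * b h p) / 2 - Re (a h p * c p) * real p powr (- \<sigma>) / 2\<bar> =
                \<bar>Re (a h p * c p)\<bar> * ((1 - w p) * real p powr (- \<sigma>)) / 2"
              using w(2)[OF pp(1)] by (simp only: abs_minus_cancel abs_divide abs_mult) simp
            also have "\<dots> \<le> d * (real X ^ 4 / 2 ^ N)"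
            proof -
              have r1: "\<bar>Re (a h p * c p)\<bar> \<le> d"
              proof -
                have "\<bar>Re (a h p * c p)\<bar> \<le> norm (a h p) * norm (c p)"
                  using abs_Re_le_cmod[of "a h p * c p"] by (simp only: norm_mult)
                also have "\<dots> \<le> d * 1" using ad[OF h pp(1)] c d0 by (intro mult_mono) auto
                finally show ?thesis by simp
              qed
              have "real p powr (- \<sigma>) \<le> 1" using pp \<sigma> powr_mono[of "-\<sigma>" 0 "real p"] by simp
              then have "(1 - w p) * real p powr (- \<sigma>) \<le> (1 - w p) * 1"
                using w(2)[OF pp(1)] by (intro mult_left_mono) auto
              also have "\<dots> \<le> real p powr (4 - \<sigma>) / 2 ^ N" using w(3)[OF pp(1)] by simp
              also have "real p powr (4 - \<sigma>) \<le> real X ^ 4"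
              proof -
                have "real p powr (4 - \<sigma>) \<le> real p powr 4" using pp \<sigma> by (intro powr_mono) auto
                also have "\<dots> = real p ^ 4" using pp by (simp add: powr_numeral)
                also have "\<dots> \<le> real X ^ 4" using pp by (intro power_mono) auto
                finally show ?thesis .
              qed
              finally have "(1 - w p) * real p powr (- \<sigma>) \<le> real X ^ 4 / 2 ^ N"
                by (simp add: divide_right_mono)
              then have "\<bar>Re (a h p * c p)\<bar> * ((1 - w p) * real p powr (- \<sigma>)) \<le> d * (real X ^ 4 / 2 ^ N)"
                using r1 d0 w(2)[OF pp(1)] by (intro mult_mono) auto
              moreover have "0 \<le> d * (real X ^ 4 / 2 ^ N)" using d0 by simp
              ultimately show ?thesis by linarith
            qed
            finally show ?thesis .
          qed
          have "\<bar>G - G'\<bar> = \<bar>\<Sum>p | prime p \<and> p \<le> X. Re (c p * b h p) / 2 - Re (a h p * c p) * real p powr (- \<sigma>) / 2\<bar>"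
            unfolding G_def G'_def sum_subtractf sum_divide_distrib ..
          also have "\<dots> \<le> (\<Sum>p | prime p \<and> p \<le> X. d * (real X ^ 4 / 2 ^ N))"
            by (rule order_trans[OF sum_abs sum_mono]) (rule term_le)
          also have "\<dots> = real (card {p. prime p \<and> p \<le> X}) * (d * (real X ^ 4 / 2 ^ N))" by simp
          also have "\<dots> \<le> real X * (d * (real X ^ 4 / 2 ^ N))"
            using card_primes_le[of X] d0 by (intro mult_right_mono) auto
          also have "\<dots> = d * (real X ^ 5 / 2 ^ N)" by (simp add: power_Suc[of _ 4, simplified] mult_ac)
          also have "\<dots> \<le> d * 1" using d0 par(5) by (intro mult_left_mono) auto
          finally show ?thesis by simp
        qed
        have "\<bar>ln (norm (F h (Complex \<sigma> t))) - G'\<bar> \<le> K + (1 + L) + d"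
          using A B C KhK[OF h] unfolding We e1 by linarith
        then show "F h (Complex \<sigma> t) \<noteq> 0 \<and> \<bar>ln (norm (F h (Complex \<sigma> t))) -
           (\<Sum>p | prime p \<and> p \<le> nat \<lfloor>\<alpha> / 10 * ln T\<rfloor>. Re (a h p * c p) * real p powr (- \<sigma>)) / 2\<bar> \<le> K + (1 + L) + d"
          using nzF unfolding G'_def X_def by blast
      qed
    qed
  qed
  then show ?thesis unfolding I_def by blast
qed

section \<open>Choice of the phases\<close>

lemma prime_coefficients_bounded:
  assumes "selberg_poly a f" "ramanujan a"
  shows "\<exists>d\<ge>0. \<forall>p. prime p \<longrightarrow> norm (a p) \<le> d"
  \<comment> \<open>Any admissible pair of abscissas would do; the bound on the coefficients does
    not depend on it.\<close>
  using ln_norm_approx_eventually[OF assms, of "3/4" "4/5"] by auto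

definition resonator_sign :: "nat \<Rightarrow> nat \<Rightarrow> real" where
  "resonator_sign H h = (if h \<le> H then 1 else -1)"

lemma big_values_mono:
  assumes "big_values F H G \<sigma> T V" "V' \<le> V"
  shows "big_values F H G \<sigma> T V'"
proof -
  from assms(1) obtain t where t: "t \<in> {T..2*T}" "\<forall>h\<in>{1..H}. norm (F h (Complex \<sigma> t)) \<ge> V"
    "G = 0 \<or> (\<exists>h\<in>{H+1..H+G}. norm (F h (Complex \<sigma> t)) * V \<le> 1)"
    unfolding big_values_def by blast
  have "norm w * V' \<le> 1" if "norm w * V \<le> 1" for w :: complex
    using mult_left_mono[OF assms(2), of "norm w"] that by auto
  then show ?thesis using t assms(2) unfolding big_values_def
    by (intro bexI[of _ t]) (auto intro: order_trans)
qed

text \<open>With phases proportional to a signed sum of conjugate coefficients, Re (a_h(p) c_p)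
  becomes q * \<omega> / \<Delta>. The weight \<omega> is left open because \<sigma> < 1 and
  \<sigma> = 1 need different ones to make the prime sum accessible to the hypothesis on a_h(p) cnj
  (a_g(p)).\<close>

lemma big_values_from_weights:
  fixes H G :: nat and a :: "nat \<Rightarrow> nat \<Rightarrow> complex" and F :: "nat \<Rightarrow> complex \<Rightarrow> complex"
    and \<sigma>0 \<sigma> \<alpha> \<Delta> :: real and \<omega> :: "nat \<Rightarrow> nat \<Rightarrow> real" and B :: "nat \<Rightarrow> real"
  defines "\<epsilon> \<equiv> resonator_sign H"
  defines "q \<equiv> \<lambda>h p. Re (a h p * (\<Sum>g\<in>{1..H+G}. of_real (\<epsilon> g) * cnj (a g p)))"
  assumes poly: "\<forall>h\<in>{1..H+G}. selberg_poly (a h) (F h)" and ram: "\<forall>h\<in>{1..H+G}. ramanujan (a h)"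
    and \<sigma>: "1/2 < \<sigma>0" "\<sigma>0 < \<sigma>" "\<sigma> \<le> 1" and \<alpha>: "0 < \<alpha>" "\<alpha> < 1"
    and dens: "(\<lambda>T. real (\<Sum>h\<in>{1..H+G}. zero_count (F h) \<sigma>0 T)) \<in> o[at_top](\<lambda>T. T powr (1 - \<alpha>))"
    and \<Delta>: "\<Delta> > 0" "\<And>p. prime p \<Longrightarrow> norm (\<Sum>g\<in>{1..H+G}. of_real (\<epsilon> g) * cnj (a g p)) \<le> \<Delta>"
    and \<omega>: "\<And>X p. 0 \<le> \<omega> X p" "\<And>X p. \<omega> X p \<le> 1"
    and low: "\<forall>\<^sub>F X in at_top. \<forall>h\<in>{1..H+G}.
       B X \<le> \<epsilon> h * (\<Sum>p | prime p \<and> p \<le> X. q h p * (\<omega> X p * real p powr (- \<sigma>)))"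
  shows "\<exists>K. \<forall>\<^sub>F T in at_top. big_values F H G \<sigma> T (exp (B (nat \<lfloor>\<alpha> / 10 * ln T\<rfloor>) / (2 * \<Delta>) - K))"
proof -
  obtain K where K: "\<forall>\<^sub>F T in at_top. \<forall>c. (\<forall>p. norm (c p) \<le> 1) \<longrightarrow>
    (\<exists>t\<in>{T..2*T}. \<forall>h\<in>{1..H+G}. F h (Complex \<sigma> t) \<noteq> 0 \<and>
       \<bar>ln (norm (F h (Complex \<sigma> t))) -
         (\<Sum>p | prime p \<and> p \<le> nat \<lfloor>\<alpha> / 10 * ln T\<rfloor>. Re (a h p * c p) * real p powr (- \<sigma>)) / 2\<bar> \<le> K)"
    using simultaneous_values[OF poly ram \<sigma> \<alpha> dens] by (elim exE)
  have "filterlim (\<lambda>T. nat \<lfloor>\<alpha> / 10 * ln T\<rfloor>) at_top at_top"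
  proof -
    have "filterlim (\<lambda>T. \<alpha> / 10 * ln T) at_top at_top" using \<alpha> by real_asymp
    then show ?thesis
      by (intro filterlim_compose[OF filterlim_nat_sequentially] filterlim_compose[OF filterlim_floor_sequentially])
  qed
  from eventually_compose_filterlim[OF low this] K
  have "\<forall>\<^sub>F T in at_top. big_values F H G \<sigma> T (exp (B (nat \<lfloor>\<alpha> / 10 * ln T\<rfloor>) / (2 * \<Delta>) - K))"
  proof eventually_elim
    case (elim T)
    define X where "X = nat \<lfloor>\<alpha> / 10 * ln T\<rfloor>"
    \<comment> \<open>Division by \<Delta> ensures |c_p| \<le> 1. The weight depends on X, hence the
      phases depend on T.\<close>
    define c where "c p = (if prime p then of_real (\<omega> X p / \<Delta>) * (\<Sum>g\<in>{1..H+G}. of_real (\<epsilon> g) * cnj (a g p)) else 0)" for p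
    have "norm (c p) \<le> 1" for p
    proof (cases "prime p")
      case True
      have "norm (c p) = \<omega> X p / \<Delta> * norm (\<Sum>g\<in>{1..H+G}. of_real (\<epsilon> g) * cnj (a g p))"
        unfolding c_def norm_mult using True \<omega>(1)[of X p] \<Delta> by (simp add: norm_mult norm_divide)
      also have "\<dots> \<le> 1 / \<Delta> * \<Delta>"
        using \<omega>[where X = X and p = p] \<Delta> True by (intro mult_mono divide_right_mono) auto
      finally show ?thesis using \<Delta> by simp
    qed (simp add: c_def)
    then obtain t where t: "t \<in> {T..2*T}" and th: "\<And>h. h \<in> {1..H+G} \<Longrightarrow> F h (Complex \<sigma> t) \<noteq> 0 \<and>
       \<bar>ln (norm (F h (Complex \<sigma> t))) - (\<Sum>p | prime p \<and> p \<le> X. Re (a h p * c p) * real p powr (- \<sigma>)) / 2\<bar> \<le> K"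
      using elim(2)[rule_format, of c] unfolding X_def by blast
    define A where "A h = (\<Sum>p | prime p \<and> p \<le> X. q h p * (\<omega> X p * real p powr (- \<sigma>)))" for h
    have sumA: "(\<Sum>p | prime p \<and> p \<le> X. Re (a h p * c p) * real p powr (- \<sigma>)) / 2 = A h / (2 * \<Delta>)" for h
    proof -
      have "Re (a h p * c p) * real p powr (- \<sigma>) = q h p * (\<omega> X p * real p powr (- \<sigma>)) / \<Delta>"
        if "p \<in> {p. prime p \<and> p \<le> X}" for p
      proof -
        have e: "a h p * c p = of_real (\<omega> X p / \<Delta>) * (a h p * (\<Sum>g\<in>{1..H+G}. of_real (\<epsilon> g) * cnj (a g p)))"
          using that by (simp only: c_def mem_Collect_eq if_True mult_ac)
        have "Re (of_real x * z) = x * Re z" for x z by simp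
        then have "Re (a h p * c p) = \<omega> X p / \<Delta> * q h p" unfolding e q_def by (simp only:)
        then show ?thesis by (simp only:) simp
      qed
      then have "(\<Sum>p | prime p \<and> p \<le> X. Re (a h p * c p) * real p powr (- \<sigma>)) = A h / \<Delta>"
        unfolding A_def sum_divide_distrib by (intro sum.cong refl)
      then show ?thesis by simp
    qed
    have AB: "B X \<le> \<epsilon> h * A h" if "h \<in> {1..H+G}" for h
      using elim(1) that unfolding A_def X_def by blast
    define V where "V = B X / (2 * \<Delta>) - K"
    have AV: "V + K \<le> \<epsilon> h * (A h / (2 * \<Delta>))" if "h \<in> {1..H+G}" for h
      using divide_right_mono[OF AB[OF that], of "2 * \<Delta>"] \<Delta> by (simp add: V_def)
    have "big_values F H G \<sigma> T (exp V)"
      unfolding big_values_def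
    proof (intro bexI[OF _ t] conjI ballI)
      fix h assume h: "h \<in> {1..H}"
      then have h': "h \<in> {1..H+G}" by auto
      have "V \<le> ln (norm (F h (Complex \<sigma> t)))"
        using AV[OF h'] th[OF h'] h unfolding sumA by (auto simp: \<epsilon>_def resonator_sign_def abs_le_iff)
      then have "exp V \<le> exp (ln (norm (F h (Complex \<sigma> t))))" by simp
      then show "exp V \<le> norm (F h (Complex \<sigma> t))" using th[OF h'] by simp
    next
      \<comment> \<open>In fact every function with index above H is small at t; the maximum of the
        reciprocals needs only one of them.\<close>
      have "norm (F (H + 1) (Complex \<sigma> t)) * exp V \<le> 1" if "G \<noteq> 0"
      proof -
        have h': "H + 1 \<in> {1..H+G}" using that by auto
        have "ln (norm (F (H + 1) (Complex \<sigma> t))) \<le> - V"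
          using AV[OF h'] th[OF h'] unfolding sumA by (auto simp: \<epsilon>_def resonator_sign_def abs_le_iff)
        then have "exp (ln (norm (F (H + 1) (Complex \<sigma> t)))) \<le> exp (- V)" by simp
        moreover have "norm (F (H + 1) (Complex \<sigma> t)) > 0" using th[OF h', THEN conjunct1] by simp
        ultimately have "norm (F (H + 1) (Complex \<sigma> t)) \<le> exp (- V)" by (simp only: exp_ln)
        then have "norm (F (H + 1) (Complex \<sigma> t)) * exp V \<le> exp (- V) * exp V"
          by (rule mult_right_mono) simp
        then show ?thesis by (simp flip: exp_add)
      qed
      then show "G = 0 \<or> (\<exists>h\<in>{H + 1..H + G}. norm (F h (Complex \<sigma> t)) * exp V \<le> 1)"
        by (cases "G = 0") (auto intro!: bexI[of _ "H + 1"])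
    qed
    then show ?case unfolding V_def X_def .
  qed
  then show ?thesis ..
qed

text \<open>The weight (p / X)^\<sigma> replaces p^(-\<sigma>) by the constant X^(-\<sigma>), so the
  asymptotics of the plain sum is used at the single point X and partial summation is avoided. As q
  may take both signs, a comparison term by term would not be available.\<close>

lemma sum_power_weight_lower:
  fixes q :: "nat \<Rightarrow> real" and k :: real
  assumes lim: "((\<lambda>x::real. ln x / x * (\<Sum>p | prime p \<and> real p \<le> x. q p)) \<longlongrightarrow> k) at_top" and k: "k > 0"
  shows "\<forall>\<^sub>F X::nat in at_top. k / 2 * real X powr (1 - \<sigma>) / ln (real X) \<le>
     (\<Sum>p | prime p \<and> p \<le> X. q p * ((real p / real X) powr \<sigma> * real p powr (- \<sigma>)))"
proof -
  have "\<forall>\<^sub>F x::real in at_top. k / 2 < ln x / x * (\<Sum>p | prime p \<and> real p \<le> x. q p)"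
    using order_tendstoD(1)[OF lim, of "k / 2"] k by simp
  then have "\<forall>\<^sub>F X::nat in at_top. k / 2 < ln (real X) / real X * (\<Sum>p | prime p \<and> real p \<le> real X. q p)"
    using filterlim_real_sequentially by (rule eventually_compose_filterlim)
  then show ?thesis using eventually_ge_at_top[of 2]
  proof eventually_elim
    case (elim X)
    have X: "real X > 0" "ln (real X) > 0" using elim(2) by auto
    have "(\<Sum>p | prime p \<and> p \<le> X. q p * ((real p / real X) powr \<sigma> * real p powr (- \<sigma>))) =
        (\<Sum>p | prime p \<and> p \<le> X. q p * real X powr (- \<sigma>))"
    proof (rule sum.cong[OF refl])
      fix p assume "p \<in> {p. prime p \<and> p \<le> X}"
      then have "real p > 0" using prime_gt_0_nat by auto
      then show "q p * ((real p / real X) powr \<sigma> * real p powr (- \<sigma>)) = q p * real X powr (- \<sigma>)"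
        using X by (simp add: powr_divide powr_minus field_simps)
    qed
    also have "\<dots> = (\<Sum>p | prime p \<and> p \<le> X. q p) * real X powr (- \<sigma>)" by (simp add: sum_distrib_right)
    finally have e: "(\<Sum>p | prime p \<and> p \<le> X. q p * ((real p / real X) powr \<sigma> * real p powr (- \<sigma>))) =
       (\<Sum>p | prime p \<and> p \<le> X. q p) * real X powr (- \<sigma>)" .
    have "k / 2 * real X / ln (real X) \<le> (\<Sum>p | prime p \<and> p \<le> X. q p)"
      using elim(1) X by (simp add: field_simps)
    then have "k / 2 * real X / ln (real X) * real X powr (- \<sigma>) \<le> (\<Sum>p | prime p \<and> p \<le> X. q p) * real X powr (- \<sigma>)"
      by (rule mult_right_mono) simp
    moreover have "real X powr (1 - \<sigma>) = real X * real X powr (- \<sigma>)"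
      using X powr_add[of "real X" 1 "- \<sigma>"] by simp
    ultimately show ?case unfolding e by simp
  qed
qed

section \<open>Dyadic blocks of primes for the line \<sigma> = 1\<close>

definition dyadic_index :: "nat \<Rightarrow> nat" where
  "dyadic_index p = (LEAST m. p \<le> 2 ^ m)"

lemma dyadic_index_le: "p \<le> 2 ^ dyadic_index p"
proof -
  have "p \<le> 2 ^ p" by (rule less_imp_le[OF less_exp])
  then show ?thesis unfolding dyadic_index_def by (rule LeastI)
qed

lemma dyadic_index_le_iff: "dyadic_index p \<le> m \<longleftrightarrow> p \<le> 2 ^ m"
proof
  assume "dyadic_index p \<le> m"
  then have "(2::nat) ^ dyadic_index p \<le> 2 ^ m" by (intro power_increasing) auto
  then show "p \<le> 2 ^ m" using dyadic_index_le[of p] by linarith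
next
  assume "p \<le> 2 ^ m"
  then show "dyadic_index p \<le> m" unfolding dyadic_index_def by (rule Least_le)
qed

text \<open>The weight turns \<open>1/p\<close> into a constant on each dyadic block, which replaces partial summation.\<close>

definition dyadic_weight :: "nat \<Rightarrow> nat \<Rightarrow> nat \<Rightarrow> real" where
  "dyadic_weight m0 X p = (if m0 < dyadic_index p \<and> 2 ^ dyadic_index p \<le> X then real p / 2 ^ dyadic_index p else 0)"

lemma dyadic_weight_bounds: "0 \<le> dyadic_weight m0 X p" "dyadic_weight m0 X p \<le> 1"
proof -
  have "real p \<le> real (2 ^ dyadic_index p)" unfolding of_nat_le_iff by (rule dyadic_index_le)
  then show "0 \<le> dyadic_weight m0 X p" "dyadic_weight m0 X p \<le> 1"
    by (auto simp: dyadic_weight_def)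
qed

text \<open>On the block of index m the weighted term is q p / 2^m, so the block contributes a
  difference of partial sums over 2^m, at least k / (8 m). Summing over the complete blocks m0 < m
  \<le> M gives log M, which has the size of log log X. The threshold m0 is uniform in M and X, so
  it can be fixed before T varies.\<close>

lemma sum_dyadic_weight_lower:
  fixes q :: "nat \<Rightarrow> real" and k :: real
  assumes lim: "((\<lambda>x::real. ln x / x * (\<Sum>p | prime p \<and> real p \<le> x. q p)) \<longlongrightarrow> k) at_top" and k: "k > 0"
  shows "\<forall>\<^sub>F m0 in at_top. \<forall>M X. 2 ^ M \<le> X \<longrightarrow> X < 2 ^ (M + 1) \<longrightarrow>
     k / 8 * (ln (real M + 1) - ln (real m0 + 1)) \<le>
     (\<Sum>p | prime p \<and> p \<le> X. q p * (dyadic_weight m0 X p * real p powr (- 1)))"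
proof -
  define A where "A m = (\<Sum>p | prime p \<and> p \<le> 2 ^ m. q p)" for m :: nat
  have pl: "filterlim (\<lambda>m::nat. (2::real) ^ m) at_top sequentially" by real_asymp
  \<comment> \<open>Since q may change sign, a block is accessible only as a difference of partial
    sums, and both sides of the limit are needed. With tolerance 1/8 and m \<ge> 8, so that m - 1
    \<ge> 7/8 * m, there remains 7/8 - 9/14 > 1/8.\<close>
  have "\<forall>\<^sub>F x::real in at_top. 7/8 * k < ln x / x * (\<Sum>p | prime p \<and> real p \<le> x. q p)"
    "\<forall>\<^sub>F x::real in at_top. ln x / x * (\<Sum>p | prime p \<and> real p \<le> x. q p) < 9/8 * k"
    by (intro order_tendstoD[OF lim]; use k in simp)+
  then have "\<forall>\<^sub>F x::real in at_top. 7/8 * k < ln x / x * (\<Sum>p | prime p \<and> real p \<le> x. q p) \<and>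
      ln x / x * (\<Sum>p | prime p \<and> real p \<le> x. q p) < 9/8 * k"
    by eventually_elim auto
  from eventually_compose_filterlim[OF this pl]
  have "\<forall>\<^sub>F m::nat in at_top. 7/8 * k < ln (2 ^ m) / 2 ^ m * (\<Sum>p | prime p \<and> real p \<le> 2 ^ m. q p) \<and>
      ln (2 ^ m) / 2 ^ m * (\<Sum>p | prime p \<and> real p \<le> 2 ^ m. q p) < 9/8 * k" .
  then obtain m1 where m1: "\<And>m. m \<ge> m1 \<Longrightarrow> 7/8 * k < ln (2 ^ m) / 2 ^ m * (\<Sum>p | prime p \<and> real p \<le> 2 ^ m. q p) \<and>
      ln (2 ^ m) / 2 ^ m * (\<Sum>p | prime p \<and> real p \<le> 2 ^ m. q p) < 9/8 * k"
    unfolding eventually_sequentially by blast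
  have "real p \<le> 2 ^ m \<longleftrightarrow> p \<le> 2 ^ m" for p m :: nat
    by (metis of_nat_le_iff of_nat_numeral of_nat_power)
  then have Aeq: "(\<Sum>p | prime p \<and> real p \<le> 2 ^ m. q p) = A m" for m by (simp only: A_def)
  have bnd: "7/8 * k / (m * ln 2) \<le> A m / 2 ^ m" "A m / 2 ^ m \<le> 9/8 * k / (m * ln 2)" if "m \<ge> m1" "m \<ge> 1" for m
  proof -
    have l: "ln (2 ^ m :: real) = m * ln 2" by (rule ln_realpow)
    have pos: "real m * ln 2 > 0" using that by simp
    have "7/8 * k \<le> (m * ln 2) * (A m / 2 ^ m)" "(m * ln 2) * (A m / 2 ^ m) \<le> 9/8 * k"
      using m1[OF that(1)] unfolding Aeq l by (auto simp: mult_ac)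
    then show "7/8 * k / (m * ln 2) \<le> A m / 2 ^ m" "A m / 2 ^ m \<le> 9/8 * k / (m * ln 2)"
      using pos by (simp_all add: pos_divide_le_eq pos_le_divide_eq mult.commute)
  qed
  have step: "k / 8 * (1 / real m) \<le> (A m - A (m - 1)) / 2 ^ m" if "m \<ge> m1 + 8" for m
  proof -
    have m: "m - 1 \<ge> m1" "m - 1 \<ge> 1" "m \<ge> m1" "m \<ge> 1" "m \<ge> 8" using that by auto
    have "A (m - 1) / 2 ^ m = (A (m - 1) / 2 ^ (m - 1)) / 2"
      using m by (cases m) auto
    also have "\<dots> \<le> (9/8 * k / (real (m - 1) * ln 2)) / 2" using bnd(2)[OF m(1,2)] by simp
    also have "\<dots> \<le> (9/8 * k / (7/8 * real m * ln 2)) / 2"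
      using m k by (intro divide_right_mono divide_left_mono mult_right_mono mult_pos_pos) auto
    finally have up: "A (m - 1) / 2 ^ m \<le> (9/8 * k / (7/8 * real m * ln 2)) / 2" .
    have "k / 8 * (1 / real m) \<le> k / 8 * (1 / (real m * ln 2))"
      using m k ln2_le_25_over_36 by (intro mult_left_mono divide_left_mono) (auto simp: mult_le_cancel_left2)
    also have "\<dots> \<le> 7/8 * k / (m * ln 2) - (9/8 * k / (7/8 * real m * ln 2)) / 2"
    proof -
      define y where "y = k / (real m * ln 2)"
      have "y \<ge> 0" using k by (simp add: y_def)
      moreover have "k / 8 * (1 / (real m * ln 2)) = y / 8" "7/8 * k / (m * ln 2) = 7/8 * y"
         "(9/8 * k / (7/8 * real m * ln 2)) / 2 = 9/14 * y"
        by (simp_all add: y_def field_simps)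
      ultimately show ?thesis by simp
    qed
    also have "\<dots> \<le> A m / 2 ^ m - A (m - 1) / 2 ^ m" using bnd(1)[OF m(3,4)] up by linarith
    finally show ?thesis by (simp add: diff_divide_distrib)
  qed
  have "k / 8 * (ln (real M + 1) - ln (real m0 + 1)) \<le>
     (\<Sum>p | prime p \<and> p \<le> X. q p * (dyadic_weight m0 X p * real p powr (- 1)))"
    if m0: "m0 \<ge> m1 + 8" and X: "2 ^ M \<le> X" "X < 2 ^ (M + 1)" for m0 M X
  proof -
    define S where "S = {p. prime p \<and> m0 < dyadic_index p \<and> dyadic_index p \<le> M}"
    have iM: "2 ^ dyadic_index p \<le> X \<longleftrightarrow> dyadic_index p \<le> M" for p
    proof
      assume "2 ^ dyadic_index p \<le> X"
      then have "(2::nat) ^ dyadic_index p < 2 ^ (M + 1)" using X by linarith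
      then have "dyadic_index p < M + 1" by (rule power_less_imp_less_exp[rotated]) simp
      then show "dyadic_index p \<le> M" by simp
    next
      assume "dyadic_index p \<le> M"
      then have "(2::nat) ^ dyadic_index p \<le> 2 ^ M" by (intro power_increasing) auto
      then show "2 ^ dyadic_index p \<le> X" using X by linarith
    qed
    have SX: "S \<subseteq> {p. prime p \<and> p \<le> X}"
      using X(1) by (auto simp: S_def dyadic_index_le_iff)
    have finS: "finite S" by (rule finite_subset[OF SX finite_primes_le])
    have "(\<Sum>p | prime p \<and> p \<le> X. q p * (dyadic_weight m0 X p * real p powr (- 1))) =
        (\<Sum>p\<in>S. q p * (dyadic_weight m0 X p * real p powr (- 1)))"
      using SX by (intro sum.mono_neutral_right) (auto simp: S_def dyadic_weight_def iM)
    also have "\<dots> = (\<Sum>p\<in>S. q p / 2 ^ dyadic_index p)"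
    proof (rule sum.cong[OF refl])
      fix p assume p: "p \<in> S"
      then have "real p > 0" using prime_gt_0_nat by (auto simp: S_def)
      then show "q p * (dyadic_weight m0 X p * real p powr (- 1)) = q p / 2 ^ dyadic_index p"
        using p by (simp add: S_def dyadic_weight_def iM powr_minus field_simps)
    qed
    also have "\<dots> = (\<Sum>m\<in>{m0<..M}. \<Sum>p\<in>{p\<in>S. dyadic_index p = m}. q p / 2 ^ dyadic_index p)"
      by (rule sum.group[symmetric]) (use finS in \<open>auto simp: S_def\<close>)
    also have "\<dots> = (\<Sum>m\<in>{m0<..M}. (A m - A (m - 1)) / 2 ^ m)"
    proof (rule sum.cong[OF refl])
      fix m assume m: "m \<in> {m0<..M}"
      have di: "dyadic_index p = m \<longleftrightarrow> p \<le> 2 ^ m \<and> \<not> p \<le> 2 ^ (m - 1)" for p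
        using m unfolding dyadic_index_le_iff[symmetric] by auto
      have "{p\<in>S. dyadic_index p = m} = {p. prime p \<and> dyadic_index p = m}"
        using m by (auto simp: S_def)
      also have "\<dots> = {p. prime p \<and> p \<le> 2 ^ m} - {p. prime p \<and> p \<le> 2 ^ (m - 1)}"
        unfolding di by blast
      finally have "{p\<in>S. dyadic_index p = m} = {p. prime p \<and> p \<le> 2 ^ m} - {p. prime p \<and> p \<le> 2 ^ (m - 1)}" .
      moreover have "{p::nat. prime p \<and> p \<le> 2 ^ (m - 1)} \<subseteq> {p. prime p \<and> p \<le> 2 ^ m}"
      proof -
        have "(2::nat) ^ (m - 1) \<le> 2 ^ m" by (intro power_increasing) auto
        then have "p \<le> 2 ^ m" if "p \<le> 2 ^ (m - 1)" for p :: nat using that by (rule order_trans[rotated])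
        then show ?thesis by blast
      qed
      ultimately have "(\<Sum>p\<in>{p\<in>S. dyadic_index p = m}. q p) = A m - A (m - 1)"
        unfolding A_def by (simp add: sum_diff)
      moreover have "(\<Sum>p\<in>{p\<in>S. dyadic_index p = m}. q p / 2 ^ dyadic_index p) = (\<Sum>p\<in>{p\<in>S. dyadic_index p = m}. q p) / 2 ^ m"
        unfolding sum_divide_distrib by (intro sum.cong) auto
      ultimately show "(\<Sum>p\<in>{p\<in>S. dyadic_index p = m}. q p / 2 ^ dyadic_index p) = (A m - A (m - 1)) / 2 ^ m"
        by simp
    qed
    also have "\<dots> \<ge> (\<Sum>m\<in>{m0<..M}. k / 8 * (1 / real m))"
      using m0 by (intro sum_mono step) auto
    finally have 1: "k / 8 * (\<Sum>m\<in>{m0<..M}. 1 / real m) \<le>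
       (\<Sum>p | prime p \<and> p \<le> X. q p * (dyadic_weight m0 X p * real p powr (- 1)))"
      by (simp add: sum_distrib_left)
    have "ln (real M + 1) - ln (real m0 + 1) \<le> (\<Sum>m\<in>{m0<..M}. 1 / real m)"
    proof (cases "m0 \<le> M")
      case True
      then show ?thesis
      proof (induction M rule: dec_induct)
        case (step M)
        have "ln (real (Suc M) + 1) - ln (real M + 1) = ln ((real M + 2) / (real M + 1))"
          by (simp add: ln_div add_ac)
        also have "\<dots> \<le> (real M + 2) / (real M + 1) - 1" by (intro ln_le_minus_one) simp
        also have "\<dots> = 1 / real (Suc M)" by (simp add: field_simps)
        finally have "ln (real (Suc M) + 1) - ln (real M + 1) \<le> 1 / real (Suc M)" .
        moreover have "{m0<..Suc M} = insert (Suc M) {m0<..M}" using step by auto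
        ultimately show ?case using step by simp
      qed simp
    next
      case False
      then have "ln (real M + 1) \<le> ln (real m0 + 1)" by simp
      moreover have "0 \<le> (\<Sum>m\<in>{m0<..M}. 1 / real m)" by (intro sum_nonneg) simp
      ultimately show ?thesis by linarith
    qed
    then have "k / 8 * (ln (real M + 1) - ln (real m0 + 1)) \<le> k / 8 * (\<Sum>m\<in>{m0<..M}. 1 / real m)"
      using k by (intro mult_left_mono) auto
    then show ?thesis using 1 by linarith
  qed
  then show ?thesis unfolding eventually_sequentially by blast
qed

text \<open>The limit \<open>\<kappa> h g\<close> enters with coefficient
  \<open>\<epsilon> h * \<epsilon> g\<close>; orthogonality leaves only g = h, where the signs
  multiply to 1. Hence one resonator pushes every log |L_h| in its own prescribed direction.\<close>

lemma resonator_correlation_limit: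
  fixes H n h :: nat and a :: "nat \<Rightarrow> nat \<Rightarrow> complex" and \<kappa> :: "nat \<Rightarrow> nat \<Rightarrow> real"
  defines "\<epsilon> \<equiv> resonator_sign H"
  defines "q \<equiv> \<lambda>p. Re (a h p * (\<Sum>g\<in>{1..n}. of_real (\<epsilon> g) * cnj (a g p)))"
  assumes orth: "\<forall>g\<in>{1..n}.
       ((\<lambda>x::real. complex_of_real (ln x / x) *
           (\<Sum>p\<in>{p::nat. prime p \<and> real p \<le> x}. a h p * cnj (a g p)))
        \<longlongrightarrow> complex_of_real (\<kappa> h g)) at_top"
    and off: "\<forall>g\<in>{1..n}. h \<noteq> g \<longrightarrow> \<kappa> h g = 0" and h: "h \<in> {1..n}"
  shows "((\<lambda>x::real. ln x / x * (\<Sum>p | prime p \<and> real p \<le> x. \<epsilon> h * q p)) \<longlongrightarrow> \<kappa> h h) at_top"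
proof -
  have "((\<lambda>x::real. \<Sum>g\<in>{1..n}. \<epsilon> h * \<epsilon> g * Re (complex_of_real (ln x / x) *
           (\<Sum>p\<in>{p::nat. prime p \<and> real p \<le> x}. a h p * cnj (a g p)))) \<longlongrightarrow>
      (\<Sum>g\<in>{1..n}. \<epsilon> h * \<epsilon> g * Re (complex_of_real (\<kappa> h g)))) at_top"
    using orth by (intro tendsto_sum tendsto_mult tendsto_const tendsto_Re) auto
  moreover have "(\<Sum>g\<in>{1..n}. \<epsilon> h * \<epsilon> g * Re (complex_of_real (\<kappa> h g))) = \<kappa> h h"
  proof -
    have "(\<Sum>g\<in>{1..n}. \<epsilon> h * \<epsilon> g * Re (complex_of_real (\<kappa> h g))) = (\<Sum>g\<in>{1..n}. if g = h then \<kappa> h h else 0)"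
      using off by (intro sum.cong) (auto simp: \<epsilon>_def resonator_sign_def)
    then show ?thesis using h by simp
  qed
  moreover have "(\<Sum>g\<in>{1..n}. \<epsilon> h * \<epsilon> g * Re (complex_of_real (ln x / x) *
           (\<Sum>p\<in>{p::nat. prime p \<and> real p \<le> x}. a h p * cnj (a g p)))) =
      ln x / x * (\<Sum>p | prime p \<and> real p \<le> x. \<epsilon> h * q p)" for x :: real
  proof -
    have Rm: "Re (of_real y * z) = y * Re z" for y z by simp
    have qe: "q p = (\<Sum>g\<in>{1..n}. \<epsilon> g * Re (a h p * cnj (a g p)))" for p
    proof -
      have "a h p * (\<Sum>g\<in>{1..n}. of_real (\<epsilon> g) * cnj (a g p)) = (\<Sum>g\<in>{1..n}. of_real (\<epsilon> g) * (a h p * cnj (a g p)))"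
        by (simp only: sum_distrib_left mult_ac)
      then show ?thesis unfolding q_def by (simp only: Re_sum Rm)
    qed
    have "(\<Sum>g\<in>{1..n}. \<epsilon> h * \<epsilon> g * Re (complex_of_real (ln x / x) *
           (\<Sum>p\<in>{p::nat. prime p \<and> real p \<le> x}. a h p * cnj (a g p)))) =
      (\<Sum>g\<in>{1..n}. \<Sum>p | prime p \<and> real p \<le> x. ln x / x * (\<epsilon> h * (\<epsilon> g * Re (a h p * cnj (a g p)))))"
      unfolding Rm Re_sum sum_distrib_left by (intro sum.cong refl) (simp only: mult_ac)
    also have "\<dots> = (\<Sum>p | prime p \<and> real p \<le> x. \<Sum>g\<in>{1..n}. ln x / x * (\<epsilon> h * (\<epsilon> g * Re (a h p * cnj (a g p)))))"
      by (rule sum.swap)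
    also have "\<dots> = ln x / x * (\<Sum>p | prime p \<and> real p \<le> x. \<epsilon> h * q p)"
      unfolding qe by (simp only: sum_distrib_left)
    finally show ?thesis .
  qed
  ultimately show ?thesis by simp
qed

text \<open>Halving \<alpha>/10 absorbs the rounding.\<close>

lemma eventually_floor_ln_ge:
  assumes "0 < \<alpha>" "\<alpha> < 1"
  shows "\<forall>\<^sub>F T in at_top. \<alpha> / 20 * ln T \<le> real (nat \<lfloor>\<alpha> / 10 * ln T\<rfloor>) \<and>
    real (nat \<lfloor>\<alpha> / 10 * ln T\<rfloor>) \<le> ln T \<and> nat \<lfloor>\<alpha> / 10 * ln T\<rfloor> \<ge> 3"
proof -
  have "\<forall>\<^sub>F T in at_top. \<alpha> / 10 * ln T \<ge> 4" using assms by real_asymp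
  then show ?thesis using eventually_ge_at_top[of 1]
  proof eventually_elim
    case (elim T)
    define y where "y = \<alpha> / 10 * ln T"
    have y: "y \<ge> 4" "\<alpha> / 20 * ln T = y / 2" using elim by (auto simp: y_def)
    have "y \<le> 1 * ln T" unfolding y_def using assms elim by (intro mult_right_mono) auto
    then show ?case unfolding y_def[symmetric] y(2) using y(1) by linarith
  qed
qed

theorem theorem2:
  fixes H G :: nat
    and a :: "nat \<Rightarrow> nat \<Rightarrow> complex"
    and F :: "nat \<Rightarrow> complex \<Rightarrow> complex"
    and \<kappa> :: "nat \<Rightarrow> nat \<Rightarrow> real"
    and \<sigma>0 \<alpha> :: real
  assumes poly: "\<forall>h\<in>{1..H+G}. selberg_poly (a h) (F h)"
    and ram: "\<forall>h\<in>{1..H+G}. ramanujan (a h)"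
    and orth: "\<forall>h\<in>{1..H+G}. \<forall>g\<in>{1..H+G}.
       ((\<lambda>x::real. complex_of_real (ln x / x) *
           (\<Sum>p\<in>{p::nat. prime p \<and> real p \<le> x}. a h p * cnj (a g p)))
        \<longlongrightarrow> complex_of_real (\<kappa> h g)) at_top"
    and kpos: "\<forall>h\<in>{1..H+G}. \<kappa> h h > 0"
    and koff: "\<forall>h\<in>{1..H+G}. \<forall>g\<in>{1..H+G}. h \<noteq> g \<longrightarrow> \<kappa> h g = 0"
    and s0: "1/2 < \<sigma>0" "\<sigma>0 < 1"
    and al: "0 < \<alpha>" "\<alpha> < 1"
    and dens: "(\<lambda>T. real (\<Sum>h\<in>{1..H+G}. zero_count (F h) \<sigma>0 T)) \<in> o[at_top](\<lambda>T. T powr (1 - \<alpha>))"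
  shows "\<exists>D>0.
     (\<forall>\<sigma>. \<sigma>0 < \<sigma> \<and> \<sigma> < 1 \<longrightarrow>
        (\<forall>\<^sub>F T in at_top. big_values F H G \<sigma> T (exp (D * ln T powr (1 - \<sigma>) / ln (ln T))))) \<and>
     (\<forall>\<^sub>F T in at_top. big_values F H G 1 T (ln (ln T) powr D))"
proof (cases "H + G = 0")
  case True
  \<comment> \<open>Without any functions only a point of [T, 2T] is required, for which T \<ge> 0
    suffices. The case is separated because the minimum \<open>k\<close> below needs a nonempty
    set.\<close>
  have "\<forall>\<^sub>F T in at_top. big_values F H G \<sigma> T (V T)" for \<sigma> V
    using eventually_ge_at_top[of 0]
    by eventually_elim (use True in \<open>auto simp: big_values_def intro!: bexI\<close>)
  then show ?thesis by (intro exI[of _ 1]) auto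
next
  case False
  define I where "I = {1..H+G}"
  have I: "finite I" "I \<noteq> {}" using False by (auto simp: I_def)
  define \<epsilon> where "\<epsilon> = resonator_sign H"
  define q where "q h p = Re (a h p * (\<Sum>g\<in>I. of_real (\<epsilon> g) * cnj (a g p)))" for h p
  have "\<forall>g\<in>I. \<exists>d\<ge>0. \<forall>p. prime p \<longrightarrow> norm (a g p) \<le> d"
    using poly ram prime_coefficients_bounded unfolding I_def by blast
  from bchoice[OF this] obtain d where d: "\<And>g. g \<in> I \<Longrightarrow> d g \<ge> 0"
    "\<And>g p. g \<in> I \<Longrightarrow> prime p \<Longrightarrow> norm (a g p) \<le> d g" by blast
  \<comment> \<open>The summand 1 only serves to make \<Delta> positive.\<close>
  define \<Delta> where "\<Delta> = 1 + (\<Sum>g\<in>I. d g)"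
  have \<Delta>: "\<Delta> > 0" unfolding \<Delta>_def using d(1) by (intro add_pos_nonneg sum_nonneg) auto
  have \<Delta>2: "norm (\<Sum>g\<in>I. of_real (\<epsilon> g) * cnj (a g p)) \<le> \<Delta>" if "prime p" for p
  proof -
    have "norm (\<Sum>g\<in>I. of_real (\<epsilon> g) * cnj (a g p)) \<le> (\<Sum>g\<in>I. d g)"
      using d(2) that by (intro sum_norm_le) (auto simp: norm_mult \<epsilon>_def resonator_sign_def)
    then show ?thesis by (simp add: \<Delta>_def)
  qed
  define k where "k = Min ((\<lambda>h. \<kappa> h h) ` I)"
  have k: "k > 0" unfolding k_def using I kpos by (subst Min_gr_iff) (auto simp: I_def)
  have kle: "k \<le> \<kappa> h h" if "h \<in> I" for h unfolding k_def using I that by (intro Min_le) auto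
  have lim: "((\<lambda>x::real. ln x / x * (\<Sum>p | prime p \<and> real p \<le> x. \<epsilon> h * q h p)) \<longlongrightarrow> \<kappa> h h) at_top" if "h \<in> I" for h
    unfolding \<epsilon>_def q_def I_def using orth koff that unfolding I_def
    by (intro resonator_correlation_limit) auto
  have \<kappa>: "\<kappa> h h > 0" if "h \<in> I" for h using kpos that by (simp add: I_def)
  note weights = big_values_from_weights[OF poly ram s0(1) _ _ al dens \<Delta>, folded I_def \<epsilon>_def, OF _ _ \<Delta>2, folded q_def]
  \<comment> \<open>The weights deliver an exponent of at least 2 * D1 * (log T)^(1-\<sigma>) / log
    log T for \<sigma> < 1, and 2 * D2 * log log X up to a constant for \<sigma> = 1; half of it
    absorbs the constant K. \<open>D1\<close> must not depend on \<sigma>, so the factor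
    (\<alpha>/20)^(1-\<sigma>) is replaced by its lower bound \<alpha>/20.\<close>
  define D1 where "D1 = k * \<alpha> / (160 * \<Delta>)"
  define D2 where "D2 = k / (32 * \<Delta>)"
  have D: "D1 > 0" "D2 > 0" using k al \<Delta> by (auto simp: D1_def D2_def)
  have A: "\<forall>\<^sub>F T in at_top. big_values F H G \<sigma> T (exp (D1 * ln T powr (1 - \<sigma>) / ln (ln T)))"
    if \<sigma>: "\<sigma>0 < \<sigma>" "\<sigma> < 1" for \<sigma>
  proof -
    define B where "B X = k / 2 * real X powr (1 - \<sigma>) / ln (real X)" for X :: nat
    \<comment> \<open>The truncation at X keeps the weight at most 1 for every p.\<close>
    define \<omega> where "\<omega> X p = (if p \<le> X then (real p / real X) powr \<sigma> else 0)" for X p :: nat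
    have \<omega>: "0 \<le> \<omega> X p" "\<omega> X p \<le> 1" for X p
      using \<sigma> s0 by (auto simp: \<omega>_def divide_le_eq_1 intro!: powr_le1)
    have "\<forall>\<^sub>F X in at_top. \<forall>h\<in>I. \<kappa> h h / 2 * real X powr (1 - \<sigma>) / ln (real X) \<le>
       (\<Sum>p | prime p \<and> p \<le> X. \<epsilon> h * q h p * ((real p / real X) powr \<sigma> * real p powr (- \<sigma>)))"
      using lim \<kappa> by (intro eventually_ball_finite I(1) ballI sum_power_weight_lower)
    then have low: "\<forall>\<^sub>F X in at_top. \<forall>h\<in>I. B X \<le> \<epsilon> h * (\<Sum>p | prime p \<and> p \<le> X. q h p * (\<omega> X p * real p powr (- \<sigma>)))"
      using eventually_ge_at_top[of 2]
    proof eventually_elim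
      case (elim X)
      show ?case
      proof
        fix h assume h: "h \<in> I"
        have "B X \<le> \<kappa> h h / 2 * real X powr (1 - \<sigma>) / ln (real X)"
          unfolding B_def using kle[OF h] elim(2) by (intro divide_right_mono mult_right_mono) auto
        also have "\<dots> \<le> (\<Sum>p | prime p \<and> p \<le> X. \<epsilon> h * q h p * ((real p / real X) powr \<sigma> * real p powr (- \<sigma>)))"
          using elim(1) h by blast
        also have "\<dots> = \<epsilon> h * (\<Sum>p | prime p \<and> p \<le> X. q h p * (\<omega> X p * real p powr (- \<sigma>)))"
          unfolding sum_distrib_left by (intro sum.cong) (auto simp: \<omega>_def)
        finally show "B X \<le> \<epsilon> h * (\<Sum>p | prime p \<and> p \<le> X. q h p * (\<omega> X p * real p powr (- \<sigma>)))" .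
      qed
    qed
    have "\<exists>K. \<forall>\<^sub>F T in at_top. big_values F H G \<sigma> T (exp (B (nat \<lfloor>\<alpha> / 10 * ln T\<rfloor>) / (2 * \<Delta>) - K))"
      using \<sigma> by (intro weights[where \<omega> = \<omega>] \<omega> low) auto
    then obtain K where K: "\<forall>\<^sub>F T in at_top. big_values F H G \<sigma> T (exp (B (nat \<lfloor>\<alpha> / 10 * ln T\<rfloor>) / (2 * \<Delta>) - K))" ..
    have "filterlim (\<lambda>T::real. D1 * ln T powr (1 - \<sigma>) / ln (ln T)) at_top at_top"
      using D(1) \<sigma> by real_asymp
    then have big: "\<forall>\<^sub>F T in at_top. K \<le> D1 * ln T powr (1 - \<sigma>) / ln (ln T)"
      by (simp add: filterlim_at_top)
    have "\<forall>\<^sub>F T::real in at_top. ln (ln T) > 0" by real_asymp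
    from K big this eventually_floor_ln_ge[OF al] show ?thesis
    proof eventually_elim
      case (elim T)
      define X where "X = nat \<lfloor>\<alpha> / 10 * ln T\<rfloor>"
      have X: "\<alpha> / 20 * ln T \<le> real X" "real X \<le> ln T" "X \<ge> 3" using elim(4) by (auto simp: X_def)
      have lnT: "ln T \<ge> 3" using X by linarith
      have lnX: "0 < ln (real X)" "ln (real X) \<le> ln (ln T)" using X by (auto simp: ln_le_cancel_iff)
      have "(\<alpha> / 20) * ln T powr (1 - \<sigma>) \<le> (\<alpha> / 20) powr (1 - \<sigma>) * ln T powr (1 - \<sigma>)"
      proof (rule mult_right_mono)
        have "(\<alpha> / 20) powr 1 \<le> (\<alpha> / 20) powr (1 - \<sigma>)" using al \<sigma> s0 by (intro powr_mono') auto
        then show "\<alpha> / 20 \<le> (\<alpha> / 20) powr (1 - \<sigma>)" using al by simp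
      qed simp
      also have "\<dots> = (\<alpha> / 20 * ln T) powr (1 - \<sigma>)" using powr_mult[of "\<alpha> / 20" "ln T" "1 - \<sigma>"] al lnT by simp
      also have "\<dots> \<le> real X powr (1 - \<sigma>)" using X \<sigma> al lnT by (intro powr_mono2) auto
      finally have P: "(\<alpha> / 20) * ln T powr (1 - \<sigma>) \<le> real X powr (1 - \<sigma>)" .
      have "k / 2 * ((\<alpha> / 20) * ln T powr (1 - \<sigma>)) / ln (ln T) \<le> k / 2 * real X powr (1 - \<sigma>) / ln (real X)"
        using P k al lnX by (intro frac_le mult_left_mono) auto
      then have "k / 2 * ((\<alpha> / 20) * ln T powr (1 - \<sigma>)) / ln (ln T) / (2 * \<Delta>) \<le> B X / (2 * \<Delta>)"
        unfolding B_def using \<Delta> by (intro divide_right_mono) auto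
      moreover have "k / 2 * ((\<alpha> / 20) * ln T powr (1 - \<sigma>)) / ln (ln T) / (2 * \<Delta>) =
          2 * (D1 * ln T powr (1 - \<sigma>) / ln (ln T))"
        by (simp add: D1_def mult_ac)
      ultimately have "D1 * ln T powr (1 - \<sigma>) / ln (ln T) \<le> B X / (2 * \<Delta>) - K" using elim(2) by linarith
      then show ?case using elim(1) unfolding X_def by (elim big_values_mono) simp
    qed
  qed
  have C: "\<forall>\<^sub>F T in at_top. big_values F H G 1 T (ln (ln T) powr D2)"
  proof -
    have "\<forall>\<^sub>F m0 in at_top. \<forall>h\<in>I. \<forall>M X. 2 ^ M \<le> X \<longrightarrow> X < 2 ^ (M + 1) \<longrightarrow>
      \<kappa> h h / 8 * (ln (real M + 1) - ln (real m0 + 1)) \<le>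
      (\<Sum>p | prime p \<and> p \<le> X. \<epsilon> h * q h p * (dyadic_weight m0 X p * real p powr (- 1)))"
      using lim \<kappa> by (intro eventually_ball_finite I(1) ballI sum_dyadic_weight_lower)
    then obtain m0 where m0: "\<forall>h\<in>I. \<forall>M X. 2 ^ M \<le> X \<longrightarrow> X < 2 ^ (M + 1) \<longrightarrow>
      \<kappa> h h / 8 * (ln (real M + 1) - ln (real m0 + 1)) \<le>
      (\<Sum>p | prime p \<and> p \<le> X. \<epsilon> h * q h p * (dyadic_weight m0 X p * real p powr (- 1)))"
      unfolding eventually_sequentially by blast
    define B where "B X = k / 8 * (ln (ln (real X)) - ln (real m0 + 1))" for X :: nat
    have "filterlim (\<lambda>X::nat. ln (real X)) at_top at_top" by real_asymp
    \<comment> \<open>This makes the bracket in \<open>B X\<close> nonnegative, so that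
      \<open>k\<close> may be replaced by the possibly larger \<open>\<kappa> h h\<close>.\<close>
    then have "\<forall>\<^sub>F X::nat in at_top. ln (real X) \<ge> real m0 + 1" by (simp add: filterlim_at_top)
    then have low: "\<forall>\<^sub>F X in at_top. \<forall>h\<in>I. B X \<le> \<epsilon> h * (\<Sum>p | prime p \<and> p \<le> X. q h p * (dyadic_weight m0 X p * real p powr (- 1)))"
      using eventually_ge_at_top[of 1]
    proof eventually_elim
      case (elim X)
      obtain M where M: "2 ^ M \<le> X" "X < 2 ^ (M + 1)" using ex_power_ivl1[of 2 X] elim(2) by auto
      have "real X < real (2 ^ (M + 1))" using M(2) by (simp only: of_nat_less_iff)
      then have "ln (real X) \<le> ln (2 ^ (M + 1))" using elim(2) by (subst ln_le_cancel_iff) auto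
      also have "\<dots> = real (M + 1) * ln 2" by (rule ln_realpow)
      also have "\<dots> \<le> real (M + 1) * 1" using ln2_le_25_over_36 by (intro mult_left_mono) auto
      finally have lM: "ln (real X) \<le> real M + 1" by simp
      show ?case
      proof
        fix h assume h: "h \<in> I"
        have "ln (real m0 + 1) \<le> ln (ln (real X))" "ln (ln (real X)) \<le> ln (real M + 1)"
          using elim(1) lM by (auto simp: ln_le_cancel_iff)
        then have "B X \<le> \<kappa> h h / 8 * (ln (real M + 1) - ln (real m0 + 1))"
          unfolding B_def using kle[OF h] k by (intro mult_mono) auto
        also have "\<dots> \<le> (\<Sum>p | prime p \<and> p \<le> X. \<epsilon> h * q h p * (dyadic_weight m0 X p * real p powr (- 1)))"
          using m0 h M by blast
        also have "\<dots> = \<epsilon> h * (\<Sum>p | prime p \<and> p \<le> X. q h p * (dyadic_weight m0 X p * real p powr (- 1)))"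
          unfolding sum_distrib_left by (simp only: mult.assoc)
        finally show "B X \<le> \<epsilon> h * (\<Sum>p | prime p \<and> p \<le> X. q h p * (dyadic_weight m0 X p * real p powr (- 1)))" .
      qed
    qed
    have "\<exists>K. \<forall>\<^sub>F T in at_top. big_values F H G 1 T (exp (B (nat \<lfloor>\<alpha> / 10 * ln T\<rfloor>) / (2 * \<Delta>) - K))"
      using s0 by (intro weights[where \<omega> = "dyadic_weight m0"] dyadic_weight_bounds low) auto
    then obtain K where K: "\<forall>\<^sub>F T in at_top. big_values F H G 1 T (exp (B (nat \<lfloor>\<alpha> / 10 * ln T\<rfloor>) / (2 * \<Delta>) - K))" ..
    \<comment> \<open>The target is exp (D2 * log log log T), while the weights give twice this
      exponent with X in place of log T. The excess diverges and covers both K and the loss from the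
      blocks up to m0.\<close>
    have "filterlim (\<lambda>T. 2 * D2 * ln (ln (\<alpha> / 20 * ln T)) - D2 * ln (ln (ln T))) at_top at_top"
      using D(2) al by real_asymp
    then have "\<forall>\<^sub>F T in at_top. 2 * D2 * ln (real m0 + 1) + K \<le> 2 * D2 * ln (ln (\<alpha> / 20 * ln T)) - D2 * ln (ln (ln T))"
      by (simp add: filterlim_at_top)
    moreover have "\<forall>\<^sub>F T in at_top. \<alpha> / 20 * ln T > 3" using al by real_asymp
    moreover have "\<forall>\<^sub>F T::real in at_top. ln (ln T) > 0" by real_asymp
    ultimately show ?thesis using K eventually_floor_ln_ge[OF al]
    proof eventually_elim
      case (elim T)
      define X where "X = nat \<lfloor>\<alpha> / 10 * ln T\<rfloor>"
      have X: "\<alpha> / 20 * ln T \<le> real X" using elim(5) by (auto simp: X_def)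
      have "0 < ln (\<alpha> / 20 * ln T)" using elim(2) by (intro ln_gt_zero) linarith
      moreover have "ln (\<alpha> / 20 * ln T) \<le> ln (real X)" using elim(2) X by (subst ln_le_cancel_iff) linarith+
      ultimately have "ln (ln (\<alpha> / 20 * ln T)) \<le> ln (ln (real X))" by (subst ln_le_cancel_iff) linarith+
      then have "2 * D2 * ln (ln (\<alpha> / 20 * ln T)) \<le> 2 * D2 * ln (ln (real X))" using D(2) by simp
      moreover have "B X / (2 * \<Delta>) = 2 * D2 * ln (ln (real X)) - 2 * D2 * ln (real m0 + 1)"
        by (simp add: B_def D2_def right_diff_distrib diff_divide_distrib mult_ac)
      ultimately have "D2 * ln (ln (ln T)) \<le> B X / (2 * \<Delta>) - K" using elim(1) by linarith
      moreover have "ln (ln T) powr D2 = exp (D2 * ln (ln (ln T)))" using elim(3) by (simp add: powr_def)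
      ultimately show ?case using elim(4) unfolding X_def by (elim big_values_mono) simp
    qed
  qed
  show ?thesis
  proof (intro exI[of _ "min D1 D2"] conjI allI impI)
    show "min D1 D2 > 0" using D by simp
    fix \<sigma> assume \<sigma>: "\<sigma>0 < \<sigma> \<and> \<sigma> < 1"
    have "\<forall>\<^sub>F T::real in at_top. ln (ln T) > 0" by real_asymp
    then show "\<forall>\<^sub>F T in at_top. big_values F H G \<sigma> T (exp (min D1 D2 * ln T powr (1 - \<sigma>) / ln (ln T)))"
      using A[of \<sigma>, OF conjunct1[OF \<sigma>] conjunct2[OF \<sigma>]]
    proof eventually_elim
      case (elim T)
      have "min D1 D2 * ln T powr (1 - \<sigma>) / ln (ln T) \<le> D1 * ln T powr (1 - \<sigma>) / ln (ln T)"
        using elim(1) by (intro divide_right_mono mult_right_mono) auto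
      then show ?case using elim(2) by (elim big_values_mono) simp
    qed
  next
    have "\<forall>\<^sub>F T::real in at_top. ln (ln T) \<ge> 1" by real_asymp
    then show "\<forall>\<^sub>F T in at_top. big_values F H G 1 T (ln (ln T) powr min D1 D2)"
      using C
    proof eventually_elim
      case (elim T)
      have "ln (ln T) powr min D1 D2 \<le> ln (ln T) powr D2" using elim(1) by (intro powr_mono) auto
      then show ?case using elim(2) by (elim big_values_mono)
    qed
  qed
qed

end
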